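(* Let $A$, $B$ and $C$ be dg algebras with enough idempotents. The assignment $(U,X)\mapsto U\otimes_BX$ is the definition on objects of a dg functor $$?\otimes_B?:(C-Dg-B)\otimes(B-Dg-A)\longrightarrow C-Dg-A.$$
   Context: $K$ is a fixed commutative ring with unit, $\otimes=\otimes_K$, $|x|$ is degree. A dg category is a $K$-linear category whose Hom's are dg $K$-modules with composition of degree zero and $d(g\circ f)=d(g)\circ f+(-1)^{|g|}g\circ d(f)$; a dg functor is a $K$-linear functor preserving degrees and commuting with differentials on Hom's. The tensor product dg category $\mathcal{A}\otimes\mathcal{B}$ has pairs as objects, Hom's $\mathcal{A}(A,A')\otimes\mathcal{B}(B,B')$ with differential $d(\alpha\otimes\beta)=d(\alpha)\otimes\beta+(-1)^{|\alpha|}\alpha\otimes d(\beta)$, and composition $(\alpha_1\otimes\beta_1)\circ(\alpha_2\otimes\beta_2)=(-1)^{|\alpha_2||\beta_1|}(\alpha_1\alpha_2)\otimes(\beta_1\beta_2)$. A dg algebra with enough idempotents is a graded associative $K$-algebra $A$ having a family $(e_i)_{i\in I}$ of nonzero orthogonal degree-$0$ idempotents with $A=\bigoplus e_iA=\bigoplus Ae_i$, with a degree $+1$ square-zero map $d$ with $d(e_i)=0$ and $d(ab)=d(a)b+(-1)^{|a|}ad(b)$. Modules and bimodules are unitary. A dg $B-A-$bimodule is a graded $B-A-$bimodule $X$ with degree $+1$ square-zero $d_X$ such that $d_X(bxa)=d_B(b)xa+(-1)^{|b|}bd_X(x)a+(-1)^{|b|+|x|}bxd_A(a)$. $B-Dg-A$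 is the dg category of dg $B-A-$bimodules, where morphisms of degree $n$ are degree $n$ $K$-linear maps $f$ with $f(bxa)=(-1)^{n|b|}bf(x)a$, and $d(f)=d_Y\circ f-(-1)^{|f|}f\circ d_X$. For $U$ in $C-Dg-B$ and $X$ in $B-Dg-A$, $U\otimes_BX$ is the quotient of $U\otimes X$ by the $K$-submodule generated by the elements $ub\otimes x-u\otimes bx$, with multiplication $c(u\otimes x)a=cu\otimes xa$ and differential induced by $d(u\otimes x)=d_U(u)\otimes x+(-1)^{|u|}u\otimes d_X(x)$; it is a dg $C-A-$bimodule. The functor meant acts on homogeneous morphisms $\alpha:U\to V$ in $C-Dg-B$ and $\varphi:X\to Y$ in $B-Dg-A$ by sending $\alpha\otimes\varphi$ to the map $U\otimes_BX\to V\otimes_BY$, $u\otimes x\mapsto(-1)^{|\varphi||u|}\alpha(u)\otimes\varphi(x)$. *)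

theory Defs
  imports "HOL-Algebra.Module" "HOL-Algebra.AbelCoset"
begin

text \<open>
  Modules are \<open>('k, 'm) module\<close> records of HOL-Algebra, whose ring fields \<open>mult\<close> and \<open>one\<close> carry no
  information for a module. For an algebra \<open>mult\<close> is the product and \<open>one\<close> is still ignored:
  algebras with enough idempotents need not be unital.
\<close>

section \<open>Linear algebra over a commutative ring\<close>

definition linear_map ::
  "'k ring \<Rightarrow> ('k, 'm, 'r) module_scheme \<Rightarrow> ('k, 'n, 's) module_scheme \<Rightarrow> ('m \<Rightarrow> 'n) \<Rightarrow> bool" where
  "linear_map K M N f \<longleftrightarrow>
     f \<in> carrier M \<rightarrow> carrier N \<and>
     (\<forall>x\<in>carrier M. \<forall>y\<in>carrier M. f (x \<oplus>\<^bsub>M\<^esub> y) = f x \<oplus>\<^bsub>N\<^esub> f y) \<and>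
     (\<forall>k\<in>carrier K. \<forall>x\<in>carrier M. f (k \<odot>\<^bsub>M\<^esub> x) = k \<odot>\<^bsub>N\<^esub> f x)"

definition bilinear_map ::
  "'k ring \<Rightarrow> ('k, 'm, 'r) module_scheme \<Rightarrow> ('k, 'n, 's) module_scheme \<Rightarrow> ('k, 'p, 't) module_scheme
    \<Rightarrow> ('m \<Rightarrow> 'n \<Rightarrow> 'p) \<Rightarrow> bool" where
  "bilinear_map K M N P f \<longleftrightarrow>
     (\<forall>x\<in>carrier M. linear_map K N P (f x)) \<and>
     (\<forall>y\<in>carrier N. linear_map K M P (\<lambda>x. f x y))"

definition span_mod :: "'k ring \<Rightarrow> ('k, 'm, 'r) module_scheme \<Rightarrow> 'm set \<Rightarrow> 'm set" where
  "span_mod K M S = \<Inter>{H. submodule H K M \<and> S \<subseteq> H}"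

definition decomposes ::
  "('k, 'm, 'r) module_scheme \<Rightarrow> 'i set \<Rightarrow> ('i \<Rightarrow> 'm set) \<Rightarrow> 'm \<Rightarrow> ('i \<Rightarrow> 'm) \<Rightarrow> bool" where
  "decomposes M I S x c \<longleftrightarrow>
     (\<forall>i\<in>I. c i \<in> S i) \<and> (\<forall>i. i \<notin> I \<longrightarrow> c i = \<zero>\<^bsub>M\<^esub>) \<and> finite {i. c i \<noteq> \<zero>\<^bsub>M\<^esub>} \<and>
     x = (\<Oplus>\<^bsub>M\<^esub>i\<in>{i. c i \<noteq> \<zero>\<^bsub>M\<^esub>}. c i)"

definition internal_direct_sum ::
  "'k ring \<Rightarrow> ('k, 'm, 'r) module_scheme \<Rightarrow> 'i set \<Rightarrow> ('i \<Rightarrow> 'm set) \<Rightarrow> bool" where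
  "internal_direct_sum K M I S \<longleftrightarrow>
     (\<forall>i\<in>I. submodule (S i) K M) \<and> (\<forall>x\<in>carrier M. \<exists>!c. decomposes M I S x c)"

definition quot_mod :: "('k, 'm, 'r) module_scheme \<Rightarrow> 'm set \<Rightarrow> ('k, 'm set) module" where
  "quot_mod M N =
     \<lparr>carrier = a_rcosets\<^bsub>M\<^esub> N, mult = undefined, one = undefined, zero = N, add = set_add M,
      smult = (\<lambda>k S. \<Union>s\<in>S. N +>\<^bsub>M\<^esub> (k \<odot>\<^bsub>M\<^esub> s))\<rparr>"

text \<open>The endomap of \<open>M / N\<close> induced by an additive endomap \<open>h\<close> of \<open>M\<close> that preserves \<open>N\<close>.\<close>

definition quot_map ::
  "('k, 'm, 'r) module_scheme \<Rightarrow> 'm set \<Rightarrow> ('m \<Rightarrow> 'm) \<Rightarrow> 'm set \<Rightarrow> 'm set" where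
  "quot_map M N h S = the_elem ((\<lambda>s. N +>\<^bsub>M\<^esub> h s) ` S)"

section \<open>Tensor product of modules\<close>

definition free_mod :: "'k ring \<Rightarrow> 's set \<Rightarrow> ('k, 's \<Rightarrow> 'k) module" where
  "free_mod K S =
     \<lparr>carrier = {f. (\<forall>p. f p \<in> carrier K) \<and> (\<forall>p. p \<notin> S \<longrightarrow> f p = \<zero>\<^bsub>K\<^esub>) \<and> finite {p. f p \<noteq> \<zero>\<^bsub>K\<^esub>}},
      mult = undefined, one = undefined, zero = (\<lambda>p. \<zero>\<^bsub>K\<^esub>), add = (\<lambda>f g p. f p \<oplus>\<^bsub>K\<^esub> g p),
      smult = (\<lambda>k f p. k \<otimes>\<^bsub>K\<^esub> f p)\<rparr>"

definition free_gen :: "'k ring \<Rightarrow> 's \<Rightarrow> 's \<Rightarrow> 'k" where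
  "free_gen K p = (\<lambda>q. if q = p then \<one>\<^bsub>K\<^esub> else \<zero>\<^bsub>K\<^esub>)"

definition tensor_free ::
  "'k ring \<Rightarrow> ('k, 'm, 'r) module_scheme \<Rightarrow> ('k, 'n, 's) module_scheme \<Rightarrow> ('k, 'm \<times> 'n \<Rightarrow> 'k) module" where
  "tensor_free K M N = free_mod K (carrier M \<times> carrier N)"

definition tensor_relators ::
  "'k ring \<Rightarrow> ('k, 'm, 'r) module_scheme \<Rightarrow> ('k, 'n, 's) module_scheme \<Rightarrow> ('m \<times> 'n \<Rightarrow> 'k) set" where
  "tensor_relators K M N =
    (let F = tensor_free K M N; g = (\<lambda>x y. free_gen K (x, y)) in
     {g (x \<oplus>\<^bsub>M\<^esub> x') y \<ominus>\<^bsub>F\<^esub> (g x y \<oplus>\<^bsub>F\<^esub> g x' y) |x x' y.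
        x \<in> carrier M \<and> x' \<in> carrier M \<and> y \<in> carrier N} \<union>
     {g x (y \<oplus>\<^bsub>N\<^esub> y') \<ominus>\<^bsub>F\<^esub> (g x y \<oplus>\<^bsub>F\<^esub> g x y') |x y y'.
        x \<in> carrier M \<and> y \<in> carrier N \<and> y' \<in> carrier N} \<union>
     {g (k \<odot>\<^bsub>M\<^esub> x) y \<ominus>\<^bsub>F\<^esub> (k \<odot>\<^bsub>F\<^esub> g x y) |k x y.
        k \<in> carrier K \<and> x \<in> carrier M \<and> y \<in> carrier N} \<union>
     {g x (k \<odot>\<^bsub>N\<^esub> y) \<ominus>\<^bsub>F\<^esub> (k \<odot>\<^bsub>F\<^esub> g x y) |k x y.
        k \<in> carrier K \<and> x \<in> carrier M \<and> y \<in> carrier N})"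

definition tensor_kernel ::
  "'k ring \<Rightarrow> ('k, 'm, 'r) module_scheme \<Rightarrow> ('k, 'n, 's) module_scheme \<Rightarrow> ('m \<times> 'n \<Rightarrow> 'k) set" where
  "tensor_kernel K M N = span_mod K (tensor_free K M N) (tensor_relators K M N)"

definition tensor_mod ::
  "'k ring \<Rightarrow> ('k, 'm, 'r) module_scheme \<Rightarrow> ('k, 'n, 's) module_scheme
    \<Rightarrow> ('k, ('m \<times> 'n \<Rightarrow> 'k) set) module" where
  "tensor_mod K M N = quot_mod (tensor_free K M N) (tensor_kernel K M N)"

definition tens ::
  "'k ring \<Rightarrow> ('k, 'm, 'r) module_scheme \<Rightarrow> ('k, 'n, 's) module_scheme
    \<Rightarrow> 'm \<Rightarrow> 'n \<Rightarrow> ('m \<times> 'n \<Rightarrow> 'k) set" where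
  "tens K M N x y = tensor_kernel K M N +>\<^bsub>tensor_free K M N\<^esub> free_gen K (x, y)"

text \<open>
  The linear map \<open>M \<otimes> N \<rightarrow> P\<close> with \<open>x \<otimes> y \<mapsto> b x y\<close>, for a bilinear map \<open>b\<close> from \<open>M\<close> and \<open>N\<close> to \<open>P\<close>:
  its value on \<open>z\<close> is computed on any finite formal sum representing \<open>z\<close>.
\<close>

definition tensor_lift ::
  "'k ring \<Rightarrow> ('k, 'p, 't) module_scheme \<Rightarrow> ('m \<Rightarrow> 'n \<Rightarrow> 'p) \<Rightarrow> ('m \<times> 'n \<Rightarrow> 'k) set \<Rightarrow> 'p" where
  "tensor_lift K P b z =
     the_elem ((\<lambda>f. \<Oplus>\<^bsub>P\<^esub>p\<in>{p. f p \<noteq> \<zero>\<^bsub>K\<^esub>}. f p \<odot>\<^bsub>P\<^esub> b (fst p) (snd p)) ` z)"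

section \<open>Graded and dg modules\<close>

record ('k, 'm) gmod = "('k, 'm) module" +
  grade :: "int \<Rightarrow> 'm set"

record ('k, 'm) dgmod = "('k, 'm) gmod" +
  diff :: "'m \<Rightarrow> 'm"

text \<open>The sign \<open>(-1)\<^sup>n\<close> acting on \<open>x\<close>.\<close>

definition ksign :: "('k, 'm, 'r) module_scheme \<Rightarrow> int \<Rightarrow> 'm \<Rightarrow> 'm" where
  "ksign M n x = (if even n then x else \<ominus>\<^bsub>M\<^esub> x)"

definition hcomp :: "('k, 'm, 'r) gmod_scheme \<Rightarrow> 'm \<Rightarrow> int \<Rightarrow> 'm" where
  "hcomp M x = (THE c. decomposes M UNIV (grade M) x c)"

definition hsupp :: "('k, 'm, 'r) gmod_scheme \<Rightarrow> 'm \<Rightarrow> int set" where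
  "hsupp M x = {n. hcomp M x n \<noteq> \<zero>\<^bsub>M\<^esub>}"

text \<open>
  The linear extension of \<open>x \<mapsto> (-1)\<^bsup>|x|\<^esup> x\<close> from homogeneous elements to all elements. It serves to
  write formulas with Koszul signs, which are only stated for homogeneous elements, as total maps.
\<close>

definition twist :: "('k, 'm, 'r) gmod_scheme \<Rightarrow> 'm \<Rightarrow> 'm" where
  "twist M x = (\<Oplus>\<^bsub>M\<^esub>n\<in>hsupp M x. ksign M n (hcomp M x n))"

definition graded_module :: "'k ring \<Rightarrow> ('k, 'm, 'r) gmod_scheme \<Rightarrow> bool" where
  "graded_module K M \<longleftrightarrow> module K M \<and> internal_direct_sum K M UNIV (grade M)"

definition dg_module :: "'k ring \<Rightarrow> ('k, 'm, 'r) dgmod_scheme \<Rightarrow> bool" where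
  "dg_module K M \<longleftrightarrow>
     graded_module K M \<and> linear_map K M M (diff M) \<and>
     (\<forall>n. \<forall>x\<in>grade M n. diff M x \<in> grade M (n + 1)) \<and>
     (\<forall>x\<in>carrier M. diff M (diff M x) = \<zero>\<^bsub>M\<^esub>)"

definition dg_tensor ::
  "'k ring \<Rightarrow> ('k, 'm, 'r) dgmod_scheme \<Rightarrow> ('k, 'n, 's) dgmod_scheme
    \<Rightarrow> ('k, ('m \<times> 'n \<Rightarrow> 'k) set) dgmod" where
  "dg_tensor K M N =
    (let T = tensor_mod K M N in
     \<lparr>carrier = carrier T, mult = undefined, one = undefined, zero = zero T, add = add T,
      smult = smult T,
      grade = (\<lambda>n. span_mod K T
        {tens K M N x y |x y. \<exists>p q. p + q = n \<and> x \<in> grade M p \<and> y \<in> grade N q}),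
      diff = tensor_lift K T (\<lambda>x y. tens K M N (diff M x) y \<oplus>\<^bsub>T\<^esub> tens K M N (twist M x) (diff N y))\<rparr>)"

section \<open>Dg categories and dg functors\<close>

text \<open>
  \<open>Cmp \<C> X Y Z g f\<close> is the composite \<open>g \<circ> f\<close> of \<open>f : X \<rightarrow> Y\<close> and \<open>g : Y \<rightarrow> Z\<close>. The objects are explicit
  arguments since the carriers of different Hom's need not be disjoint.
\<close>

record ('o, 'k, 'h) dgcat =
  Obj :: "'o set"
  Hom :: "'o \<Rightarrow> 'o \<Rightarrow> ('k, 'h) dgmod"
  Idn :: "'o \<Rightarrow> 'h"
  Cmp :: "'o \<Rightarrow> 'o \<Rightarrow> 'o \<Rightarrow> 'h \<Rightarrow> 'h \<Rightarrow> 'h"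

locale dg_category =
  fixes K :: "'k ring" and \<C> :: "('o, 'k, 'h) dgcat"
  assumes Hom_dg_module: "\<lbrakk>X \<in> Obj \<C>; Y \<in> Obj \<C>\<rbrakk> \<Longrightarrow> dg_module K (Hom \<C> X Y)"
    and Idn_closed: "X \<in> Obj \<C> \<Longrightarrow> Idn \<C> X \<in> carrier (Hom \<C> X X)"
    and Cmp_bilinear: "\<lbrakk>X \<in> Obj \<C>; Y \<in> Obj \<C>; Z \<in> Obj \<C>\<rbrakk> \<Longrightarrow>
      bilinear_map K (Hom \<C> Y Z) (Hom \<C> X Y) (Hom \<C> X Z) (Cmp \<C> X Y Z)"
    and Cmp_Idn_left: "\<lbrakk>X \<in> Obj \<C>; Y \<in> Obj \<C>; f \<in> carrier (Hom \<C> X Y)\<rbrakk> \<Longrightarrow>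
      Cmp \<C> X Y Y (Idn \<C> Y) f = f"
    and Cmp_Idn_right: "\<lbrakk>X \<in> Obj \<C>; Y \<in> Obj \<C>; f \<in> carrier (Hom \<C> X Y)\<rbrakk> \<Longrightarrow>
      Cmp \<C> X X Y f (Idn \<C> X) = f"
    and Cmp_assoc: "\<lbrakk>W \<in> Obj \<C>; X \<in> Obj \<C>; Y \<in> Obj \<C>; Z \<in> Obj \<C>;
      f \<in> carrier (Hom \<C> W X); g \<in> carrier (Hom \<C> X Y); h \<in> carrier (Hom \<C> Y Z)\<rbrakk> \<Longrightarrow>
      Cmp \<C> W Y Z h (Cmp \<C> W X Y g f) = Cmp \<C> W X Z (Cmp \<C> X Y Z h g) f"
    and Cmp_degree: "\<lbrakk>X \<in> Obj \<C>; Y \<in> Obj \<C>; Z \<in> Obj \<C>;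
      g \<in> grade (Hom \<C> Y Z) m; f \<in> grade (Hom \<C> X Y) n\<rbrakk> \<Longrightarrow>
      Cmp \<C> X Y Z g f \<in> grade (Hom \<C> X Z) (m + n)"
    and Cmp_diff: "\<lbrakk>X \<in> Obj \<C>; Y \<in> Obj \<C>; Z \<in> Obj \<C>;
      g \<in> grade (Hom \<C> Y Z) m; f \<in> carrier (Hom \<C> X Y)\<rbrakk> \<Longrightarrow>
      diff (Hom \<C> X Z) (Cmp \<C> X Y Z g f) =
        Cmp \<C> X Y Z (diff (Hom \<C> Y Z) g) f \<oplus>\<^bsub>Hom \<C> X Z\<^esub>
        ksign (Hom \<C> X Z) m (Cmp \<C> X Y Z g (diff (Hom \<C> X Y) f))"

locale dg_functor =
  source: dg_category K \<C> + target: dg_category K \<D>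
  for K :: "'k ring" and \<C> :: "('o, 'k, 'h) dgcat" and \<D> :: "('p, 'k, 'g) dgcat" +
  fixes F\<^sub>0 :: "'o \<Rightarrow> 'p" and F :: "'o \<Rightarrow> 'o \<Rightarrow> 'h \<Rightarrow> 'g"
  assumes functor_Obj: "X \<in> Obj \<C> \<Longrightarrow> F\<^sub>0 X \<in> Obj \<D>"
    and functor_linear: "\<lbrakk>X \<in> Obj \<C>; Y \<in> Obj \<C>\<rbrakk> \<Longrightarrow>
      linear_map K (Hom \<C> X Y) (Hom \<D> (F\<^sub>0 X) (F\<^sub>0 Y)) (F X Y)"
    and functor_Idn: "X \<in> Obj \<C> \<Longrightarrow> F X X (Idn \<C> X) = Idn \<D> (F\<^sub>0 X)"
    and functor_Cmp: "\<lbrakk>X \<in> Obj \<C>; Y \<in> Obj \<C>; Z \<in> Obj \<C>;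
      g \<in> carrier (Hom \<C> Y Z); f \<in> carrier (Hom \<C> X Y)\<rbrakk> \<Longrightarrow>
      F X Z (Cmp \<C> X Y Z g f) = Cmp \<D> (F\<^sub>0 X) (F\<^sub>0 Y) (F\<^sub>0 Z) (F Y Z g) (F X Y f)"
    and functor_degree: "\<lbrakk>X \<in> Obj \<C>; Y \<in> Obj \<C>; f \<in> grade (Hom \<C> X Y) n\<rbrakk> \<Longrightarrow>
      F X Y f \<in> grade (Hom \<D> (F\<^sub>0 X) (F\<^sub>0 Y)) n"
    and functor_diff: "\<lbrakk>X \<in> Obj \<C>; Y \<in> Obj \<C>; f \<in> carrier (Hom \<C> X Y)\<rbrakk> \<Longrightarrow>
      F X Y (diff (Hom \<C> X Y) f) = diff (Hom \<D> (F\<^sub>0 X) (F\<^sub>0 Y)) (F X Y f)"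

text \<open>
  In the composition \<open>(\<alpha>\<^sub>1 \<otimes> \<beta>\<^sub>1) \<circ> (\<alpha>\<^sub>2 \<otimes> \<beta>\<^sub>2)\<close> the sign depends on \<open>|\<alpha>\<^sub>2|\<close> and \<open>|\<beta>\<^sub>1|\<close>, so \<open>\<alpha>\<^sub>2\<close> and \<open>\<beta>\<^sub>1\<close>
  are split into their homogeneous components.
\<close>

definition dgcat_tensor ::
  "'k ring \<Rightarrow> ('o, 'k, 'h) dgcat \<Rightarrow> ('p, 'k, 'g) dgcat
    \<Rightarrow> ('o \<times> 'p, 'k, ('h \<times> 'g \<Rightarrow> 'k) set) dgcat" where
  "dgcat_tensor K \<A> \<B> =
     \<lparr>Obj = Obj \<A> \<times> Obj \<B>,
      Hom = (\<lambda>(A, B) (A', B'). dg_tensor K (Hom \<A> A A') (Hom \<B> B B')),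
      Idn = (\<lambda>(A, B). tens K (Hom \<A> A A) (Hom \<B> B B) (Idn \<A> A) (Idn \<B> B)),
      Cmp = (\<lambda>(A, B) (A', B') (A'', B'') z w.
        let H = dg_tensor K (Hom \<A> A A'') (Hom \<B> B B'') in
        tensor_lift K H (\<lambda>\<alpha>1 \<beta>1.
          tensor_lift K H (\<lambda>\<alpha>2 \<beta>2.
            \<Oplus>\<^bsub>H\<^esub>m\<in>hsupp (Hom \<A> A A') \<alpha>2. \<Oplus>\<^bsub>H\<^esub>n\<in>hsupp (Hom \<B> B' B'') \<beta>1.
              ksign H (m * n) (tens K (Hom \<A> A A'') (Hom \<B> B B'')
                (Cmp \<A> A A' A'' \<alpha>1 (hcomp (Hom \<A> A A') \<alpha>2 m))
                (Cmp \<B> B B' B'' (hcomp (Hom \<B> B' B'') \<beta>1 n) \<beta>2))) w) z)\<rparr>"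

section \<open>Dg algebras with enough idempotents and dg bimodules\<close>

locale dg_algebra_idem =
  fixes K :: "'k ring" and A :: "('k, 'a) dgmod" and I :: "'i set" and e :: "'i \<Rightarrow> 'a"
  assumes dg_module: "dg_module K A"
    and mult_bilinear: "bilinear_map K A A A (mult A)"
    and mult_assoc: "\<lbrakk>a \<in> carrier A; b \<in> carrier A; c \<in> carrier A\<rbrakk> \<Longrightarrow>
      (a \<otimes>\<^bsub>A\<^esub> b) \<otimes>\<^bsub>A\<^esub> c = a \<otimes>\<^bsub>A\<^esub> (b \<otimes>\<^bsub>A\<^esub> c)"
    and mult_degree: "\<lbrakk>a \<in> grade A m; b \<in> grade A n\<rbrakk> \<Longrightarrow> a \<otimes>\<^bsub>A\<^esub> b \<in> grade A (m + n)"
    and idem_degree: "i \<in> I \<Longrightarrow> e i \<in> grade A 0"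
    and idem_nonzero: "i \<in> I \<Longrightarrow> e i \<noteq> \<zero>\<^bsub>A\<^esub>"
    and idem_idem: "i \<in> I \<Longrightarrow> e i \<otimes>\<^bsub>A\<^esub> e i = e i"
    and idem_orthogonal: "\<lbrakk>i \<in> I; j \<in> I; i \<noteq> j\<rbrakk> \<Longrightarrow> e i \<otimes>\<^bsub>A\<^esub> e j = \<zero>\<^bsub>A\<^esub>"
    and idem_right_sum: "internal_direct_sum K A I (\<lambda>i. (\<lambda>a. e i \<otimes>\<^bsub>A\<^esub> a) ` carrier A)"
    and idem_left_sum: "internal_direct_sum K A I (\<lambda>i. (\<lambda>a. a \<otimes>\<^bsub>A\<^esub> e i) ` carrier A)"
    and idem_diff: "i \<in> I \<Longrightarrow> diff A (e i) = \<zero>\<^bsub>A\<^esub>"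
    and mult_diff: "\<lbrakk>a \<in> grade A m; b \<in> carrier A\<rbrakk> \<Longrightarrow>
      diff A (a \<otimes>\<^bsub>A\<^esub> b) = (diff A a \<otimes>\<^bsub>A\<^esub> b) \<oplus>\<^bsub>A\<^esub> ksign A m (a \<otimes>\<^bsub>A\<^esub> diff A b)"

record ('k, 'b, 'a, 'x) dgbimod = "('k, 'x) dgmod" +
  lact :: "'b \<Rightarrow> 'x \<Rightarrow> 'x"
  ract :: "'x \<Rightarrow> 'a \<Rightarrow> 'x"

locale dg_bimodule =
  fixes K :: "'k ring" and B :: "('k, 'b) dgmod" and A :: "('k, 'a) dgmod"
    and X :: "('k, 'b, 'a, 'x) dgbimod"
  assumes dg_module: "dg_module K X"
    and lact_bilinear: "bilinear_map K B X X (lact X)"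
    and ract_bilinear: "bilinear_map K X A X (ract X)"
    and lact_assoc: "\<lbrakk>b \<in> carrier B; b' \<in> carrier B; x \<in> carrier X\<rbrakk> \<Longrightarrow>
      lact X (b \<otimes>\<^bsub>B\<^esub> b') x = lact X b (lact X b' x)"
    and ract_assoc: "\<lbrakk>x \<in> carrier X; a \<in> carrier A; a' \<in> carrier A\<rbrakk> \<Longrightarrow>
      ract X x (a \<otimes>\<^bsub>A\<^esub> a') = ract X (ract X x a) a'"
    and lact_ract: "\<lbrakk>b \<in> carrier B; x \<in> carrier X; a \<in> carrier A\<rbrakk> \<Longrightarrow>
      ract X (lact X b x) a = lact X b (ract X x a)"
    and lact_unitary: "span_mod K X {lact X b x |b x. b \<in> carrier B \<and> x \<in> carrier X} = carrier X"
    and ract_unitary: "span_mod K X {ract X x a |x a. x \<in> carrier X \<and> a \<in> carrier A} = carrier X"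
    and lact_degree: "\<lbrakk>b \<in> grade B m; x \<in> grade X n\<rbrakk> \<Longrightarrow> lact X b x \<in> grade X (m + n)"
    and ract_degree: "\<lbrakk>x \<in> grade X m; a \<in> grade A n\<rbrakk> \<Longrightarrow> ract X x a \<in> grade X (m + n)"
    and act_diff: "\<lbrakk>b \<in> grade B m; x \<in> grade X n; a \<in> carrier A\<rbrakk> \<Longrightarrow>
      diff X (ract X (lact X b x) a) =
        ract X (lact X (diff B b) x) a \<oplus>\<^bsub>X\<^esub>
        ksign X m (ract X (lact X b (diff X x)) a) \<oplus>\<^bsub>X\<^esub>
        ksign X (m + n) (ract X (lact X b x) (diff A a))"

section \<open>The dg category of dg bimodules\<close>

definition lin_maps ::
  "'k ring \<Rightarrow> ('k, 'x, 'r) module_scheme \<Rightarrow> ('k, 'y, 's) module_scheme \<Rightarrow> ('k, 'x \<Rightarrow> 'y) module" where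
  "lin_maps K X Y =
     \<lparr>carrier = {f \<in> extensional (carrier X). linear_map K X Y f},
      mult = undefined, one = undefined, zero = (\<lambda>x\<in>carrier X. \<zero>\<^bsub>Y\<^esub>),
      add = (\<lambda>f g. \<lambda>x\<in>carrier X. f x \<oplus>\<^bsub>Y\<^esub> g x),
      smult = (\<lambda>k f. \<lambda>x\<in>carrier X. k \<odot>\<^bsub>Y\<^esub> f x)\<rparr>"

definition bimod_hom_deg ::
  "'k ring \<Rightarrow> ('k, 'b) dgmod \<Rightarrow> ('k, 'a) dgmod
    \<Rightarrow> ('k, 'b, 'a, 'x) dgbimod \<Rightarrow> ('k, 'b, 'a, 'y) dgbimod \<Rightarrow> int \<Rightarrow> ('x \<Rightarrow> 'y) set" where
  "bimod_hom_deg K B A X Y n =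
     {f \<in> carrier (lin_maps K X Y).
        (\<forall>p. \<forall>x\<in>grade X p. f x \<in> grade Y (p + n)) \<and>
        (\<forall>p. \<forall>b\<in>grade B p. \<forall>x\<in>carrier X. \<forall>a\<in>carrier A.
           f (ract X (lact X b x) a) = ksign Y (n * p) (ract Y (lact Y b (f x)) a))}"

text \<open>
  The Hom's are \<open>\<Oplus>\<^sub>n HOM\<^sup>n\<close>, which embeds into the module of all linear maps because maps of different
  degrees are linearly independent.
\<close>

definition bimod_ghom ::
  "'k ring \<Rightarrow> ('k, 'b) dgmod \<Rightarrow> ('k, 'a) dgmod
    \<Rightarrow> ('k, 'b, 'a, 'x) dgbimod \<Rightarrow> ('k, 'b, 'a, 'y) dgbimod \<Rightarrow> ('k, 'x \<Rightarrow> 'y) gmod" where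
  "bimod_ghom K B A X Y =
    (let L = lin_maps K X Y in
     \<lparr>carrier = span_mod K L (\<Union>n. bimod_hom_deg K B A X Y n),
      mult = undefined, one = undefined, zero = zero L, add = add L, smult = smult L,
      grade = bimod_hom_deg K B A X Y\<rparr>)"

definition bimod_hom ::
  "'k ring \<Rightarrow> ('k, 'b) dgmod \<Rightarrow> ('k, 'a) dgmod
    \<Rightarrow> ('k, 'b, 'a, 'x) dgbimod \<Rightarrow> ('k, 'b, 'a, 'y) dgbimod \<Rightarrow> ('k, 'x \<Rightarrow> 'y) dgmod" where
  "bimod_hom K B A X Y =
     gmod.extend (bimod_ghom K B A X Y)
       (dgmod.fields (\<lambda>f. \<lambda>x\<in>carrier X.
          diff Y (f x) \<ominus>\<^bsub>Y\<^esub> twist (bimod_ghom K B A X Y) f (diff X x)))"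

text \<open>
  The dg category \<open>B-Dg-A\<close> of all dg bimodules whose elements are drawn from the type \<open>'x\<close>, which
  plays the role of the universe.
\<close>

definition Dg_bimod ::
  "'k ring \<Rightarrow> ('k, 'b) dgmod \<Rightarrow> ('k, 'a) dgmod \<Rightarrow> (('k, 'b, 'a, 'x) dgbimod, 'k, 'x \<Rightarrow> 'x) dgcat" where
  "Dg_bimod K B A =
     \<lparr>Obj = {X. dg_bimodule K B A X},
      Hom = bimod_hom K B A,
      Idn = (\<lambda>X. \<lambda>x\<in>carrier X. x),
      Cmp = (\<lambda>X Y Z g f. compose (carrier X) g f)\<rparr>"

section \<open>Tensor product over a dg algebra\<close>

definition balancing ::
  "'k ring \<Rightarrow> ('k, 'b) dgmod \<Rightarrow> ('k, 'c, 'b, 'u) dgbimod \<Rightarrow> ('k, 'b, 'a, 'x) dgbimod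
    \<Rightarrow> ('u \<times> 'x \<Rightarrow> 'k) set set" where
  "balancing K B U X =
    (let T = dg_tensor K U X in
     span_mod K T {tens K U X (ract U u b) x \<ominus>\<^bsub>T\<^esub> tens K U X u (lact X b x) |u b x.
       u \<in> carrier U \<and> b \<in> carrier B \<and> x \<in> carrier X})"

definition tensor_over ::
  "'k ring \<Rightarrow> ('k, 'b) dgmod \<Rightarrow> ('k, 'c, 'b, 'u) dgbimod \<Rightarrow> ('k, 'b, 'a, 'x) dgbimod
    \<Rightarrow> ('k, 'c, 'a, ('u \<times> 'x \<Rightarrow> 'k) set set) dgbimod" where
  "tensor_over K B U X =
    (let T = dg_tensor K U X; N = balancing K B U X; Q = quot_mod T N in
     \<lparr>carrier = carrier Q, mult = undefined, one = undefined, zero = zero Q, add = add Q,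
      smult = smult Q,
      grade = (\<lambda>n. (\<lambda>z. N +>\<^bsub>T\<^esub> z) ` grade T n),
      diff = quot_map T N (diff T),
      lact = (\<lambda>c. quot_map T N (tensor_lift K T (\<lambda>u x. tens K U X (lact U c u) x))),
      ract = (\<lambda>w a. quot_map T N (tensor_lift K T (\<lambda>u x. tens K U X u (ract X x a))) w)\<rparr>)"

definition tens_over ::
  "'k ring \<Rightarrow> ('k, 'b) dgmod \<Rightarrow> ('k, 'c, 'b, 'u) dgbimod \<Rightarrow> ('k, 'b, 'a, 'x) dgbimod
    \<Rightarrow> 'u \<Rightarrow> 'x \<Rightarrow> ('u \<times> 'x \<Rightarrow> 'k) set set" where
  "tens_over K B U X u x = balancing K B U X +>\<^bsub>dg_tensor K U X\<^esub> tens K U X u x"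

end

theory Submission
  imports Defs
begin

text \<open>
  All conditions to be checked are identities between maps that are linear in every variable, on
  modules that are generated by very few elements: a graded module by its homogeneous elements, a
  tensor product by the pure tensors \<open>x \<otimes> y\<close> of homogeneous \<open>x\<close> and \<open>y\<close>, and \<open>U \<otimes>\<^sub>B X\<close> by the classes of
  such tensors (\<open>graded_induct\<close>, \<open>dg_tensor_induct\<close>, \<open>over_induct\<close>). On those generators each identity
  compares a few terms with Koszul signs, and the exponents agree modulo 2. For this to make sense,
  formulas that are given for homogeneous elements only have to be extended to total linear maps; a
  family of linear maps indexed by the degree always glues to one (\<open>graded_sum_linear\<close>). Maps out of
  tensor products and of \<open>U \<otimes>\<^sub>B X\<close> come from universal properties (\<open>tensor_lift_tens\<close>,
  \<open>over_lift_tens\<close>), and direct sum decompositions into degrees from explicit projections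
  (\<open>graded_moduleI\<close>).

  The idempotents enter at one point. The Leibniz rule of a bimodule and the equivariance of a bimodule
  map are stated for \<open>b x a\<close>, but the tensor product over \<open>B\<close> uses one action of each factor only.
  Finite sums of the idempotents are local units, homogeneous of degree zero and cycles, and inserting
  one of them isolates either action: \<open>d(b x)\<close> and \<open>d(x a)\<close> obey the usual rules (\<open>lact_diff\<close>,
  \<open>ract_diff\<close>), and a map \<open>\<phi>\<close> of degree \<open>n\<close> satisfies \<open>\<phi>(b x) = (-1)\<^bsup>n|b|\<^esup> b \<phi>(x)\<close> and
  \<open>\<phi>(x a) = \<phi>(x) a\<close> (\<open>bimod_hom_deg_lact\<close>, \<open>bimod_hom_deg_ract\<close>).

  With these rules the differential of \<open>U \<otimes> X\<close> respects the relation \<open>u b \<otimes> x = u \<otimes> b x\<close>, so \<open>U \<otimes>\<^sub>B X\<close> is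
  a dg bimodule (\<open>tensor_over_dg_bimodule\<close>). The map \<open>u \<otimes> x \<mapsto> (-1)\<^bsup>|\<phi>||u|\<^esup> \<alpha>(u) \<otimes> \<phi>(x)\<close> respects it as well:
  replacing \<open>u\<close> by \<open>u b\<close> contributes \<open>(-1)\<^bsup>|\<phi>||b|\<^esup>\<close>, and this is the sign of moving \<open>\<phi>\<close> past \<open>b\<close> on the
  other side (\<open>kernel_balanced\<close>). The induced map is bilinear in \<open>(\<alpha>, \<phi>)\<close>, has degree \<open>|\<alpha>| + |\<phi>|\<close>, and
  commutes with differentials and composition (\<open>tensor_hom_deg\<close>, \<open>tensor_hom_diff\<close>, \<open>tensor_hom_Cmp\<close>),
  so it induces the functor on Hom's.
\<close>

section \<open>Linear maps, spans and quotients\<close>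

lemma linear_mapI:
  assumes "\<And>x. x \<in> carrier M \<Longrightarrow> f x \<in> carrier N"
    and "\<And>x y. x \<in> carrier M \<Longrightarrow> y \<in> carrier M \<Longrightarrow> f (x \<oplus>\<^bsub>M\<^esub> y) = f x \<oplus>\<^bsub>N\<^esub> f y"
    and "\<And>k x. k \<in> carrier K \<Longrightarrow> x \<in> carrier M \<Longrightarrow> f (k \<odot>\<^bsub>M\<^esub> x) = k \<odot>\<^bsub>N\<^esub> f x"
  shows "linear_map K M N f"
  using assms by (auto simp: linear_map_def)

lemma linear_map_closed: "linear_map K M N f \<Longrightarrow> x \<in> carrier M \<Longrightarrow> f x \<in> carrier N"
  and linear_map_add: "linear_map K M N f \<Longrightarrow> x \<in> carrier M \<Longrightarrow> y \<in> carrier M \<Longrightarrow>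
    f (x \<oplus>\<^bsub>M\<^esub> y) = f x \<oplus>\<^bsub>N\<^esub> f y"
  and linear_map_smult: "linear_map K M N f \<Longrightarrow> k \<in> carrier K \<Longrightarrow> x \<in> carrier M \<Longrightarrow>
    f (k \<odot>\<^bsub>M\<^esub> x) = k \<odot>\<^bsub>N\<^esub> f x"
  by (auto simp: linear_map_def)

lemma linear_map_cong:
  assumes "\<And>x. x \<in> carrier M \<Longrightarrow> f x = g x" "module K M"
  shows "linear_map K M N f \<longleftrightarrow> linear_map K M N g"
proof -
  interpret module K M by fact
  show ?thesis using assms(1) by (auto simp: linear_map_def Pi_def)
qed

lemma linear_map_zero:
  assumes "module K M" "module K N" "linear_map K M N f"
  shows "f \<zero>\<^bsub>M\<^esub> = \<zero>\<^bsub>N\<^esub>"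
proof -
  interpret M: module K M by fact
  interpret N: module K N by fact
  have "f \<zero>\<^bsub>M\<^esub> = f (\<zero>\<^bsub>K\<^esub> \<odot>\<^bsub>M\<^esub> \<zero>\<^bsub>M\<^esub>)" by simp
  also have "\<dots> = \<zero>\<^bsub>N\<^esub>"
    using linear_map_smult[OF assms(3), of "\<zero>\<^bsub>K\<^esub>" "\<zero>\<^bsub>M\<^esub>"] linear_map_closed[OF assms(3), of "\<zero>\<^bsub>M\<^esub>"]
    by simp
  finally show ?thesis .
qed

lemma linear_map_a_inv:
  assumes "module K M" "module K N" "linear_map K M N f" "x \<in> carrier M"
  shows "f (\<ominus>\<^bsub>M\<^esub> x) = \<ominus>\<^bsub>N\<^esub> f x"
proof -
  interpret M: module K M by fact
  interpret N: module K N by fact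
  have "f (\<ominus>\<^bsub>M\<^esub> x) \<oplus>\<^bsub>N\<^esub> f x = \<zero>\<^bsub>N\<^esub>"
    using assms linear_map_add[OF assms(3), of "\<ominus>\<^bsub>M\<^esub> x" x] linear_map_zero[OF assms(1-3)]
    by (simp add: M.l_neg)
  then show ?thesis
    using assms(4) linear_map_closed[OF assms(3)] N.minus_equality by simp
qed

lemma linear_map_minus:
  assumes "module K M" "module K N" "linear_map K M N f" "x \<in> carrier M" "y \<in> carrier M"
  shows "f (x \<ominus>\<^bsub>M\<^esub> y) = f x \<ominus>\<^bsub>N\<^esub> f y"
proof -
  interpret M: module K M by fact
  show ?thesis
    using assms by (simp add: a_minus_def linear_map_add linear_map_a_inv)
qed

lemma linear_map_finsum:
  assumes "module K M" "module K N" "linear_map K M N f" "finite I" "\<And>i. i \<in> I \<Longrightarrow> x i \<in> carrier M"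
  shows "f (\<Oplus>\<^bsub>M\<^esub>i\<in>I. x i) = (\<Oplus>\<^bsub>N\<^esub>i\<in>I. f (x i))"
proof -
  interpret M: module K M by fact
  interpret N: module K N by fact
  show ?thesis
    using assms(4,5)
  proof (induction I)
    case empty
    then show ?case using linear_map_zero[OF assms(1-3)] by simp
  next
    case (insert i I)
    then show ?case
      using linear_map_closed[OF assms(3)] linear_map_add[OF assms(3)]
      by (simp add: Pi_def M.finsum_insert N.finsum_insert)
  qed
qed

lemma linear_map_ksign:
  assumes "module K M" "module K N" "linear_map K M N f" "x \<in> carrier M"
  shows "f (ksign M n x) = ksign N n (f x)"
  using assms by (simp add: ksign_def linear_map_a_inv)

lemma (in abelian_group) minus_eq_zero_iff:
  assumes "x \<in> carrier G" "y \<in> carrier G"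
  shows "x \<ominus> y = \<zero> \<longleftrightarrow> x = y"
  using assms minus_equality[of x "\<ominus> y"] by (auto simp: a_minus_def r_neg)

lemma (in abelian_group) a_minus_cancel_left:
  assumes "a \<in> carrier G" "b \<in> carrier G" "c \<in> carrier G"
  shows "(a \<oplus> b) \<ominus> (a \<oplus> c) = b \<ominus> c"
proof -
  have "(a \<oplus> b) \<ominus> (a \<oplus> c) = (b \<oplus> a) \<oplus> (\<ominus> a \<oplus> \<ominus> c)"
    using assms by (simp add: a_minus_def minus_add a_comm)
  also have "\<dots> = b \<ominus> c" using assms by (simp add: a_assoc r_neg2 a_minus_def)
  finally show ?thesis .
qed

lemma (in abelian_group) a_minus_cancel_right:
  assumes "a \<in> carrier G" "b \<in> carrier G" "c \<in> carrier G"
  shows "(b \<oplus> a) \<ominus> (c \<oplus> a) = b \<ominus> c"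
  using assms a_minus_cancel_left[of a b c] by (simp add: a_comm)

lemma (in abelian_group) a_minus_telescope:
  assumes "a \<in> carrier G" "b \<in> carrier G" "c \<in> carrier G"
  shows "(a \<ominus> b) \<oplus> (b \<ominus> c) = a \<ominus> c"
  using assms by (simp add: a_minus_def a_assoc r_neg1)

lemma linear_map_id: "linear_map K M M (\<lambda>x. x)"
  by (simp add: linear_map_def)

lemma linear_map_comp:
  "linear_map K M N f \<Longrightarrow> linear_map K N P g \<Longrightarrow> linear_map K M P (\<lambda>x. g (f x))"
  by (auto simp: linear_map_def Pi_iff)

lemma linear_map_zero_fun:
  assumes "module K P" shows "linear_map K M P (\<lambda>x. \<zero>\<^bsub>P\<^esub>)"
proof -
  interpret module K P by fact
  show ?thesis by (simp add: linear_map_def)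
qed

lemma linear_map_plus_fun:
  assumes "module K P" "linear_map K M P f" "linear_map K M P g"
  shows "linear_map K M P (\<lambda>x. f x \<oplus>\<^bsub>P\<^esub> g x)"
proof -
  interpret module K P by fact
  show ?thesis using assms(2,3)
    by (auto simp: linear_map_def Pi_def smult_r_distr M.a_ac)
qed

lemma linear_map_smult_fun:
  assumes "module K P" "linear_map K M P f" "k \<in> carrier K"
  shows "linear_map K M P (\<lambda>x. k \<odot>\<^bsub>P\<^esub> f x)"
proof -
  interpret module K P by fact
  show ?thesis using assms(2,3)
    by (auto simp: linear_map_def Pi_def smult_r_distr smult_assoc1[symmetric] R.m_comm)
qed

lemma linear_map_a_inv_fun:
  assumes "module K P" "linear_map K M P f"
  shows "linear_map K M P (\<lambda>x. \<ominus>\<^bsub>P\<^esub> f x)"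
proof -
  interpret module K P by fact
  show ?thesis using assms(2)
    by (auto simp: linear_map_def Pi_def M.minus_add smult_r_minus)
qed

lemma linear_map_minus_fun:
  assumes "module K P" "linear_map K M P f" "linear_map K M P g"
  shows "linear_map K M P (\<lambda>x. f x \<ominus>\<^bsub>P\<^esub> g x)"
  using linear_map_plus_fun[OF assms(1,2) linear_map_a_inv_fun[OF assms(1,3)]]
  by (simp add: a_minus_def)

lemma linear_map_ksign_fun:
  assumes "module K P" "linear_map K M P f"
  shows "linear_map K M P (\<lambda>x. ksign P n (f x))"
  using linear_map_a_inv_fun[OF assms] assms(2) by (cases "even n") (simp_all add: ksign_def)

lemma linear_map_finsum_fun:
  assumes "module K M" "module K P" "finite I" "\<And>i. i \<in> I \<Longrightarrow> linear_map K M P (f i)"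
  shows "linear_map K M P (\<lambda>x. \<Oplus>\<^bsub>P\<^esub>i\<in>I. f i x)"
proof -
  interpret P: module K P by fact
  show ?thesis using assms(3,4)
  proof (induction I)
    case empty
    then show ?case by (simp add: linear_map_zero_fun[OF assms(2)])
  next
    case (insert i I)
    then have "linear_map K M P (\<lambda>x. f i x \<oplus>\<^bsub>P\<^esub> (\<Oplus>\<^bsub>P\<^esub>i\<in>I. f i x))"
      by (intro linear_map_plus_fun[OF assms(2)]) auto
    moreover have "(\<Oplus>\<^bsub>P\<^esub>i\<in>insert i I. f i x) = f i x \<oplus>\<^bsub>P\<^esub> (\<Oplus>\<^bsub>P\<^esub>i\<in>I. f i x)" if "x \<in> carrier M" for x
      using insert that by (intro P.finsum_insert) (auto intro: linear_map_closed)
    ultimately show ?case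
      by (subst linear_map_cong[OF _ assms(1)]) auto
  qed
qed

lemma bilinear_mapI:
  assumes "\<And>x. x \<in> carrier M \<Longrightarrow> linear_map K N P (f x)"
    and "\<And>y. y \<in> carrier N \<Longrightarrow> linear_map K M P (\<lambda>x. f x y)"
  shows "bilinear_map K M N P f"
  using assms by (simp add: bilinear_map_def)

lemma bilinear_map_right: "bilinear_map K M N P f \<Longrightarrow> x \<in> carrier M \<Longrightarrow> linear_map K N P (f x)"
  and bilinear_map_left: "bilinear_map K M N P f \<Longrightarrow> y \<in> carrier N \<Longrightarrow> linear_map K M P (\<lambda>x. f x y)"
  by (auto simp: bilinear_map_def)

lemma bilinear_map_closed:
  "bilinear_map K M N P f \<Longrightarrow> x \<in> carrier M \<Longrightarrow> y \<in> carrier N \<Longrightarrow> f x y \<in> carrier P"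
  by (meson bilinear_map_right linear_map_closed)

subsection \<open>Submodules and spans\<close>

lemma submodule_subset: "submodule H K M \<Longrightarrow> x \<in> H \<Longrightarrow> x \<in> carrier M"
  using subgroup.subset[OF submodule.axioms(1)] by fastforce

lemma submodule_zero: "submodule H K M \<Longrightarrow> \<zero>\<^bsub>M\<^esub> \<in> H"
  using subgroup.one_closed[OF submodule.axioms(1)] by fastforce

lemma submodule_add: "submodule H K M \<Longrightarrow> x \<in> H \<Longrightarrow> y \<in> H \<Longrightarrow> x \<oplus>\<^bsub>M\<^esub> y \<in> H"
  using subgroup.m_closed[OF submodule.axioms(1)] by fastforce

lemma submodule_smult: "submodule H K M \<Longrightarrow> k \<in> carrier K \<Longrightarrow> x \<in> H \<Longrightarrow> k \<odot>\<^bsub>M\<^esub> x \<in> H"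
  by (rule submodule.smult_closed)

lemma submodule_a_inv: "submodule H K M \<Longrightarrow> x \<in> H \<Longrightarrow> \<ominus>\<^bsub>M\<^esub> x \<in> H"
  using subgroup.m_inv_closed[OF submodule.axioms(1)] by (fastforce simp: a_inv_def)

lemma submodule_minus: "submodule H K M \<Longrightarrow> x \<in> H \<Longrightarrow> y \<in> H \<Longrightarrow> x \<ominus>\<^bsub>M\<^esub> y \<in> H"
  by (simp add: a_minus_def submodule_a_inv submodule_add)

lemma submodule_ksign: "submodule H K M \<Longrightarrow> x \<in> H \<Longrightarrow> ksign M n x \<in> H"
  by (simp add: ksign_def submodule_a_inv)

lemma submodule_finsum:
  assumes "module K M" "submodule H K M" "finite I" "\<And>i. i \<in> I \<Longrightarrow> x i \<in> H"
  shows "(\<Oplus>\<^bsub>M\<^esub>i\<in>I. x i) \<in> H"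
proof -
  interpret M: module K M by fact
  show ?thesis using assms(3,4)
  proof (induction I)
    case (insert i I)
    then have "(\<Oplus>\<^bsub>M\<^esub>i\<in>insert i I. x i) = x i \<oplus>\<^bsub>M\<^esub> (\<Oplus>\<^bsub>M\<^esub>i\<in>I. x i)"
      by (intro M.finsum_insert) (auto intro: submodule_subset[OF assms(2)])
    then show ?case using insert by (simp add: submodule_add[OF assms(2)])
  qed (simp add: submodule_zero[OF assms(2)])
qed

text \<open>
  Closure under negation follows from closure under scalars, by \<open>\<ominus> x = (\<ominus> 1) x\<close>.
\<close>

lemma submodule_if:
  assumes "module K M" "H \<subseteq> carrier M" "\<zero>\<^bsub>M\<^esub> \<in> H"
    and "\<And>x y. x \<in> H \<Longrightarrow> y \<in> H \<Longrightarrow> x \<oplus>\<^bsub>M\<^esub> y \<in> H"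
    and "\<And>k x. k \<in> carrier K \<Longrightarrow> x \<in> H \<Longrightarrow> k \<odot>\<^bsub>M\<^esub> x \<in> H"
  shows "submodule H K M"
proof -
  interpret module K M by fact
  show ?thesis
  proof (rule submoduleI)
    fix a assume a: "a \<in> H"
    then have "\<ominus>\<^bsub>M\<^esub> a = (\<ominus>\<^bsub>K\<^esub> \<one>\<^bsub>K\<^esub>) \<odot>\<^bsub>M\<^esub> a"
      using assms(2) by (auto simp: smult_l_minus)
    then show "\<ominus>\<^bsub>M\<^esub> a \<in> H" using assms(5) a by simp
  qed (use assms in auto)
qed

lemma submodule_carrier: "module K M \<Longrightarrow> submodule (carrier M) K M"
  by (rule module.carrier_is_submodule)

lemma submodule_preimage:
  assumes "module K M" "module K N" "linear_map K M N f" "submodule H K N"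
  shows "submodule {x \<in> carrier M. f x \<in> H} K M"
proof -
  interpret module K M by fact
  show ?thesis
    by (rule submodule_if)
      (use assms in \<open>auto simp: linear_map_zero linear_map_add linear_map_smult
        intro: submodule_zero submodule_add submodule_smult module_axioms\<close>)
qed

lemma submodule_image:
  assumes "module K M" "module K N" "linear_map K M N f" "submodule H K M"
  shows "submodule (f ` H) K N"
proof (rule submodule_if[OF assms(2)])
  show "f ` H \<subseteq> carrier N"
    using assms(3,4) by (auto intro: linear_map_closed submodule_subset)
  show "\<zero>\<^bsub>N\<^esub> \<in> f ` H"
    using linear_map_zero[OF assms(1-3)] submodule_zero[OF assms(4)] by (metis imageI)
  fix x y assume "x \<in> f ` H" "y \<in> f ` H"
  then show "x \<oplus>\<^bsub>N\<^esub> y \<in> f ` H"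
    using linear_map_add[OF assms(3)] submodule_add[OF assms(4)] submodule_subset[OF assms(4)]
    by (smt (verit) imageE imageI)
next
  fix k x assume "k \<in> carrier K" "x \<in> f ` H"
  then show "k \<odot>\<^bsub>N\<^esub> x \<in> f ` H"
    using linear_map_smult[OF assms(3)] submodule_smult[OF assms(4)] submodule_subset[OF assms(4)]
    by (smt (verit) imageE imageI)
qed

lemma submodule_equalizer:
  assumes "module K M" "module K N" "linear_map K M N f" "linear_map K M N g"
  shows "submodule {x \<in> carrier M. f x = g x} K M"
proof -
  interpret module K M by fact
  show ?thesis
    by (rule submodule_if)
      (use assms in \<open>auto simp: linear_map_zero linear_map_add linear_map_smult intro: module_axioms\<close>)
qed

lemma span_mod_submodule:
  assumes "module K M" "S \<subseteq> carrier M"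
  shows "submodule (span_mod K M S) K M"
proof -
  interpret module K M by fact
  show ?thesis
    by (rule submodule_if)
      (use assms carrier_is_submodule in \<open>auto simp: span_mod_def
        intro: submodule_zero submodule_add submodule_smult submodule_subset module_axioms\<close>)
qed

lemma span_mod_base: "x \<in> S \<Longrightarrow> x \<in> span_mod K M S"
  by (auto simp: span_mod_def)

lemma span_mod_least: "submodule H K M \<Longrightarrow> S \<subseteq> H \<Longrightarrow> span_mod K M S \<subseteq> H"
  by (auto simp: span_mod_def)

lemma span_mod_subset_carrier: "module K M \<Longrightarrow> S \<subseteq> carrier M \<Longrightarrow> span_mod K M S \<subseteq> carrier M"
  by (simp add: span_mod_least submodule_carrier)

lemma linear_map_span_into:
  assumes "module K M" "module K N" "linear_map K M N f" "submodule H K N"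
    and "S \<subseteq> carrier M" "\<And>s. s \<in> S \<Longrightarrow> f s \<in> H" "x \<in> span_mod K M S"
  shows "f x \<in> H"
  using span_mod_least[OF submodule_preimage[OF assms(1-4)], of S] assms(5-7) by auto

lemma linear_map_span_eq:
  assumes "module K M" "module K N" "linear_map K M N f" "linear_map K M N g"
    and "S \<subseteq> carrier M" "\<And>s. s \<in> S \<Longrightarrow> f s = g s" "x \<in> span_mod K M S"
  shows "f x = g x"
  using span_mod_least[OF submodule_equalizer[OF assms(1-4)], of S] assms(5-7) by auto

subsection \<open>Quotients\<close>

context
  fixes K :: "'k ring" and M :: "('k, 'm, 'r) module_scheme" and N :: "'m set"
  assumes M: "module K M" and N: "submodule N K M"
begin

interpretation M: module K M by (rule M)
interpretation N: abelian_subgroup N M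
  using N submodule.axioms(1) by (intro abelian_subgroupI3 additive_subgroupI M.abelian_group_axioms) blast

text \<open>
  Elements of the quotient are only ever handled through representatives: the next lemmas compute
  every operation on cosets from the operation in \<open>M\<close>.
\<close>

lemma quot_coset_eq:
  assumes "x \<in> carrier M" "y \<in> carrier M"
  shows "N +>\<^bsub>M\<^esub> x = N +>\<^bsub>M\<^esub> y \<longleftrightarrow> x \<ominus>\<^bsub>M\<^esub> y \<in> N"
proof
  assume "N +>\<^bsub>M\<^esub> x = N +>\<^bsub>M\<^esub> y"
  then have "N +>\<^bsub>M\<^esub> (x \<ominus>\<^bsub>M\<^esub> y) = N"
    using M.a_coset_add_inv2[of N x y] assms N.a_subset by (simp add: a_minus_def)
  then show "x \<ominus>\<^bsub>M\<^esub> y \<in> N"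
    using M.a_coset_join1 assms N.a_subgroup by blast
next
  assume "x \<ominus>\<^bsub>M\<^esub> y \<in> N"
  then have "N +>\<^bsub>M\<^esub> (x \<ominus>\<^bsub>M\<^esub> y) = N"
    using M.a_coset_join2 assms N.a_subgroup by simp
  then show "N +>\<^bsub>M\<^esub> x = N +>\<^bsub>M\<^esub> y"
    using M.a_coset_add_inv1[of N x y] assms N.a_subset by (simp add: a_minus_def)
qed

lemma quot_coset_mem:
  assumes "x \<in> carrier M" "s \<in> N +>\<^bsub>M\<^esub> x"
  shows "s \<in> carrier M" "N +>\<^bsub>M\<^esub> s = N +>\<^bsub>M\<^esub> x"
  using assms N.a_subset M.a_repr_independence[OF assms(2,1) N.a_subgroup]
    M.a_r_coset_subset_G[of N x] by auto

lemma quot_carrier: "carrier (quot_mod M N) = (\<lambda>x. N +>\<^bsub>M\<^esub> x) ` carrier M"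
  by (auto simp: quot_mod_def A_RCOSETS_def')

lemma quot_zero: "\<zero>\<^bsub>quot_mod M N\<^esub> = N +>\<^bsub>M\<^esub> \<zero>\<^bsub>M\<^esub>"
  using N.a_subset by (simp add: quot_mod_def)

lemma quot_add:
  "x \<in> carrier M \<Longrightarrow> y \<in> carrier M \<Longrightarrow>
    (N +>\<^bsub>M\<^esub> x) \<oplus>\<^bsub>quot_mod M N\<^esub> (N +>\<^bsub>M\<^esub> y) = N +>\<^bsub>M\<^esub> (x \<oplus>\<^bsub>M\<^esub> y)"
  by (simp add: quot_mod_def N.a_rcos_sum)

lemma quot_smult:
  assumes "k \<in> carrier K" "x \<in> carrier M"
  shows "k \<odot>\<^bsub>quot_mod M N\<^esub> (N +>\<^bsub>M\<^esub> x) = N +>\<^bsub>M\<^esub> (k \<odot>\<^bsub>M\<^esub> x)"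
proof -
  have "N +>\<^bsub>M\<^esub> (k \<odot>\<^bsub>M\<^esub> s) = N +>\<^bsub>M\<^esub> (k \<odot>\<^bsub>M\<^esub> x)" if s: "s \<in> N +>\<^bsub>M\<^esub> x" for s
  proof -
    have sM: "s \<in> carrier M" and "s \<ominus>\<^bsub>M\<^esub> x \<in> N"
      using quot_coset_mem[OF assms(2) s] quot_coset_eq[of s x] assms by auto
    then have "k \<odot>\<^bsub>M\<^esub> (s \<ominus>\<^bsub>M\<^esub> x) \<in> N"
      using submodule_smult[OF N] assms by blast
    moreover have "k \<odot>\<^bsub>M\<^esub> (s \<ominus>\<^bsub>M\<^esub> x) = k \<odot>\<^bsub>M\<^esub> s \<ominus>\<^bsub>M\<^esub> k \<odot>\<^bsub>M\<^esub> x"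
      using sM assms by (simp add: a_minus_def M.smult_r_distr M.smult_r_minus)
    ultimately show ?thesis using quot_coset_eq sM assms by simp
  qed
  moreover have "x \<in> N +>\<^bsub>M\<^esub> x" using assms(2) by (rule N.a_rcos_self)
  ultimately have "(\<lambda>s. N +>\<^bsub>M\<^esub> (k \<odot>\<^bsub>M\<^esub> s)) ` (N +>\<^bsub>M\<^esub> x) = {N +>\<^bsub>M\<^esub> (k \<odot>\<^bsub>M\<^esub> x)}" by blast
  then show ?thesis by (simp add: quot_mod_def)
qed

lemma quot_proj_linear: "linear_map K M (quot_mod M N) (\<lambda>x. N +>\<^bsub>M\<^esub> x)"
  by (rule linear_mapI) (auto simp: quot_carrier quot_add quot_smult)

lemma quot_module: "module K (quot_mod M N)"
proof -
  let ?Q = "quot_mod M N"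
  have rep: "\<exists>x\<in>carrier M. X = N +>\<^bsub>M\<^esub> x" if "X \<in> carrier ?Q" for X
    using that by (auto simp: quot_carrier)
  have cl: "N +>\<^bsub>M\<^esub> x \<in> carrier ?Q" if "x \<in> carrier M" for x
    using that by (simp add: quot_carrier)
  have "abelian_group ?Q"
  proof (rule abelian_groupI)
    show "\<zero>\<^bsub>?Q\<^esub> \<in> carrier ?Q" using cl[of "\<zero>\<^bsub>M\<^esub>"] quot_zero by simp
    fix X Y Z assume "X \<in> carrier ?Q" "Y \<in> carrier ?Q" "Z \<in> carrier ?Q"
    then obtain x y z where x: "x \<in> carrier M" "X = N +>\<^bsub>M\<^esub> x" and y: "y \<in> carrier M" "Y = N +>\<^bsub>M\<^esub> y"
      and z: "z \<in> carrier M" "Z = N +>\<^bsub>M\<^esub> z"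
      by (meson rep)
    show "X \<oplus>\<^bsub>?Q\<^esub> Y \<in> carrier ?Q" using x y by (simp only: quot_add M.add.m_closed cl)
    show "X \<oplus>\<^bsub>?Q\<^esub> Y \<oplus>\<^bsub>?Q\<^esub> Z = X \<oplus>\<^bsub>?Q\<^esub> (Y \<oplus>\<^bsub>?Q\<^esub> Z)"
      using x y z by (simp only: quot_add M.add.m_closed M.a_assoc)
  next
    fix X Y assume "X \<in> carrier ?Q" "Y \<in> carrier ?Q"
    then obtain x y where x: "x \<in> carrier M" "X = N +>\<^bsub>M\<^esub> x" and y: "y \<in> carrier M" "Y = N +>\<^bsub>M\<^esub> y"
      by (meson rep)
    show "X \<oplus>\<^bsub>?Q\<^esub> Y = Y \<oplus>\<^bsub>?Q\<^esub> X" using x y by (simp only: quot_add M.a_comm)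
  next
    fix X assume "X \<in> carrier ?Q"
    then obtain x where x: "x \<in> carrier M" "X = N +>\<^bsub>M\<^esub> x" by (meson rep)
    show "\<zero>\<^bsub>?Q\<^esub> \<oplus>\<^bsub>?Q\<^esub> X = X"
      using x by (simp only: quot_zero quot_add M.zero_closed M.l_zero)
    have "(N +>\<^bsub>M\<^esub> (\<ominus>\<^bsub>M\<^esub> x)) \<oplus>\<^bsub>?Q\<^esub> X = \<zero>\<^bsub>?Q\<^esub>"
      using x by (simp only: quot_zero quot_add M.l_neg M.a_inv_closed)
    then show "\<exists>Y\<in>carrier ?Q. Y \<oplus>\<^bsub>?Q\<^esub> X = \<zero>\<^bsub>?Q\<^esub>"
      using cl x(1) M.a_inv_closed by blast
  qed
  then show ?thesis
  proof (rule moduleI[OF M.R.is_cring])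
    fix a b X Y assume a: "a \<in> carrier K" and b: "b \<in> carrier K"
      and "X \<in> carrier ?Q" "Y \<in> carrier ?Q"
    then obtain x y where x: "x \<in> carrier M" "X = N +>\<^bsub>M\<^esub> x" and y: "y \<in> carrier M" "Y = N +>\<^bsub>M\<^esub> y"
      by (meson rep)
    show "a \<odot>\<^bsub>?Q\<^esub> (X \<oplus>\<^bsub>?Q\<^esub> Y) = a \<odot>\<^bsub>?Q\<^esub> X \<oplus>\<^bsub>?Q\<^esub> a \<odot>\<^bsub>?Q\<^esub> Y"
      using a x y by (simp only: quot_add quot_smult M.smult_closed M.add.m_closed M.smult_r_distr)
  next
    fix a b X assume a: "a \<in> carrier K" and b: "b \<in> carrier K" and "X \<in> carrier ?Q"
    then obtain x where x: "x \<in> carrier M" "X = N +>\<^bsub>M\<^esub> x" by (meson rep)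
    show "a \<odot>\<^bsub>?Q\<^esub> X \<in> carrier ?Q" using a x by (simp only: quot_smult cl M.smult_closed)
    show "(a \<oplus>\<^bsub>K\<^esub> b) \<odot>\<^bsub>?Q\<^esub> X = a \<odot>\<^bsub>?Q\<^esub> X \<oplus>\<^bsub>?Q\<^esub> b \<odot>\<^bsub>?Q\<^esub> X"
      using a b x by (simp only: quot_add quot_smult M.smult_closed M.R.add.m_closed M.smult_l_distr)
    show "a \<otimes>\<^bsub>K\<^esub> b \<odot>\<^bsub>?Q\<^esub> X = a \<odot>\<^bsub>?Q\<^esub> (b \<odot>\<^bsub>?Q\<^esub> X)"
      using a b x by (simp only: quot_smult M.smult_closed M.R.m_closed M.smult_assoc1)
  next
    fix X assume "X \<in> carrier ?Q"
    then obtain x where x: "x \<in> carrier M" "X = N +>\<^bsub>M\<^esub> x" by (meson rep)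
    then show "\<one>\<^bsub>K\<^esub> \<odot>\<^bsub>?Q\<^esub> X = X" by (simp only: quot_smult M.R.one_closed M.smult_one)
  qed
qed

text \<open>
  A linear map that vanishes on \<open>N\<close> is constant on every coset, so its image of a coset is a
  singleton. All maps out of quotients below are evaluated through this fact.
\<close>

lemma quot_factor_eq:
  assumes P: "module K P" and f: "linear_map K M P f" and 0: "\<And>n. n \<in> N \<Longrightarrow> f n = \<zero>\<^bsub>P\<^esub>"
    and x: "x \<in> carrier M"
  shows "the_elem (f ` (N +>\<^bsub>M\<^esub> x)) = f x"
proof -
  interpret P: module K P by (rule P)
  have "f s = f x" if s: "s \<in> N +>\<^bsub>M\<^esub> x" for s
  proof -
    have sM: "s \<in> carrier M" and "s \<ominus>\<^bsub>M\<^esub> x \<in> N"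
      using quot_coset_mem[OF x s] quot_coset_eq[of s x] x by auto
    then have "f s \<ominus>\<^bsub>P\<^esub> f x = \<zero>\<^bsub>P\<^esub>"
      using 0 linear_map_minus[OF M P f sM x] by simp
    then show ?thesis using sM x linear_map_closed[OF f] by (simp add: P.minus_eq_zero_iff)
  qed
  moreover have "x \<in> N +>\<^bsub>M\<^esub> x" using x by (rule N.a_rcos_self)
  ultimately have "f ` (N +>\<^bsub>M\<^esub> x) = {f x}" by blast
  then show ?thesis by simp
qed

lemma quot_factor_linear:
  assumes P: "module K P" and f: "linear_map K M P f" and 0: "\<And>n. n \<in> N \<Longrightarrow> f n = \<zero>\<^bsub>P\<^esub>"
  shows "linear_map K (quot_mod M N) P (\<lambda>S. the_elem (f ` S))"
  by (rule linear_mapI)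
    (auto simp: quot_carrier quot_add quot_smult quot_factor_eq[OF assms]
      linear_map_add[OF f] linear_map_smult[OF f] linear_map_closed[OF f])

lemma quot_proj_zero: "n \<in> N \<Longrightarrow> N +>\<^bsub>M\<^esub> n = \<zero>\<^bsub>quot_mod M N\<^esub>"
  using M.a_coset_join2 N.a_subgroup N.a_subset by (auto simp: quot_mod_def)

lemma quot_map_eq:
  assumes h: "linear_map K M M h" and "\<And>n. n \<in> N \<Longrightarrow> h n \<in> N" and x: "x \<in> carrier M"
  shows "quot_map M N h (N +>\<^bsub>M\<^esub> x) = N +>\<^bsub>M\<^esub> h x"
  unfolding quot_map_def
  by (rule quot_factor_eq[OF quot_module linear_map_comp[OF h quot_proj_linear] _ x])
    (use assms quot_proj_zero in auto)

lemma quot_map_linear: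
  assumes h: "linear_map K M M h" and "\<And>n. n \<in> N \<Longrightarrow> h n \<in> N"
  shows "linear_map K (quot_mod M N) (quot_mod M N) (quot_map M N h)"
  unfolding quot_map_def
  by (rule quot_factor_linear[OF quot_module linear_map_comp[OF h quot_proj_linear]])
    (use assms quot_proj_zero in auto)

end

section \<open>The tensor product and its universal property\<close>

subsection \<open>Free modules\<close>

lemma free_mod_simps:
  "carrier (free_mod K S) = {f. (\<forall>p. f p \<in> carrier K) \<and> (\<forall>p. p \<notin> S \<longrightarrow> f p = \<zero>\<^bsub>K\<^esub>) \<and> finite {p. f p \<noteq> \<zero>\<^bsub>K\<^esub>}}"
  "\<zero>\<^bsub>free_mod K S\<^esub> = (\<lambda>p. \<zero>\<^bsub>K\<^esub>)"
  "f \<oplus>\<^bsub>free_mod K S\<^esub> g = (\<lambda>p. f p \<oplus>\<^bsub>K\<^esub> g p)"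
  "k \<odot>\<^bsub>free_mod K S\<^esub> f = (\<lambda>p. k \<otimes>\<^bsub>K\<^esub> f p)"
  by (simp_all add: free_mod_def)

context
  fixes K :: "'k ring"
  assumes K: "cring K"
begin

interpretation K: cring K by (rule K)

lemma free_mod_module: "module K (free_mod K S)"
proof -
  let ?F = "free_mod K S"
  have add: "f \<oplus>\<^bsub>?F\<^esub> g \<in> carrier ?F" if "f \<in> carrier ?F" "g \<in> carrier ?F" for f g
  proof -
    have "finite {p. f p \<oplus>\<^bsub>K\<^esub> g p \<noteq> \<zero>\<^bsub>K\<^esub>}"
      by (rule finite_subset[of _ "{p. f p \<noteq> \<zero>\<^bsub>K\<^esub>} \<union> {p. g p \<noteq> \<zero>\<^bsub>K\<^esub>}"])
        (use that in \<open>auto simp: free_mod_simps\<close>)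
    then show ?thesis using that by (auto simp: free_mod_simps)
  qed
  have smult: "k \<odot>\<^bsub>?F\<^esub> f \<in> carrier ?F" if "f \<in> carrier ?F" "k \<in> carrier K" for f k
  proof -
    have "finite {p. k \<otimes>\<^bsub>K\<^esub> f p \<noteq> \<zero>\<^bsub>K\<^esub>}"
      by (rule finite_subset[of _ "{p. f p \<noteq> \<zero>\<^bsub>K\<^esub>}"]) (use that in \<open>auto simp: free_mod_simps\<close>)
    then show ?thesis using that by (auto simp: free_mod_simps)
  qed
  have "abelian_group ?F"
  proof (rule abelian_groupI)
    fix f assume f: "f \<in> carrier ?F"
    then have "(\<ominus>\<^bsub>K\<^esub> \<one>\<^bsub>K\<^esub>) \<odot>\<^bsub>?F\<^esub> f \<oplus>\<^bsub>?F\<^esub> f = \<zero>\<^bsub>?F\<^esub>"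
      by (auto simp: free_mod_simps K.l_minus K.l_neg)
    then show "\<exists>g\<in>carrier ?F. g \<oplus>\<^bsub>?F\<^esub> f = \<zero>\<^bsub>?F\<^esub>" using smult[OF f] by blast
  qed (auto simp: add, auto simp: free_mod_simps K.a_ac)
  then show ?thesis
    by (rule moduleI[OF K])
      (auto simp: smult, auto simp: free_mod_simps K.l_distr K.r_distr K.m_ac)
qed

lemma free_gen_closed: "p \<in> S \<Longrightarrow> free_gen K p \<in> carrier (free_mod K S)"
proof -
  assume "p \<in> S"
  moreover have "finite {q. free_gen K p q \<noteq> \<zero>\<^bsub>K\<^esub>}"
    by (rule finite_subset[of _ "{p}"]) (auto simp: free_gen_def)
  ultimately show ?thesis by (auto simp: free_mod_simps free_gen_def)
qed

text \<open>
  Induction on a finite set that contains the support: one value at a time is split off as a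
  multiple of a generator.
\<close>

lemma free_mod_span: "span_mod K (free_mod K S) (free_gen K ` S) = carrier (free_mod K S)"
proof
  let ?F = "free_mod K S"
  show "span_mod K ?F (free_gen K ` S) \<subseteq> carrier ?F"
    by (rule span_mod_subset_carrier[OF free_mod_module]) (auto intro: free_gen_closed)
  have sub: "submodule (span_mod K ?F (free_gen K ` S)) K ?F"
    by (rule span_mod_submodule[OF free_mod_module]) (auto intro: free_gen_closed)
  have "f \<in> span_mod K ?F (free_gen K ` S)"
    if "finite A" "f \<in> carrier ?F" "{p. f p \<noteq> \<zero>\<^bsub>K\<^esub>} \<subseteq> A" for A f
    using that
  proof (induction A arbitrary: f)
    case empty
    then have "f = \<zero>\<^bsub>?F\<^esub>" by (auto simp: free_mod_simps)
    then show ?case using submodule_zero[OF sub] by simp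
  next
    case (insert q A)
    have fq: "f q \<in> carrier K" using insert.prems by (auto simp: free_mod_simps)
    define g where "g = f(q := \<zero>\<^bsub>K\<^esub>)"
    have "finite {p. g p \<noteq> \<zero>\<^bsub>K\<^esub>}" and supp: "{p. g p \<noteq> \<zero>\<^bsub>K\<^esub>} \<subseteq> A"
      using insert by (auto simp: g_def intro: finite_subset[of _ A])
    then have g: "g \<in> carrier ?F" using insert.prems by (auto simp: free_mod_simps g_def)
    show ?case
    proof (cases "q \<in> S")
      case True
      have "f = g \<oplus>\<^bsub>?F\<^esub> f q \<odot>\<^bsub>?F\<^esub> free_gen K q"
        using insert.prems by (auto simp: free_mod_simps g_def free_gen_def)
      moreover have "f q \<odot>\<^bsub>?F\<^esub> free_gen K q \<in> span_mod K ?F (free_gen K ` S)"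
        using True fq by (intro submodule_smult[OF sub] span_mod_base) auto
      ultimately show ?thesis
        using submodule_add[OF sub insert.IH[OF g supp]] by metis
    next
      case False
      then have "f = g" using insert.prems by (auto simp: free_mod_simps g_def)
      then show ?thesis using insert.IH[OF g supp] by simp
    qed
  qed
  then show "carrier ?F \<subseteq> span_mod K ?F (free_gen K ` S)"
    by (auto simp: free_mod_simps)
qed

definition free_lift :: "('k, 'p, 't) module_scheme \<Rightarrow> ('s \<Rightarrow> 'p) \<Rightarrow> ('s \<Rightarrow> 'k) \<Rightarrow> 'p" where
  "free_lift P b f = (\<Oplus>\<^bsub>P\<^esub>p\<in>{p. f p \<noteq> \<zero>\<^bsub>K\<^esub>}. f p \<odot>\<^bsub>P\<^esub> b p)"

context
  fixes P :: "('k, 'p, 't) module_scheme" and S :: "'s set" and b :: "'s \<Rightarrow> 'p"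
  assumes P: "module K P" and b: "\<And>p. p \<in> S \<Longrightarrow> b p \<in> carrier P"
begin

interpretation P: module K P by (rule P)

lemma free_lift_eq_sum:
  assumes "f \<in> carrier (free_mod K S)" "finite A" "{p. f p \<noteq> \<zero>\<^bsub>K\<^esub>} \<subseteq> A" "A \<subseteq> S"
  shows "free_lift P b f = (\<Oplus>\<^bsub>P\<^esub>p\<in>A. f p \<odot>\<^bsub>P\<^esub> b p)"
  unfolding free_lift_def
  by (rule P.add.finprod_mono_neutral_cong_left)
    (use assms b in \<open>auto simp: free_mod_simps Pi_def subset_iff\<close>)

lemma free_lift_linear: "linear_map K (free_mod K S) P (free_lift P b)"
proof (rule linear_mapI)
  interpret F: module K "free_mod K S" by (rule free_mod_module)
  fix f assume f: "f \<in> carrier (free_mod K S)"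
  let ?A = "{p. f p \<noteq> \<zero>\<^bsub>K\<^esub>}"
  have A: "finite ?A" "?A \<subseteq> S" using f by (auto simp: free_mod_simps)
  show "free_lift P b f \<in> carrier P"
    unfolding free_lift_def using f A b by (intro P.finsum_closed) (auto simp: free_mod_simps)
  show "free_lift P b (k \<odot>\<^bsub>free_mod K S\<^esub> f) = k \<odot>\<^bsub>P\<^esub> free_lift P b f" if k: "k \<in> carrier K" for k
  proof -
    have "free_lift P b (k \<odot>\<^bsub>free_mod K S\<^esub> f) = (\<Oplus>\<^bsub>P\<^esub>p\<in>?A. (k \<otimes>\<^bsub>K\<^esub> f p) \<odot>\<^bsub>P\<^esub> b p)"
      by (subst free_lift_eq_sum[of _ ?A]) (use f k A F.smult_closed in \<open>auto simp: free_mod_simps(4)\<close>)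
    also have "\<dots> = (\<Oplus>\<^bsub>P\<^esub>p\<in>?A. k \<odot>\<^bsub>P\<^esub> (f p \<odot>\<^bsub>P\<^esub> b p))"
      using f k A b by (intro P.finsum_cong') (auto simp: free_mod_simps subset_iff P.smult_assoc1)
    also have "\<dots> = k \<odot>\<^bsub>P\<^esub> free_lift P b f"
      unfolding free_lift_def using f k A b
      by (subst P.finsum_smult_ldistr) (auto simp: free_mod_simps subset_iff)
    finally show ?thesis .
  qed
  fix g assume g: "g \<in> carrier (free_mod K S)"
  let ?B = "?A \<union> {p. g p \<noteq> \<zero>\<^bsub>K\<^esub>}"
  have B: "finite ?B" "?B \<subseteq> S" using f g by (auto simp: free_mod_simps)
  have fK: "f p \<in> carrier K" and gK: "g p \<in> carrier K" for p
    using f g by (simp_all add: free_mod_simps)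
  have bB: "b p \<in> carrier P" if "p \<in> ?B" for p
    using that B(2) b by blast
  have "{p. f p \<oplus>\<^bsub>K\<^esub> g p \<noteq> \<zero>\<^bsub>K\<^esub>} \<subseteq> ?B" by auto
  then have "free_lift P b (f \<oplus>\<^bsub>free_mod K S\<^esub> g) = (\<Oplus>\<^bsub>P\<^esub>p\<in>?B. (f p \<oplus>\<^bsub>K\<^esub> g p) \<odot>\<^bsub>P\<^esub> b p)"
    using B f g by (subst free_lift_eq_sum[of _ ?B]) (use F.add.m_closed in \<open>auto simp: free_mod_simps(3)\<close>)
  also have "\<dots> = (\<Oplus>\<^bsub>P\<^esub>p\<in>?B. f p \<odot>\<^bsub>P\<^esub> b p \<oplus>\<^bsub>P\<^esub> g p \<odot>\<^bsub>P\<^esub> b p)"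
    using fK gK bB by (intro P.finsum_cong' refl) (auto simp: P.smult_l_distr)
  also have "\<dots> = (\<Oplus>\<^bsub>P\<^esub>p\<in>?B. f p \<odot>\<^bsub>P\<^esub> b p) \<oplus>\<^bsub>P\<^esub> (\<Oplus>\<^bsub>P\<^esub>p\<in>?B. g p \<odot>\<^bsub>P\<^esub> b p)"
    using fK gK bB by (intro P.finsum_addf) auto
  also have "\<dots> = free_lift P b f \<oplus>\<^bsub>P\<^esub> free_lift P b g"
    using f g B by (simp add: free_lift_eq_sum[of _ ?B])
  finally show "free_lift P b (f \<oplus>\<^bsub>free_mod K S\<^esub> g) = free_lift P b f \<oplus>\<^bsub>P\<^esub> free_lift P b g" .
qed

lemma free_lift_gen: "p \<in> S \<Longrightarrow> free_lift P b (free_gen K p) = b p"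
  using free_gen_closed[of p S] b[of p]
  by (subst free_lift_eq_sum[of _ "{p}"]) (auto simp: free_gen_def)

end

end

subsection \<open>Tensor products of modules\<close>

context
  fixes K :: "'k ring" and M :: "('k, 'm, 'r) module_scheme" and N :: "('k, 'n, 's) module_scheme"
  assumes M: "module K M" and N: "module K N"
begin

interpretation M: module K M by (rule M)
interpretation N: module K N by (rule N)

private lemmas tensor_cring = M.R.is_cring

lemma tensor_free_module: "module K (tensor_free K M N)"
  unfolding tensor_free_def by (rule free_mod_module[OF tensor_cring])

interpretation F: module K "tensor_free K M N" by (rule tensor_free_module)

lemma tensor_free_gen_closed:
  "x \<in> carrier M \<Longrightarrow> y \<in> carrier N \<Longrightarrow> free_gen K (x, y) \<in> carrier (tensor_free K M N)"
  unfolding tensor_free_def by (rule free_gen_closed[OF tensor_cring]) simp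

lemma tensor_relators_closed: "tensor_relators K M N \<subseteq> carrier (tensor_free K M N)"
  by (auto simp: tensor_relators_def Let_def tensor_free_gen_closed)

lemma tensor_kernel_submodule: "submodule (tensor_kernel K M N) K (tensor_free K M N)"
  unfolding tensor_kernel_def by (rule span_mod_submodule[OF tensor_free_module tensor_relators_closed])

lemma tensor_mod_module: "module K (tensor_mod K M N)"
  unfolding tensor_mod_def by (rule quot_module[OF tensor_free_module tensor_kernel_submodule])

lemma tensor_relatorD:
  assumes "a \<ominus>\<^bsub>tensor_free K M N\<^esub> c \<in> tensor_relators K M N"
    and "a \<in> carrier (tensor_free K M N)" "c \<in> carrier (tensor_free K M N)"
  shows "tensor_kernel K M N +>\<^bsub>tensor_free K M N\<^esub> a = tensor_kernel K M N +>\<^bsub>tensor_free K M N\<^esub> c"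
  using assms by (subst quot_coset_eq[OF tensor_free_module tensor_kernel_submodule])
    (auto simp: tensor_kernel_def intro: span_mod_base)

lemma tens_bilinear: "bilinear_map K M N (tensor_mod K M N) (tens K M N)"
proof -
  note proj = quot_proj_linear[OF tensor_free_module tensor_kernel_submodule, folded tensor_mod_def]
  note cl = tensor_free_gen_closed
  have mem: "tens K M N x y \<in> carrier (tensor_mod K M N)" if "x \<in> carrier M" "y \<in> carrier N" for x y
    unfolding tens_def using that by (intro linear_map_closed[OF proj] cl)
  have addl: "tens K M N (x \<oplus>\<^bsub>M\<^esub> x') y = tens K M N x y \<oplus>\<^bsub>tensor_mod K M N\<^esub> tens K M N x' y"
    if "x \<in> carrier M" "x' \<in> carrier M" "y \<in> carrier N" for x x' y
    unfolding tens_def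
    by (subst linear_map_add[OF proj, symmetric], (simp add: that cl)+, rule tensor_relatorD,
        (use that in \<open>simp add: tensor_relators_def Let_def\<close>, blast), simp_all add: that cl)
  have addr: "tens K M N x (y \<oplus>\<^bsub>N\<^esub> y') = tens K M N x y \<oplus>\<^bsub>tensor_mod K M N\<^esub> tens K M N x y'"
    if "x \<in> carrier M" "y' \<in> carrier N" "y \<in> carrier N" for x y' y
    unfolding tens_def
    by (subst linear_map_add[OF proj, symmetric], (simp add: that cl)+, rule tensor_relatorD,
        (use that in \<open>simp add: tensor_relators_def Let_def\<close>, blast), simp_all add: that cl)
  have sl: "tens K M N (k \<odot>\<^bsub>M\<^esub> x) y = k \<odot>\<^bsub>tensor_mod K M N\<^esub> tens K M N x y"
    if "k \<in> carrier K" "x \<in> carrier M" "y \<in> carrier N" for k x y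
    unfolding tens_def
    by (subst linear_map_smult[OF proj, symmetric], (simp add: that cl)+, rule tensor_relatorD,
        (use that in \<open>simp add: tensor_relators_def Let_def\<close>, blast), simp_all add: that cl)
  have sr: "tens K M N x (k \<odot>\<^bsub>N\<^esub> y) = k \<odot>\<^bsub>tensor_mod K M N\<^esub> tens K M N x y"
    if "k \<in> carrier K" "x \<in> carrier M" "y \<in> carrier N" for k x y
    unfolding tens_def
    by (subst linear_map_smult[OF proj, symmetric], (simp add: that cl)+, rule tensor_relatorD,
        (use that in \<open>simp add: tensor_relators_def Let_def\<close>, blast), simp_all add: that cl)
  show ?thesis
    by (intro bilinear_mapI linear_mapI mem addl addr sl sr) assumption+
qed

text \<open>
  The generators of the free module map onto the pure tensors.
\<close>

lemma tensor_mod_span: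
  "span_mod K (tensor_mod K M N) {tens K M N x y |x y. x \<in> carrier M \<and> y \<in> carrier N}
    = carrier (tensor_mod K M N)" (is "?S = _")
proof
  note T = tensor_mod_module
  note proj = quot_proj_linear[OF tensor_free_module tensor_kernel_submodule, folded tensor_mod_def]
  have sub: "{tens K M N x y |x y. x \<in> carrier M \<and> y \<in> carrier N} \<subseteq> carrier (tensor_mod K M N)"
    using bilinear_map_closed[OF tens_bilinear] by auto
  then show "?S \<subseteq> carrier (tensor_mod K M N)" by (rule span_mod_subset_carrier[OF T])
  have "tensor_kernel K M N +>\<^bsub>tensor_free K M N\<^esub> f \<in> ?S" if "f \<in> carrier (tensor_free K M N)" for f
  proof (rule linear_map_span_into[OF tensor_free_module T proj span_mod_submodule[OF T sub]])
    show "f \<in> span_mod K (tensor_free K M N) (free_gen K ` (carrier M \<times> carrier N))"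
      using that free_mod_span[OF tensor_cring, of "carrier M \<times> carrier N"] by (simp add: tensor_free_def)
  qed (auto simp: tensor_free_gen_closed tens_def intro!: span_mod_base)
  then show "carrier (tensor_mod K M N) \<subseteq> ?S"
    unfolding tensor_mod_def using quot_carrier[OF tensor_free_module tensor_kernel_submodule] by auto
qed

context
  fixes P :: "('k, 'p, 't) module_scheme" and b :: "'m \<Rightarrow> 'n \<Rightarrow> 'p"
  assumes P: "module K P" and b: "bilinear_map K M N P b"
begin

interpretation P: module K P by (rule P)

text \<open>The map induced on formal sums vanishes on the relators exactly because \<open>b\<close> is bilinear.\<close>

lemma tensor_kernel_killed:
  assumes "f \<in> tensor_kernel K M N"
  shows "free_lift K P (\<lambda>p. b (fst p) (snd p)) f = \<zero>\<^bsub>P\<^esub>"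
proof -
  let ?L = "free_lift K P (\<lambda>p. b (fst p) (snd p))"
  note Fm = tensor_free_module
  have bc: "b (fst p) (snd p) \<in> carrier P" if "p \<in> carrier M \<times> carrier N" for p
    using that bilinear_map_closed[OF b] by auto
  have L: "linear_map K (tensor_free K M N) P ?L"
    unfolding tensor_free_def by (rule free_lift_linear[OF tensor_cring P bc])
  have gen: "?L (free_gen K (x, y)) = b x y" if "x \<in> carrier M" "y \<in> carrier N" for x y
    using free_lift_gen[OF tensor_cring P bc, where p = "(x, y)"] that by simp
  note cl = tensor_free_gen_closed bilinear_map_closed[OF b]
  have "?L f = (\<lambda>f. \<zero>\<^bsub>P\<^esub>) f"
  proof (rule linear_map_span_eq[OF Fm P L linear_map_zero_fun[OF P] tensor_relators_closed _
      assms[unfolded tensor_kernel_def]])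
    fix r assume "r \<in> tensor_relators K M N"
    then show "?L r = \<zero>\<^bsub>P\<^esub>"
      by (auto simp: tensor_relators_def Let_def cl linear_map_minus[OF Fm P L] linear_map_add[OF L]
          linear_map_smult[OF L] gen P.minus_eq_zero_iff
          linear_map_add[OF bilinear_map_left[OF b]] linear_map_add[OF bilinear_map_right[OF b]]
          linear_map_smult[OF bilinear_map_left[OF b]] linear_map_smult[OF bilinear_map_right[OF b]])
  qed
  then show ?thesis by simp
qed

lemma tensor_lift_linear: "linear_map K (tensor_mod K M N) P (tensor_lift K P b)"
  and tensor_lift_tens: "x \<in> carrier M \<Longrightarrow> y \<in> carrier N \<Longrightarrow> tensor_lift K P b (tens K M N x y) = b x y"
proof -
  let ?L = "free_lift K P (\<lambda>p. b (fst p) (snd p))"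
  have bc: "b (fst p) (snd p) \<in> carrier P" if "p \<in> carrier M \<times> carrier N" for p
    using that bilinear_map_closed[OF b] by auto
  have L: "linear_map K (tensor_free K M N) P ?L"
    unfolding tensor_free_def by (rule free_lift_linear[OF tensor_cring P bc])
  have lift: "tensor_lift K P b = (\<lambda>z. the_elem (?L ` z))"
    by (auto simp: tensor_lift_def free_lift_def[OF tensor_cring])
  show "linear_map K (tensor_mod K M N) P (tensor_lift K P b)"
    unfolding lift tensor_mod_def
    by (rule quot_factor_linear[OF tensor_free_module tensor_kernel_submodule P L tensor_kernel_killed])
  show "tensor_lift K P b (tens K M N x y) = b x y" if "x \<in> carrier M" "y \<in> carrier N"
    unfolding lift tens_def
    using quot_factor_eq[OF tensor_free_module tensor_kernel_submodule P L tensor_kernel_killed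
        tensor_free_gen_closed] free_lift_gen[OF tensor_cring P bc, where p = "(x, y)"] that by simp
qed

end

end

section \<open>Graded modules\<close>

lemma
  assumes "graded_module K M"
  shows graded_module_module: "module K M"
    and grade_submodule: "submodule (grade M n) K M"
  using assms by (auto simp: graded_module_def internal_direct_sum_def)

lemma grade_closed: "graded_module K M \<Longrightarrow> x \<in> grade M n \<Longrightarrow> x \<in> carrier M"
  by (meson grade_submodule submodule_subset)

lemma decomposes_sum:
  assumes "module K M" "\<And>i. S i \<subseteq> carrier M" "decomposes M UNIV S x c" "finite A" "{i. c i \<noteq> \<zero>\<^bsub>M\<^esub>} \<subseteq> A"
  shows "x = (\<Oplus>\<^bsub>M\<^esub>i\<in>A. c i)"
proof -
  interpret M: module K M by fact
  have c: "c i \<in> carrier M" for i using assms(2,3) by (auto simp: decomposes_def)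
  have "x = (\<Oplus>\<^bsub>M\<^esub>i\<in>{i. c i \<noteq> \<zero>\<^bsub>M\<^esub>}. c i)" using assms(3) by (simp add: decomposes_def)
  also have "\<dots> = (\<Oplus>\<^bsub>M\<^esub>i\<in>A. c i)"
    by (rule M.add.finprod_mono_neutral_cong_left) (use assms(4,5) c in auto)
  finally show ?thesis .
qed

lemma decomposesI:
  assumes "module K M" "\<And>i. S i \<subseteq> carrier M" "\<And>i. c i \<in> S i" "finite A" "{i. c i \<noteq> \<zero>\<^bsub>M\<^esub>} \<subseteq> A"
    and "x = (\<Oplus>\<^bsub>M\<^esub>i\<in>A. c i)"
  shows "decomposes M UNIV S x c"
proof -
  interpret M: module K M by fact
  have c: "c i \<in> carrier M" for i using assms(2,3) by auto
  have "(\<Oplus>\<^bsub>M\<^esub>i\<in>{i. c i \<noteq> \<zero>\<^bsub>M\<^esub>}. c i) = (\<Oplus>\<^bsub>M\<^esub>i\<in>A. c i)"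
    by (rule M.add.finprod_mono_neutral_cong_left) (use assms(4,5) c in auto)
  then show ?thesis
    using assms by (auto simp: decomposes_def intro: finite_subset)
qed

context
  fixes K :: "'k ring" and M :: "('k, 'm, 'r) gmod_scheme"
  assumes gr: "graded_module K M"
begin

interpretation M: module K M using gr by (rule graded_module_module)

lemma grade_subset: "grade M n \<subseteq> carrier M"
  using grade_closed[OF gr] by blast

lemma hcomp_decomposes: "x \<in> carrier M \<Longrightarrow> decomposes M UNIV (grade M) x (hcomp M x)"
  unfolding hcomp_def using gr
  by (intro theI'[of "decomposes M UNIV (grade M) x"]) (simp add: graded_module_def internal_direct_sum_def)

lemma hcomp_unique:
  assumes "x \<in> carrier M" "decomposes M UNIV (grade M) x c"
  shows "hcomp M x = c"
proof -
  have "\<exists>!c. decomposes M UNIV (grade M) x c"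
    using gr assms(1) by (simp add: graded_module_def internal_direct_sum_def)
  then show ?thesis using hcomp_decomposes[OF assms(1)] assms(2) by blast
qed

lemma hcomp_grade: "x \<in> carrier M \<Longrightarrow> hcomp M x n \<in> grade M n"
  using hcomp_decomposes by (simp add: decomposes_def)

lemma hcomp_closed: "x \<in> carrier M \<Longrightarrow> hcomp M x n \<in> carrier M"
  using hcomp_grade grade_closed[OF gr] by blast

lemma finite_hsupp: "x \<in> carrier M \<Longrightarrow> finite (hsupp M x)"
  using hcomp_decomposes by (simp add: decomposes_def hsupp_def)

lemma hcomp_sum: "x \<in> carrier M \<Longrightarrow> (\<Oplus>\<^bsub>M\<^esub>n\<in>hsupp M x. hcomp M x n) = x"
  using hcomp_decomposes by (simp add: decomposes_def hsupp_def)

lemma hcomp_homogeneous: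
  assumes "x \<in> grade M n"
  shows "hcomp M x m = (if m = n then x else \<zero>\<^bsub>M\<^esub>)"
proof -
  have x: "x \<in> carrier M" using assms by (rule grade_closed[OF gr])
  have "decomposes M UNIV (grade M) x (\<lambda>m. if m = n then x else \<zero>\<^bsub>M\<^esub>)"
  proof (rule decomposesI[OF M.module_axioms, of _ _ "{n}"])
    show "(if i = n then x else \<zero>\<^bsub>M\<^esub>) \<in> grade M i" for i
      using assms submodule_zero[OF grade_submodule[OF gr]] by auto
    show "x = (\<Oplus>\<^bsub>M\<^esub>i\<in>{n}. if i = n then x else \<zero>\<^bsub>M\<^esub>)" using x by simp
  qed (use grade_subset in auto)
  from hcomp_unique[OF x this] show ?thesis by simp
qed

lemma hsupp_homogeneous: "x \<in> grade M n \<Longrightarrow> hsupp M x = (if x = \<zero>\<^bsub>M\<^esub> then {} else {n})"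
  by (auto simp: hsupp_def hcomp_homogeneous)

text \<open>
  The componentwise sum of decompositions of \<open>x\<close> and \<open>y\<close> decomposes \<open>x + y\<close>, so uniqueness of
  decompositions makes the components additive; the same argument works for scalars.
\<close>

lemma hcomp_linear: "linear_map K M M (\<lambda>x. hcomp M x n)"
proof (rule linear_mapI)
  fix x y assume x: "x \<in> carrier M" and y: "y \<in> carrier M"
  let ?A = "hsupp M x \<union> hsupp M y"
  have "decomposes M UNIV (grade M) (x \<oplus>\<^bsub>M\<^esub> y) (\<lambda>n. hcomp M x n \<oplus>\<^bsub>M\<^esub> hcomp M y n)"
  proof (rule decomposesI[OF M.module_axioms, of _ _ ?A])
    show A: "finite ?A" using x y finite_hsupp by simp
    show "hcomp M x n \<oplus>\<^bsub>M\<^esub> hcomp M y n \<in> grade M n" for n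
      by (intro submodule_add[OF grade_submodule[OF gr]] hcomp_grade x y)
    show "{i. hcomp M x i \<oplus>\<^bsub>M\<^esub> hcomp M y i \<noteq> \<zero>\<^bsub>M\<^esub>} \<subseteq> ?A" by (auto simp: hsupp_def)
    have "x = (\<Oplus>\<^bsub>M\<^esub>n\<in>?A. hcomp M x n)"
      by (rule decomposes_sum[OF M.module_axioms grade_subset hcomp_decomposes[OF x] A])
        (auto simp: hsupp_def)
    moreover have "y = (\<Oplus>\<^bsub>M\<^esub>n\<in>?A. hcomp M y n)"
      by (rule decomposes_sum[OF M.module_axioms grade_subset hcomp_decomposes[OF y] A])
        (auto simp: hsupp_def)
    ultimately show "x \<oplus>\<^bsub>M\<^esub> y = (\<Oplus>\<^bsub>M\<^esub>n\<in>?A. hcomp M x n \<oplus>\<^bsub>M\<^esub> hcomp M y n)"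
      using M.finsum_addf[of "hcomp M x" ?A "hcomp M y"] hcomp_closed x y by (simp add: Pi_def)
  qed (use grade_subset in auto)
  from hcomp_unique[OF _ this] show "hcomp M (x \<oplus>\<^bsub>M\<^esub> y) n = hcomp M x n \<oplus>\<^bsub>M\<^esub> hcomp M y n"
    using x y by simp
next
  fix k x assume k: "k \<in> carrier K" and x: "x \<in> carrier M"
  let ?A = "hsupp M x"
  have "decomposes M UNIV (grade M) (k \<odot>\<^bsub>M\<^esub> x) (\<lambda>n. k \<odot>\<^bsub>M\<^esub> hcomp M x n)"
  proof (rule decomposesI[OF M.module_axioms, of _ _ ?A])
    show A: "finite ?A" using x finite_hsupp by simp
    show "k \<odot>\<^bsub>M\<^esub> hcomp M x n \<in> grade M n" for n
      by (intro submodule_smult[OF grade_submodule[OF gr]] hcomp_grade k x)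
    show "{i. k \<odot>\<^bsub>M\<^esub> hcomp M x i \<noteq> \<zero>\<^bsub>M\<^esub>} \<subseteq> ?A" using k by (auto simp: hsupp_def)
    show "k \<odot>\<^bsub>M\<^esub> x = (\<Oplus>\<^bsub>M\<^esub>n\<in>?A. k \<odot>\<^bsub>M\<^esub> hcomp M x n)"
      using M.finsum_smult_ldistr[OF A k, of "hcomp M x"] hcomp_closed x hcomp_sum[OF x] by (simp add: Pi_def)
  qed (use grade_subset in auto)
  from hcomp_unique[OF _ this] show "hcomp M (k \<odot>\<^bsub>M\<^esub> x) n = k \<odot>\<^bsub>M\<^esub> hcomp M x n"
    using x k by simp
qed (rule hcomp_closed)

text \<open>
  There is no case for scalars: homogeneous elements absorb them. So the rule also applies to
  properties that are not stable under scalars.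
\<close>

lemma graded_induct [consumes -3, case_names zero add grade]:
  assumes "x \<in> carrier M" and "P \<zero>\<^bsub>M\<^esub>"
    and "\<And>x y. x \<in> carrier M \<Longrightarrow> y \<in> carrier M \<Longrightarrow> P x \<Longrightarrow> P y \<Longrightarrow> P (x \<oplus>\<^bsub>M\<^esub> y)"
    and "\<And>n x. x \<in> grade M n \<Longrightarrow> P x"
  shows "P x"
proof -
  have "P (\<Oplus>\<^bsub>M\<^esub>n\<in>A. hcomp M x n)" if "finite A" for A
    using that
  proof (induction A)
    case (insert n A)
    have "(\<Oplus>\<^bsub>M\<^esub>n\<in>insert n A. hcomp M x n) = hcomp M x n \<oplus>\<^bsub>M\<^esub> (\<Oplus>\<^bsub>M\<^esub>n\<in>A. hcomp M x n)"
      using insert hcomp_closed[OF assms(1)] by (intro M.finsum_insert) auto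
    moreover have "P (hcomp M x n)" by (rule assms(4)[OF hcomp_grade[OF assms(1)]])
    ultimately show ?case
      using insert hcomp_closed[OF assms(1)] by (auto intro!: assms(3) M.finsum_closed)
  qed (use assms(2) in simp)
  from this[OF finite_hsupp[OF assms(1)]] show ?thesis by (simp add: hcomp_sum[OF assms(1)])
qed

lemma linear_map_graded_eq:
  assumes "module K P" "linear_map K M P f" "linear_map K M P g"
    and "\<And>n x. x \<in> grade M n \<Longrightarrow> f x = g x" "x \<in> carrier M"
  shows "f x = g x"
  using assms(5)
  by (induction rule: graded_induct)
    (use assms M.module_axioms in \<open>auto simp: linear_map_zero linear_map_add\<close>)

lemma span_grades: "span_mod K M (\<Union>n. grade M n) = carrier M"
proof
  show "span_mod K M (\<Union>n. grade M n) \<subseteq> carrier M"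
    using grade_subset by (intro span_mod_subset_carrier M.module_axioms) auto
  have sub: "submodule (span_mod K M (\<Union>n. grade M n)) K M"
    using grade_subset by (intro span_mod_submodule M.module_axioms) auto
  show "carrier M \<subseteq> span_mod K M (\<Union>n. grade M n)"
  proof
    fix x assume "x \<in> carrier M"
    then show "x \<in> span_mod K M (\<Union>n. grade M n)"
      by (induction rule: graded_induct)
        (auto intro: submodule_zero[OF sub] submodule_add[OF sub] span_mod_base)
  qed
qed

text \<open>
  A family of linear maps \<open>h n\<close> glues to one linear map that agrees with \<open>h n\<close> in degree \<open>n\<close>. Every
  formula with Koszul signs becomes a total map in this way.
\<close>

context
  fixes P :: "('k, 'p, 't) module_scheme" and h :: "int \<Rightarrow> 'm \<Rightarrow> 'p"
  assumes P: "module K P" and h: "\<And>n. linear_map K M P (h n)"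
begin

interpretation P: module K P by (rule P)

lemma graded_sum_extend:
  assumes "x \<in> carrier M" "finite A" "hsupp M x \<subseteq> A"
  shows "(\<Oplus>\<^bsub>P\<^esub>n\<in>hsupp M x. h n (hcomp M x n)) = (\<Oplus>\<^bsub>P\<^esub>n\<in>A. h n (hcomp M x n))"
  by (rule P.add.finprod_mono_neutral_cong_left)
    (use assms linear_map_zero[OF M.module_axioms P h] in
      \<open>auto simp: hsupp_def intro!: linear_map_closed[OF h] hcomp_closed\<close>)

lemma graded_sum_linear: "linear_map K M P (\<lambda>x. \<Oplus>\<^bsub>P\<^esub>n\<in>hsupp M x. h n (hcomp M x n))"
proof -
  have lin: "linear_map K M P (\<lambda>x. \<Oplus>\<^bsub>P\<^esub>n\<in>A. h n (hcomp M x n))" if "finite A" for A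
    by (intro linear_map_finsum_fun M.module_axioms P that linear_map_comp[OF hcomp_linear h])
  show ?thesis
  proof (rule linear_mapI)
    fix x assume x: "x \<in> carrier M"
    then show "(\<Oplus>\<^bsub>P\<^esub>n\<in>hsupp M x. h n (hcomp M x n)) \<in> carrier P"
      using linear_map_closed[OF lin[OF finite_hsupp]] by simp
    fix y assume y: "y \<in> carrier M"
    let ?A = "hsupp M x \<union> hsupp M y \<union> hsupp M (x \<oplus>\<^bsub>M\<^esub> y)"
    have fin: "finite ?A" using x y finite_hsupp by simp
    have ext: "(\<Oplus>\<^bsub>P\<^esub>n\<in>hsupp M z. h n (hcomp M z n)) = (\<Oplus>\<^bsub>P\<^esub>n\<in>?A. h n (hcomp M z n))"
      if "z \<in> {x, y, x \<oplus>\<^bsub>M\<^esub> y}" for z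
      using that x y by (intro graded_sum_extend fin) auto
    show "(\<Oplus>\<^bsub>P\<^esub>n\<in>hsupp M (x \<oplus>\<^bsub>M\<^esub> y). h n (hcomp M (x \<oplus>\<^bsub>M\<^esub> y) n)) =
      (\<Oplus>\<^bsub>P\<^esub>n\<in>hsupp M x. h n (hcomp M x n)) \<oplus>\<^bsub>P\<^esub> (\<Oplus>\<^bsub>P\<^esub>n\<in>hsupp M y. h n (hcomp M y n))"
      using linear_map_add[OF lin[OF fin] x y] ext[of x] ext[of y] ext[of "x \<oplus>\<^bsub>M\<^esub> y"] by simp
  next
    fix k x assume k: "k \<in> carrier K" and x: "x \<in> carrier M"
    let ?A = "hsupp M x \<union> hsupp M (k \<odot>\<^bsub>M\<^esub> x)"
    have fin: "finite ?A" using x k finite_hsupp by simp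
    have ext: "(\<Oplus>\<^bsub>P\<^esub>n\<in>hsupp M z. h n (hcomp M z n)) = (\<Oplus>\<^bsub>P\<^esub>n\<in>?A. h n (hcomp M z n))"
      if "z \<in> {x, k \<odot>\<^bsub>M\<^esub> x}" for z
      using that x k by (intro graded_sum_extend fin) auto
    show "(\<Oplus>\<^bsub>P\<^esub>n\<in>hsupp M (k \<odot>\<^bsub>M\<^esub> x). h n (hcomp M (k \<odot>\<^bsub>M\<^esub> x) n)) =
      k \<odot>\<^bsub>P\<^esub> (\<Oplus>\<^bsub>P\<^esub>n\<in>hsupp M x. h n (hcomp M x n))"
      using linear_map_smult[OF lin[OF fin] k x] ext[of x] ext[of "k \<odot>\<^bsub>M\<^esub> x"] by simp
  qed
qed

lemma graded_sum_homogeneous: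
  assumes "x \<in> grade M n"
  shows "(\<Oplus>\<^bsub>P\<^esub>n\<in>hsupp M x. h n (hcomp M x n)) = h n x"
proof -
  have x: "x \<in> carrier M" using assms grade_subset by blast
  then have "h n x \<in> carrier P" using linear_map_closed[OF h] by blast
  then show ?thesis
    using graded_sum_extend[OF x, of "{n}"] assms by (simp add: hsupp_homogeneous hcomp_homogeneous)
qed

end

lemma twist_linear: "linear_map K M M (twist M)"
  unfolding twist_def
  by (rule graded_sum_linear[OF M.module_axioms linear_map_ksign_fun[OF M.module_axioms linear_map_id]])

lemma twist_homogeneous: "x \<in> grade M n \<Longrightarrow> twist M x = ksign M n x"
  unfolding twist_def
  by (rule graded_sum_homogeneous[OF M.module_axioms linear_map_ksign_fun[OF M.module_axioms linear_map_id]])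

end

text \<open>
  The elements with some decomposition form a submodule that contains all homogeneous elements, hence
  everything. Applying \<open>\<pi> n\<close> to a decomposition of \<open>x\<close> returns its component of degree \<open>n\<close>, so that
  component is determined by \<open>x\<close>. Below, each direct sum condition is proved by exhibiting such
  projections.
\<close>

lemma graded_moduleI:
  fixes K :: "'k ring" and M :: "('k, 'm, 'r) gmod_scheme"
  assumes M: "module K M" and sub: "\<And>n. submodule (grade M n) K M"
    and span: "carrier M \<subseteq> span_mod K M (\<Union>n. grade M n)"
    and lin: "\<And>n. linear_map K M M (\<pi> n)"
    and proj: "\<And>m n x. x \<in> grade M m \<Longrightarrow> \<pi> n x = (if m = n then x else \<zero>\<^bsub>M\<^esub>)"
  shows "graded_module K M"
proof -
  interpret M: module K M by fact
  have gc: "grade M n \<subseteq> carrier M" for n using submodule_subset[OF sub] by blast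
  have ex: "\<exists>c. decomposes M UNIV (grade M) x c" if "x \<in> carrier M" for x
  proof -
    let ?D = "{x \<in> carrier M. \<exists>c. decomposes M UNIV (grade M) x c}"
    have "submodule ?D K M"
    proof (rule submodule_if[OF M])
      have "decomposes M UNIV (grade M) \<zero>\<^bsub>M\<^esub> (\<lambda>n. \<zero>\<^bsub>M\<^esub>)"
        by (rule decomposesI[OF M gc, where A = "{}"]) (use submodule_zero[OF sub] in auto)
      then show "\<zero>\<^bsub>M\<^esub> \<in> ?D" by auto
      fix x y assume "x \<in> ?D" "y \<in> ?D"
      then obtain c d where x: "x \<in> carrier M" and y: "y \<in> carrier M"
        and c: "decomposes M UNIV (grade M) x c" and d: "decomposes M UNIV (grade M) y d" by auto
      let ?A = "{n. c n \<noteq> \<zero>\<^bsub>M\<^esub>} \<union> {n. d n \<noteq> \<zero>\<^bsub>M\<^esub>}"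
      have fin: "finite ?A" using c d by (auto simp: decomposes_def)
      have cd: "c n \<in> grade M n" "d n \<in> grade M n" "c n \<in> carrier M" "d n \<in> carrier M" for n
        using c d gc by (auto simp: decomposes_def)
      have "decomposes M UNIV (grade M) (x \<oplus>\<^bsub>M\<^esub> y) (\<lambda>n. c n \<oplus>\<^bsub>M\<^esub> d n)"
      proof (rule decomposesI[OF M gc _ fin])
        show "x \<oplus>\<^bsub>M\<^esub> y = (\<Oplus>\<^bsub>M\<^esub>n\<in>?A. c n \<oplus>\<^bsub>M\<^esub> d n)"
          using decomposes_sum[OF M gc c fin] decomposes_sum[OF M gc d fin] M.finsum_addf[of c ?A d] cd
          by (simp add: Pi_def)
      qed (use cd submodule_add[OF sub] in auto)
      then show "x \<oplus>\<^bsub>M\<^esub> y \<in> ?D" using x y by auto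
    next
      fix k x assume k: "k \<in> carrier K" and "x \<in> ?D"
      then obtain c where x: "x \<in> carrier M" and c: "decomposes M UNIV (grade M) x c" by auto
      let ?A = "{n. c n \<noteq> \<zero>\<^bsub>M\<^esub>}"
      have fin: "finite ?A" using c by (auto simp: decomposes_def)
      have cd: "c n \<in> grade M n" "c n \<in> carrier M" for n
        using c gc by (auto simp: decomposes_def)
      have "decomposes M UNIV (grade M) (k \<odot>\<^bsub>M\<^esub> x) (\<lambda>n. k \<odot>\<^bsub>M\<^esub> c n)"
      proof (rule decomposesI[OF M gc _ fin])
        show "k \<odot>\<^bsub>M\<^esub> x = (\<Oplus>\<^bsub>M\<^esub>n\<in>?A. k \<odot>\<^bsub>M\<^esub> c n)"
          using decomposes_sum[OF M gc c fin] M.finsum_smult_ldistr[OF fin k, of c] cd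
          by (simp add: Pi_def)
      qed (use cd k submodule_smult[OF sub] in auto)
      then show "k \<odot>\<^bsub>M\<^esub> x \<in> ?D" using x k by auto
    qed auto
    moreover have "(\<Union>n. grade M n) \<subseteq> ?D"
    proof clarsimp
      fix n x assume x: "x \<in> grade M n"
      then have "x \<in> carrier M" using gc by blast
      with x have "decomposes M UNIV (grade M) x (\<lambda>m. if m = n then x else \<zero>\<^bsub>M\<^esub>)"
        by (intro decomposesI[OF M gc, where A = "{n}"]) (use gc submodule_zero[OF sub] in auto)
      then show "x \<in> carrier M \<and> (\<exists>c. decomposes M UNIV (grade M) x c)" using x gc by blast
    qed
    ultimately have "span_mod K M (\<Union>n. grade M n) \<subseteq> ?D" by (rule span_mod_least)
    then show ?thesis using span that by auto
  qed
  have uniq: "c n = \<pi> n x" if "decomposes M UNIV (grade M) x c" for x c n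
  proof -
    let ?A = "insert n {n. c n \<noteq> \<zero>\<^bsub>M\<^esub>}"
    have fin: "finite ?A" and c: "\<And>m. c m \<in> grade M m" using that by (auto simp: decomposes_def)
    have cc: "c m \<in> carrier M" for m using c[of m] gc[of m] by blast
    have "\<pi> n x = (\<Oplus>\<^bsub>M\<^esub>m\<in>?A. \<pi> n (c m))"
      by (subst decomposes_sum[OF M gc that fin], blast, rule linear_map_finsum[OF M M lin fin])
        (use cc in blast)
    also have "\<dots> = (\<Oplus>\<^bsub>M\<^esub>m\<in>?A. if n = m then c m else \<zero>\<^bsub>M\<^esub>)"
      using cc by (intro M.finsum_cong' refl) (auto simp: proj[OF c])
    also have "\<dots> = c n"
      using cc fin by (intro M.finsum_singleton) auto
    finally show ?thesis by simp
  qed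
  show ?thesis
    unfolding graded_module_def internal_direct_sum_def
  proof (intro conjI ballI M sub)
    fix x assume "x \<in> carrier M"
    from ex[OF this] show "\<exists>!c. decomposes M UNIV (grade M) x c"
    proof
      fix c assume c: "decomposes M UNIV (grade M) x c"
      have "d = c" if "decomposes M UNIV (grade M) x d" for d
        using uniq[OF c] uniq[OF that] by (intro ext) simp
      then show ?thesis using c by blast
    qed
  qed
qed

subsection \<open>Signs\<close>

lemma (in module) ksign_closed: "x \<in> carrier M \<Longrightarrow> ksign M n x \<in> carrier M"
  by (simp add: ksign_def)

lemma (in module) ksign_add: "x \<in> carrier M \<Longrightarrow> y \<in> carrier M \<Longrightarrow>
    ksign M n (x \<oplus>\<^bsub>M\<^esub> y) = ksign M n x \<oplus>\<^bsub>M\<^esub> ksign M n y"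
  by (simp add: ksign_def M.minus_add)

lemma (in module) ksign_minus: "x \<in> carrier M \<Longrightarrow> y \<in> carrier M \<Longrightarrow>
    ksign M n (x \<ominus>\<^bsub>M\<^esub> y) = ksign M n x \<ominus>\<^bsub>M\<^esub> ksign M n y"
  by (simp add: ksign_def a_minus_def M.minus_add)

lemma (in module) ksign_ksign: "x \<in> carrier M \<Longrightarrow> ksign M m (ksign M n x) = ksign M (m + n) x"
  by (auto simp: ksign_def)

lemma (in module) ksign_zero: "ksign M n \<zero>\<^bsub>M\<^esub> = \<zero>\<^bsub>M\<^esub>"
  by (simp add: ksign_def)

lemmas (in module) ksign_simps = ksign_closed ksign_add ksign_ksign ksign_zero

lemma ksign_cong: "even m = even n \<Longrightarrow> ksign M m x = ksign M n x"
  by (simp add: ksign_def)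

section \<open>The tensor product of dg modules\<close>

text \<open>
  The induction runs over the submodule of those \<open>x\<close> all of whose multiples satisfy \<open>P\<close>.
\<close>

lemma span_mod_induct [consumes 3, case_names zero add gen]:
  assumes "module K M" "S \<subseteq> carrier M" "x \<in> span_mod K M S"
    and "P \<zero>\<^bsub>M\<^esub>"
    and "\<And>x y. x \<in> carrier M \<Longrightarrow> y \<in> carrier M \<Longrightarrow> P x \<Longrightarrow> P y \<Longrightarrow> P (x \<oplus>\<^bsub>M\<^esub> y)"
    and "\<And>k s. k \<in> carrier K \<Longrightarrow> s \<in> S \<Longrightarrow> P (k \<odot>\<^bsub>M\<^esub> s)"
  shows "P x"
proof -
  interpret M: module K M by fact
  let ?H = "{x \<in> carrier M. \<forall>k\<in>carrier K. P (k \<odot>\<^bsub>M\<^esub> x)}"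
  have "submodule ?H K M"
    by (rule submodule_if[OF assms(1)])
      (use assms(4,5) in \<open>auto simp: M.smult_r_distr M.smult_assoc1[symmetric]\<close>)
  moreover have "S \<subseteq> ?H" using assms(2,6) by auto
  ultimately have "span_mod K M S \<subseteq> ?H" by (rule span_mod_least)
  then have "x \<in> ?H" using assms(3) by blast
  then have "P (\<one>\<^bsub>K\<^esub> \<odot>\<^bsub>M\<^esub> x)" "x \<in> carrier M" using M.R.one_closed by blast+
  then show ?thesis by simp
qed

text \<open>
  Linear algebra sees only four fields of a record; records that agree there are interchangeable.
\<close>

definition same_module ::
  "('k, 'm, 'r) module_scheme \<Rightarrow> ('k, 'm, 's) module_scheme \<Rightarrow> bool" where
  "same_module M M' \<longleftrightarrow>
     carrier M = carrier M' \<and> add M = add M' \<and> zero M = zero M' \<and> smult M = smult M'"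

lemma same_module_module:
  assumes "same_module M M'" "module K M"
  shows "module K M'"
proof -
  interpret M: module K M by fact
  have e: "carrier M' = carrier M" "add M' = add M" "zero M' = zero M" "smult M' = smult M"
    using assms(1) by (simp_all add: same_module_def)
  have "abelian_group M'"
    by (rule abelian_groupI) (auto simp: e M.a_ac intro: exI[of _ "\<ominus>\<^bsub>M\<^esub> _"] M.l_neg)
  then show ?thesis
    by (rule moduleI[OF M.R.is_cring]) (auto simp: e M.smult_l_distr M.smult_r_distr M.smult_assoc1)
qed

lemma same_module_simps:
  assumes "same_module M M'"
  shows "linear_map K M' N = linear_map K M N" "linear_map K N M' = linear_map K N M"
    and "submodule H K M' \<longleftrightarrow> submodule H K M" "span_mod K M' S = span_mod K M S"
    and "a_inv M' = a_inv M" "a_minus M' x y = a_minus M x y" "finsum M' = (finsum M :: ('z \<Rightarrow> _) \<Rightarrow> _)"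
    and "ksign M' n = ksign M n" "a_r_coset M' = a_r_coset M" "quot_mod M' = quot_mod M"
proof -
  have e: "carrier M' = carrier M" "add M' = add M" "zero M' = zero M" "smult M' = smult M"
    using assms by (simp_all add: same_module_def)
  show "linear_map K M' N = linear_map K M N" "linear_map K N M' = linear_map K N M"
    by (auto simp: linear_map_def e fun_eq_iff)
  show i: "a_inv M' = a_inv M" by (simp add: fun_eq_iff a_inv_def m_inv_def e)
  have sg: "subgroup H (add_monoid M') \<longleftrightarrow> subgroup H (add_monoid M)" for H
    using i by (simp add: subgroup_def e a_inv_def fun_eq_iff)
  show sm: "submodule H K M' \<longleftrightarrow> submodule H K M" for H
    by (simp only: submodule_def submodule_axioms_def sg e(4))
  show "span_mod K M' S = span_mod K M S" by (simp add: span_mod_def sm)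
  show "a_minus M' x y = a_minus M x y" by (simp add: a_minus_def e i)
  show "finsum M' = (finsum M :: ('z \<Rightarrow> _) \<Rightarrow> _)" by (simp add: fun_eq_iff finsum_def finprod_def e)
  show "ksign M' n = ksign M n" by (simp add: ksign_def fun_eq_iff i)
  show c: "a_r_coset M' = a_r_coset M" by (simp add: fun_eq_iff a_r_coset_def r_coset_def e)
  show "quot_mod M' = quot_mod M"
    by (simp add: quot_mod_def fun_eq_iff e A_RCOSETS_def RCOSETS_def r_coset_def set_add_def set_mult_def c)
qed

lemma same_module_bilinear:
  "same_module P P' \<Longrightarrow> bilinear_map K M N P' b \<longleftrightarrow> bilinear_map K M N P b"
  by (simp add: bilinear_map_def same_module_simps(2)[of P P'])

lemma
  assumes "dg_module K M"
  shows dg_module_graded: "graded_module K M"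
    and dg_module_module: "module K M"
    and diff_linear: "linear_map K M M (diff M)"
    and diff_grade: "x \<in> grade M n \<Longrightarrow> diff M x \<in> grade M (n + 1)"
    and diff_diff: "x \<in> carrier M \<Longrightarrow> diff M (diff M x) = \<zero>\<^bsub>M\<^esub>"
  using assms by (auto simp: dg_module_def graded_module_def)

lemma dg_module_grade_closed: "dg_module K M \<Longrightarrow> x \<in> grade M n \<Longrightarrow> x \<in> carrier M"
  by (meson dg_module_graded grade_closed)

lemma diff_closed: "dg_module K M \<Longrightarrow> x \<in> carrier M \<Longrightarrow> diff M x \<in> carrier M"
  by (meson diff_linear linear_map_closed)

lemma same_module_dg_tensor: "same_module (tensor_mod K M N) (dg_tensor K M N)"
  by (simp add: same_module_def dg_tensor_def Let_def)

lemma dg_tensor_grade: "grade (dg_tensor K M N) n = span_mod K (dg_tensor K M N)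
    {tens K M N x y |x y. \<exists>p q. p + q = n \<and> x \<in> grade M p \<and> y \<in> grade N q}"
  by (simp add: same_module_simps(4)[OF same_module_dg_tensor]) (simp add: dg_tensor_def Let_def)

context
  fixes K :: "'k ring" and M :: "('k, 'm, 'r) dgmod_scheme" and N :: "('k, 'n, 's) dgmod_scheme"
  assumes dgM: "dg_module K M" and dgN: "dg_module K N"
begin

interpretation M: module K M by (rule dg_module_module[OF dgM])
interpretation N: module K N by (rule dg_module_module[OF dgN])

private abbreviation (input) "T \<equiv> dg_tensor K M N"
private abbreviation (input) "tn \<equiv> tens K M N"

lemma dg_tensor_module: "module K T"
  by (rule same_module_module[OF same_module_dg_tensor tensor_mod_module[OF M.module_axioms N.module_axioms]])

interpretation T: module K T by (rule dg_tensor_module)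

lemma dg_tens_bilinear: "bilinear_map K M N T tn"
  using tens_bilinear[OF M.module_axioms N.module_axioms]
  by (simp add: same_module_bilinear[OF same_module_dg_tensor])

lemma dg_tens_closed: "x \<in> carrier M \<Longrightarrow> y \<in> carrier N \<Longrightarrow> tn x y \<in> carrier T"
  by (rule bilinear_map_closed[OF dg_tens_bilinear])

lemmas dg_tens_right = bilinear_map_right[OF dg_tens_bilinear]
lemmas dg_tens_left = bilinear_map_left[OF dg_tens_bilinear]

lemma dg_tensor_lift_linear:
  "module K P \<Longrightarrow> bilinear_map K M N P b \<Longrightarrow> linear_map K T P (tensor_lift K P b)"
  using tensor_lift_linear[OF M.module_axioms N.module_axioms]
  by (simp add: same_module_simps(1)[OF same_module_dg_tensor])

lemma dg_tensor_lift_tens: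
  "module K P \<Longrightarrow> bilinear_map K M N P b \<Longrightarrow> x \<in> carrier M \<Longrightarrow> y \<in> carrier N \<Longrightarrow>
    tensor_lift K P b (tn x y) = b x y"
  by (rule tensor_lift_tens[OF M.module_axioms N.module_axioms])

text \<open>
  Pure tensors absorb scalars, and each factor is a sum of homogeneous elements.
\<close>

lemma dg_tensor_induct [consumes -3, case_names zero add tens]:
  assumes "z \<in> carrier T" and "P \<zero>\<^bsub>T\<^esub>"
    and "\<And>x y. x \<in> carrier T \<Longrightarrow> y \<in> carrier T \<Longrightarrow> P x \<Longrightarrow> P y \<Longrightarrow> P (x \<oplus>\<^bsub>T\<^esub> y)"
    and "\<And>p q x y. x \<in> grade M p \<Longrightarrow> y \<in> grade N q \<Longrightarrow> P (tn x y)"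
  shows "P z"
proof -
  have *: "P (tn x y)" if "x \<in> carrier M" "y \<in> carrier N" for x y
    using that
  proof (induction rule: graded_induct[OF dg_module_graded[OF dgM], consumes 1, case_names zero add grade])
    case zero
    then show ?case
      using assms(2) linear_map_zero[OF M.module_axioms T.module_axioms dg_tens_left] by simp
  next
    case (add x x')
    then show ?case
      using assms(3) by (simp add: linear_map_add[OF dg_tens_left] dg_tens_closed)
  next
    case (grade n x)
    have x: "x \<in> carrier M" using grade(1) by (rule dg_module_grade_closed[OF dgM])
    from grade(2) show ?case
    proof (induction rule: graded_induct[OF dg_module_graded[OF dgN], consumes 1, case_names zero add grade])
      case zero
      then show ?case
        using assms(2) linear_map_zero[OF N.module_axioms T.module_axioms dg_tens_right[OF x]] by simp
    next
      case (add y y')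
      then show ?case
        using assms(3) x by (simp add: linear_map_add[OF dg_tens_right[OF x]] dg_tens_closed)
    next
      case (grade m y)
      then show ?case using \<open>x \<in> grade M n\<close> assms(4) by blast
    qed
  qed
  have sub: "{tn x y |x y. x \<in> carrier M \<and> y \<in> carrier N} \<subseteq> carrier T"
    using dg_tens_closed by auto
  have "z \<in> span_mod K T {tn x y |x y. x \<in> carrier M \<and> y \<in> carrier N}"
    using assms(1) tensor_mod_span[OF M.module_axioms N.module_axioms] same_module_dg_tensor[of K M N]
    by (simp add: same_module_simps(4)[OF same_module_dg_tensor]) (simp add: same_module_def)
  from T.module_axioms sub this show ?thesis
  proof (induction rule: span_mod_induct)
    case (gen k s)
    then obtain x y where "s = tn x y" "x \<in> carrier M" "y \<in> carrier N" by auto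
    then show ?case
      using * gen(1) by (simp add: linear_map_smult[OF dg_tens_left, symmetric])
  qed (use dg_tens_closed assms(2,3) in auto)
qed

lemma dg_tensor_eqI:
  assumes "module K P" "linear_map K T P f" "linear_map K T P g"
    and "\<And>p q x y. x \<in> grade M p \<Longrightarrow> y \<in> grade N q \<Longrightarrow> f (tn x y) = g (tn x y)"
    and "z \<in> carrier T"
  shows "f z = g z"
  using assms(5)
  by (induction rule: dg_tensor_induct)
    (use assms T.module_axioms in \<open>auto simp: linear_map_zero linear_map_add\<close>)

lemma dg_tens_grade:
  "x \<in> grade M p \<Longrightarrow> y \<in> grade N q \<Longrightarrow> tn x y \<in> grade T (p + q)"
  unfolding dg_tensor_grade by (rule span_mod_base) blast

lemma dg_tensor_grade_subset:
  "{tn x y |x y. \<exists>p q. p + q = n \<and> x \<in> grade M p \<and> y \<in> grade N q} \<subseteq> carrier T"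
  using dg_module_grade_closed[OF dgM] dg_module_grade_closed[OF dgN] by (auto intro!: dg_tens_closed)

lemma dg_tensor_grade_submodule: "submodule (grade T n) K T"
  unfolding dg_tensor_grade by (rule span_mod_submodule[OF T.module_axioms dg_tensor_grade_subset])

lemma dg_tensor_grade_into:
  assumes "module K P" "linear_map K T P f" "submodule H K P"
    and "\<And>p q x y. p + q = n \<Longrightarrow> x \<in> grade M p \<Longrightarrow> y \<in> grade N q \<Longrightarrow> f (tn x y) \<in> H"
    and "z \<in> grade T n"
  shows "f z \<in> H"
  by (rule linear_map_span_into[OF T.module_axioms assms(1-3) dg_tensor_grade_subset])
    (use assms(4,5) in \<open>auto simp: dg_tensor_grade\<close>)

lemma dg_tensor_grade_eq:
  assumes "module K P" "linear_map K T P f" "linear_map K T P g"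
    and "\<And>p q x y. p + q = n \<Longrightarrow> x \<in> grade M p \<Longrightarrow> y \<in> grade N q \<Longrightarrow> f (tn x y) = g (tn x y)"
    and "z \<in> grade T n"
  shows "f z = g z"
  by (rule linear_map_span_eq[OF T.module_axioms assms(1-3) dg_tensor_grade_subset])
    (use assms(4,5) in \<open>auto simp: dg_tensor_grade\<close>)

text \<open>
  The projection to degree \<open>n\<close> sends \<open>x \<otimes> y\<close> with \<open>x\<close> of degree \<open>p\<close> to \<open>x \<otimes> y'\<close>, where \<open>y'\<close> is the
  component of \<open>y\<close> of degree \<open>n - p\<close>. Gluing over \<open>p\<close> makes this a bilinear map in \<open>x\<close> and \<open>y\<close>.
\<close>

lemma dg_tensor_graded: "graded_module K T"
proof (rule graded_moduleI)
  note grM = dg_module_graded[OF dgM] and grN = dg_module_graded[OF dgN]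
  let ?h = "\<lambda>n y p x. tn x (hcomp N y (n - p))"
  let ?b = "\<lambda>n x y. \<Oplus>\<^bsub>T\<^esub>p\<in>hsupp M x. ?h n y p (hcomp M x p)"
  have h: "linear_map K M T (?h n y p)" if "y \<in> carrier N" for n p y
    using that by (intro dg_tens_left hcomp_closed[OF grN])
  have b: "bilinear_map K M N T (?b n)" for n
  proof (rule bilinear_mapI)
    fix x assume x: "x \<in> carrier M"
    show "linear_map K N T (?b n x)"
      by (intro linear_map_finsum_fun N.module_axioms T.module_axioms finite_hsupp[OF grM] x
          linear_map_comp[OF hcomp_linear[OF grN] dg_tens_right] hcomp_closed[OF grM])
  next
    fix y assume "y \<in> carrier N"
    then show "linear_map K M T (\<lambda>x. ?b n x y)"
      by (intro graded_sum_linear[OF grM T.module_axioms] h)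
  qed
  show "linear_map K T T (tensor_lift K T (?b n))" for n
    by (rule dg_tensor_lift_linear[OF T.module_axioms b])
  show "tensor_lift K T (?b n) z = (if m = n then z else \<zero>\<^bsub>T\<^esub>)" if "z \<in> grade T m" for m n z
  proof -
    have "tensor_lift K T (?b n) z = (\<lambda>z. if m = n then z else \<zero>\<^bsub>T\<^esub>) z"
    proof (rule dg_tensor_grade_eq[OF T.module_axioms _ _ _ that])
      show "linear_map K T T (tensor_lift K T (?b n))"
        by (rule dg_tensor_lift_linear[OF T.module_axioms b])
      show "linear_map K T T (\<lambda>z. if m = n then z else \<zero>\<^bsub>T\<^esub>)"
        by (cases "m = n") (simp_all add: linear_map_id linear_map_zero_fun T.module_axioms)
      fix p q x y assume pq: "p + q = m" and x: "x \<in> grade M p" and y: "y \<in> grade N q"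
      have xc: "x \<in> carrier M" and yc: "y \<in> carrier N"
        using grade_closed[OF grM x] grade_closed[OF grN y] by auto
      have "tensor_lift K T (?b n) (tn x y) = ?b n x y"
        by (rule dg_tensor_lift_tens[OF T.module_axioms b xc yc])
      also have "\<dots> = tn x (hcomp N y (n - p))"
        by (rule graded_sum_homogeneous[OF grM T.module_axioms h[OF yc] x])
      also have "\<dots> = (if m = n then tn x y else \<zero>\<^bsub>T\<^esub>)"
        using pq linear_map_zero[OF N.module_axioms T.module_axioms dg_tens_right[OF xc]]
        by (auto simp: hcomp_homogeneous[OF grN y])
      finally show "tensor_lift K T (?b n) (tn x y) = (if m = n then tn x y else \<zero>\<^bsub>T\<^esub>)" .
    qed
    then show ?thesis by simp
  qed
  show "carrier T \<subseteq> span_mod K T (\<Union>n. grade T n)"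
  proof
    have sub: "submodule (span_mod K T (\<Union>n. grade T n)) K T"
      using submodule_subset[OF dg_tensor_grade_submodule]
      by (intro span_mod_submodule[OF T.module_axioms]) auto
    fix z assume "z \<in> carrier T"
    then show "z \<in> span_mod K T (\<Union>n. grade T n)"
    proof (induction rule: dg_tensor_induct)
      case (tens p q x y)
      then show ?case using dg_tens_grade by (intro span_mod_base) blast
    qed (simp_all add: submodule_zero[OF sub] submodule_add[OF sub])
  qed
qed (rule T.module_axioms dg_tensor_grade_submodule)+

lemma dg_tensor_diff_bilinear:
  "bilinear_map K M N T (\<lambda>x y. tn (diff M x) y \<oplus>\<^bsub>T\<^esub> tn (twist M x) (diff N y))"
proof -
  note tw = twist_linear[OF dg_module_graded[OF dgM]]
  show ?thesis
    by (intro bilinear_mapI linear_map_plus_fun T.module_axioms)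
      (auto intro: dg_tens_right linear_map_comp[OF diff_linear[OF dgN] dg_tens_right]
        linear_map_comp[OF diff_linear[OF dgM] dg_tens_left] linear_map_comp[OF tw dg_tens_left]
        diff_closed[OF dgM] diff_closed[OF dgN] linear_map_closed[OF tw])
qed

lemma dg_tensor_diff: "diff T = tensor_lift K T (\<lambda>x y. tn (diff M x) y \<oplus>\<^bsub>T\<^esub> tn (twist M x) (diff N y))"
proof -
  have e: "add (tensor_mod K M N) = add T" "finsum (tensor_mod K M N) = (finsum T :: ('m \<times> 'n \<Rightarrow> _) \<Rightarrow> _)"
      "smult (tensor_mod K M N) = smult T"
    using same_module_simps(7)[OF same_module_dg_tensor[of K M N], symmetric] same_module_dg_tensor[of K M N]
    by (simp_all add: same_module_def)
  have "diff T = tensor_lift K (tensor_mod K M N)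
      (\<lambda>x y. tn (diff M x) y \<oplus>\<^bsub>tensor_mod K M N\<^esub> tn (twist M x) (diff N y))"
    by (simp add: dg_tensor_def Let_def)
  also have "\<dots> = tensor_lift K T (\<lambda>x y. tn (diff M x) y \<oplus>\<^bsub>T\<^esub> tn (twist M x) (diff N y))"
    by (rule ext) (simp only: tensor_lift_def e)
  finally show ?thesis .
qed

lemma dg_tensor_diff_linear: "linear_map K T T (diff T)"
  unfolding dg_tensor_diff by (rule dg_tensor_lift_linear[OF T.module_axioms dg_tensor_diff_bilinear])

lemma dg_tensor_diff_tens:
  assumes "x \<in> grade M p" "y \<in> carrier N"
  shows "diff T (tn x y) = tn (diff M x) y \<oplus>\<^bsub>T\<^esub> ksign T p (tn x (diff N y))"
proof -
  have x: "x \<in> carrier M" using assms(1) by (rule dg_module_grade_closed[OF dgM])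
  show ?thesis
    unfolding dg_tensor_diff
    by (subst dg_tensor_lift_tens[OF T.module_axioms dg_tensor_diff_bilinear x assms(2)])
      (simp add: twist_homogeneous[OF dg_module_graded[OF dgM] assms(1)]
        linear_map_ksign[OF M.module_axioms T.module_axioms dg_tens_left[OF diff_closed[OF dgN assms(2)]] x])
qed

text \<open>
  The two mixed terms of the squared differential are \<open>dx \<otimes> dy\<close> with the signs of \<open>p + 1\<close> and \<open>p\<close>,
  and cancel.
\<close>

lemma dg_tensor_dg_module: "dg_module K T"
  unfolding dg_module_def
proof (intro conjI allI ballI dg_tensor_graded dg_tensor_diff_linear)
  note cl = dg_module_grade_closed[OF dgM] dg_module_grade_closed[OF dgN]
  fix n z assume "z \<in> grade T n"
  then show "diff T z \<in> grade T (n + 1)"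
  proof (rule dg_tensor_grade_into[OF T.module_axioms dg_tensor_diff_linear dg_tensor_grade_submodule, rotated])
    fix p q x y assume n: "p + q = n" and x: "x \<in> grade M p" and y: "y \<in> grade N q"
    have "tn (diff M x) y \<in> grade T (n + 1)" "tn x (diff N y) \<in> grade T (n + 1)"
      using dg_tens_grade[OF diff_grade[OF dgM x] y] dg_tens_grade[OF x diff_grade[OF dgN y]] n
      by (simp_all add: algebra_simps)
    then show "diff T (tn x y) \<in> grade T (n + 1)"
      unfolding dg_tensor_diff_tens[OF x cl(2)[OF y]]
      by (intro submodule_add[OF dg_tensor_grade_submodule] submodule_ksign[OF dg_tensor_grade_submodule])
  qed
next
  note cl = dg_module_grade_closed[OF dgM] dg_module_grade_closed[OF dgN]
  fix z assume "z \<in> carrier T"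
  then show "diff T (diff T z) = \<zero>\<^bsub>T\<^esub>"
  proof (rule dg_tensor_eqI[OF T.module_axioms linear_map_comp[OF dg_tensor_diff_linear dg_tensor_diff_linear]
        linear_map_zero_fun[OF T.module_axioms], rotated])
    fix p q x y assume x: "x \<in> grade M p" and y: "y \<in> grade N q"
    note xy = cl(1)[OF x] cl(2)[OF y] diff_closed[OF dgM cl(1)[OF x]] diff_closed[OF dgN cl(2)[OF y]]
    have "diff T (diff T (tn x y)) = diff T (tn (diff M x) y) \<oplus>\<^bsub>T\<^esub> ksign T p (diff T (tn x (diff N y)))"
      using xy by (simp add: dg_tensor_diff_tens[OF x] linear_map_add[OF dg_tensor_diff_linear]
          linear_map_ksign[OF T.module_axioms T.module_axioms dg_tensor_diff_linear] dg_tens_closed T.ksign_simps)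
    also have "diff T (tn (diff M x) y) = ksign T (p + 1) (tn (diff M x) (diff N y))"
      using xy linear_map_zero[OF M.module_axioms T.module_axioms dg_tens_left[OF xy(2)]]
      by (simp add: dg_tensor_diff_tens[OF diff_grade[OF dgM x]] diff_diff[OF dgM] dg_tens_closed T.ksign_simps)
    also have "diff T (tn x (diff N y)) = tn (diff M x) (diff N y)"
      using xy linear_map_zero[OF N.module_axioms T.module_axioms dg_tens_right[OF xy(1)]]
      by (simp add: dg_tensor_diff_tens[OF x] diff_diff[OF dgN] dg_tens_closed T.ksign_simps)
    also have "ksign T (p + 1) (tn (diff M x) (diff N y)) \<oplus>\<^bsub>T\<^esub> ksign T p (tn (diff M x) (diff N y)) = \<zero>\<^bsub>T\<^esub>"
      using dg_tens_closed[OF xy(3,4)] by (simp add: ksign_def T.l_neg T.r_neg)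
    finally show "diff T (diff T (tn x y)) = \<zero>\<^bsub>T\<^esub>" .
  qed
qed

end

text \<open>
  Composition in a tensor product of categories is a lift whose values are lifts, and the outer lift
  requires the inner ones to be linear in their parameters.
\<close>

lemma tensor_lift_parameter:
  assumes "dg_module K M" "dg_module K N" "module K A" "module K P"
    and "\<And>a. a \<in> carrier A \<Longrightarrow> bilinear_map K M N P (b a)"
    and "\<And>x y. x \<in> carrier M \<Longrightarrow> y \<in> carrier N \<Longrightarrow> linear_map K A P (\<lambda>a. b a x y)"
    and "z \<in> carrier (dg_tensor K M N)"
  shows "linear_map K A P (\<lambda>a. tensor_lift K P (b a) z)"
  using assms(7)
proof (induction rule: dg_tensor_induct[OF assms(1,2), consumes 1, case_names zero add tens])
  interpret A: module K A by fact
  note T = dg_tensor_module[OF assms(1,2)]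
  have lin: "linear_map K (dg_tensor K M N) P (tensor_lift K P (b a))" if "a \<in> carrier A" for a
    by (rule dg_tensor_lift_linear[OF assms(1,2,4) assms(5)[OF that]])
  {
    case zero
    show ?case
      by (subst linear_map_cong[OF linear_map_zero[OF T assms(4) lin] assms(3)], assumption)
        (rule linear_map_zero_fun[OF assms(4)])
  next
    case (add x y)
    show ?case
      by (subst linear_map_cong[OF linear_map_add[OF lin add(1,2)] assms(3)], assumption)
        (rule linear_map_plus_fun[OF assms(4) add(3,4)])
  next
    case (tens p q x y)
    then have "x \<in> carrier M" "y \<in> carrier N"
      by (auto intro: dg_module_grade_closed[OF assms(1)] dg_module_grade_closed[OF assms(2)])
    then show ?case
      by (subst linear_map_cong[OF _ assms(3)])
        (use dg_tensor_lift_tens[OF assms(1,2,4,5)] assms(6) in auto)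
  }
qed

section \<open>The tensor product of dg categories\<close>

context dg_category
begin

lemma Cmp_closed:
  "\<lbrakk>X \<in> Obj \<C>; Y \<in> Obj \<C>; Z \<in> Obj \<C>; g \<in> carrier (Hom \<C> Y Z); f \<in> carrier (Hom \<C> X Y)\<rbrakk> \<Longrightarrow>
    Cmp \<C> X Y Z g f \<in> carrier (Hom \<C> X Z)"
  using Cmp_bilinear by (meson bilinear_map_closed)

lemma Cmp_left_linear:
  "\<lbrakk>X \<in> Obj \<C>; Y \<in> Obj \<C>; Z \<in> Obj \<C>; f \<in> carrier (Hom \<C> X Y)\<rbrakk> \<Longrightarrow>
    linear_map K (Hom \<C> Y Z) (Hom \<C> X Z) (\<lambda>g. Cmp \<C> X Y Z g f)"
  by (rule bilinear_map_left[OF Cmp_bilinear])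

lemma Cmp_right_linear:
  "\<lbrakk>X \<in> Obj \<C>; Y \<in> Obj \<C>; Z \<in> Obj \<C>; g \<in> carrier (Hom \<C> Y Z)\<rbrakk> \<Longrightarrow>
    linear_map K (Hom \<C> X Y) (Hom \<C> X Z) (Cmp \<C> X Y Z g)"
  by (rule bilinear_map_right[OF Cmp_bilinear])

text \<open>
  For \<open>f\<close> of degree \<open>m\<close>, the component of degree \<open>m\<close> of \<open>id \<circ> f = f\<close> shows that the component \<open>id\<^sub>0\<close> of
  degree zero already acts as a left identity. Hence \<open>id = id\<^sub>0 \<circ> id = id\<^sub>0\<close>.
\<close>

lemma Idn_degree:
  assumes X: "X \<in> Obj \<C>"
  shows "Idn \<C> X \<in> grade (Hom \<C> X X) 0"
proof -
  let ?H = "Hom \<C> X X" and ?c = "Cmp \<C> X X X"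
  note dg = Hom_dg_module[OF X X]
  note gr = dg_module_graded[OF dg] and md = dg_module_module[OF dg]
  interpret H: module K ?H by (rule md)
  note id = Idn_closed[OF X]
  have cl: "hcomp ?H (Idn \<C> X) n \<in> carrier ?H" for n by (rule hcomp_closed[OF gr id])
  have "?c (hcomp ?H (Idn \<C> X) 0) f = f" if "f \<in> carrier ?H" for f
  proof (rule linear_map_graded_eq[OF gr md _ linear_map_id _ that])
    show "linear_map K ?H ?H (?c (hcomp ?H (Idn \<C> X) 0))" by (rule Cmp_right_linear[OF X X X cl])
    fix m f assume f: "f \<in> grade ?H m"
    have fc: "f \<in> carrier ?H" by (rule grade_closed[OF gr f])
    let ?L = "\<lambda>g. hcomp ?H (?c g f) m"
    have L: "linear_map K ?H ?H ?L"
      by (rule linear_map_comp[OF Cmp_left_linear[OF X X X fc] hcomp_linear[OF gr]])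
    have R: "linear_map K ?H ?H (\<lambda>g. ?c (hcomp ?H g 0) f)"
      by (rule linear_map_comp[OF hcomp_linear[OF gr] Cmp_left_linear[OF X X X fc]])
    have "?L (Idn \<C> X) = ?c (hcomp ?H (Idn \<C> X) 0) f"
    proof (rule linear_map_graded_eq[OF gr md L R _ id])
      fix n g assume g: "g \<in> grade ?H n"
      show "?L g = ?c (hcomp ?H g 0) f"
        using hcomp_homogeneous[OF gr Cmp_degree[OF X X X g f], of m] hcomp_homogeneous[OF gr g, of 0]
          linear_map_zero[OF md md Cmp_left_linear[OF X X X fc]] by auto
    qed
    then show "?c (hcomp ?H (Idn \<C> X) 0) f = f"
      using Cmp_Idn_left[OF X X fc] hcomp_homogeneous[OF gr f, of m] by simp
  qed
  from this[OF id] have "hcomp ?H (Idn \<C> X) 0 = Idn \<C> X"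
    using Cmp_Idn_right[OF X X cl] by simp
  then show ?thesis using hcomp_grade[OF gr id, of 0] by simp
qed

end

context
  fixes K :: "'k ring" and \<A> :: "('o, 'k, 'h) dgcat" and \<B> :: "('p, 'k, 'g) dgcat"
  assumes \<A>: "dg_category K \<A>" and \<B>: "dg_category K \<B>"
begin

interpretation A: dg_category K \<A> by (rule \<A>)
interpretation B: dg_category K \<B> by (rule \<B>)

private abbreviation (input) "HA X Y \<equiv> Hom \<A> (fst X) (fst Y)"
private abbreviation (input) "HB X Y \<equiv> Hom \<B> (snd X) (snd Y)"
private abbreviation (input) "cA X Y Z \<equiv> Cmp \<A> (fst X) (fst Y) (fst Z)"
private abbreviation (input) "cB X Y Z \<equiv> Cmp \<B> (snd X) (snd Y) (snd Z)"
private abbreviation (input) "TT X Y \<equiv> dg_tensor K (HA X Y) (HB X Y)"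
private abbreviation (input) "tt X Y \<equiv> tens K (HA X Y) (HB X Y)"

lemma dgcat_tensor_simps:
  "Obj (dgcat_tensor K \<A> \<B>) = Obj \<A> \<times> Obj \<B>"
  "Hom (dgcat_tensor K \<A> \<B>) X Y = TT X Y"
  "Idn (dgcat_tensor K \<A> \<B>) X = tt X X (Idn \<A> (fst X)) (Idn \<B> (snd X))"
  by (auto simp: dgcat_tensor_def split: prod.splits)

text \<open>
  The composition formula on four morphisms. It is linear in each of them, because the degrees that
  enter the sign are those of the components over which it sums.
\<close>

definition cmp_kernel where
  "cmp_kernel X Y Z \<alpha>1 \<beta>1 \<alpha>2 \<beta>2 =
     (\<Oplus>\<^bsub>TT X Z\<^esub>m\<in>hsupp (HA X Y) \<alpha>2. \<Oplus>\<^bsub>TT X Z\<^esub>n\<in>hsupp (HB Y Z) \<beta>1.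
        ksign (TT X Z) (m * n) (tt X Z
          (cA X Y Z \<alpha>1 (hcomp (HA X Y) \<alpha>2 m))
          (cB X Y Z (hcomp (HB Y Z) \<beta>1 n) \<beta>2)))"

lemma dgcat_tensor_Cmp:
  "Cmp (dgcat_tensor K \<A> \<B>) X Y Z z w =
    tensor_lift K (TT X Z) (\<lambda>\<alpha>1 \<beta>1. tensor_lift K (TT X Z) (cmp_kernel X Y Z \<alpha>1 \<beta>1) w) z"
  unfolding cmp_kernel_def by (auto simp: dgcat_tensor_def Let_def split: prod.splits)

context
  fixes X Y Z :: "'o \<times> 'p"
  assumes X: "X \<in> Obj \<A> \<times> Obj \<B>" and Y: "Y \<in> Obj \<A> \<times> Obj \<B>" and Z: "Z \<in> Obj \<A> \<times> Obj \<B>"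
begin

lemma obj_components:
  "fst X \<in> Obj \<A>" "snd X \<in> Obj \<B>" "fst Y \<in> Obj \<A>" "snd Y \<in> Obj \<B>" "fst Z \<in> Obj \<A>" "snd Z \<in> Obj \<B>"
  using X Y Z by auto

lemma components_dg_module:
  "dg_module K (HA X Y)" "dg_module K (HB X Y)"
  "dg_module K (HA Y Z)" "dg_module K (HB Y Z)"
  "dg_module K (HA X Z)" "dg_module K (HB X Z)"
  by (simp_all add: A.Hom_dg_module B.Hom_dg_module obj_components)

interpretation T: module K "TT X Z"
  by (rule dg_tensor_module[OF components_dg_module(5,6)])

private lemmas cmp_A_left = A.Cmp_left_linear[OF obj_components(1,3,5)]
private lemmas cmp_A_right = A.Cmp_right_linear[OF obj_components(1,3,5)]
private lemmas cmp_B_left = B.Cmp_left_linear[OF obj_components(2,4,6)]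
private lemmas cmp_B_right = B.Cmp_right_linear[OF obj_components(2,4,6)]
private lemmas cmp_A_closed = A.Cmp_closed[OF obj_components(1,3,5)]
private lemmas cmp_B_closed = B.Cmp_closed[OF obj_components(2,4,6)]
private lemmas comp_graded = components_dg_module[THEN dg_module_graded]
private lemmas comp_module = components_dg_module[THEN dg_module_module]
private lemmas tXZ_left = dg_tens_left[OF components_dg_module(5,6)]
private lemmas tXZ_right = dg_tens_right[OF components_dg_module(5,6)]

lemma cmp_kernel_linear:
  defines "A1 \<equiv> carrier (HA Y Z)" and "B1 \<equiv> carrier (HB Y Z)"
    and "A2 \<equiv> carrier (HA X Y)" and "B2 \<equiv> carrier (HB X Y)"
  shows "\<lbrakk>\<beta>1 \<in> B1; \<alpha>2 \<in> A2; \<beta>2 \<in> B2\<rbrakk> \<Longrightarrow>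
      linear_map K (HA Y Z) (TT X Z) (\<lambda>\<alpha>1. cmp_kernel X Y Z \<alpha>1 \<beta>1 \<alpha>2 \<beta>2)"
    and "\<lbrakk>\<alpha>1 \<in> A1; \<alpha>2 \<in> A2; \<beta>2 \<in> B2\<rbrakk> \<Longrightarrow>
      linear_map K (HB Y Z) (TT X Z) (\<lambda>\<beta>1. cmp_kernel X Y Z \<alpha>1 \<beta>1 \<alpha>2 \<beta>2)"
    and "\<lbrakk>\<alpha>1 \<in> A1; \<beta>1 \<in> B1; \<beta>2 \<in> B2\<rbrakk> \<Longrightarrow>
      linear_map K (HA X Y) (TT X Z) (\<lambda>\<alpha>2. cmp_kernel X Y Z \<alpha>1 \<beta>1 \<alpha>2 \<beta>2)"
    and "\<lbrakk>\<alpha>1 \<in> A1; \<beta>1 \<in> B1; \<alpha>2 \<in> A2\<rbrakk> \<Longrightarrow>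
      linear_map K (HB X Y) (TT X Z) (\<lambda>\<beta>2. cmp_kernel X Y Z \<alpha>1 \<beta>1 \<alpha>2 \<beta>2)"
proof -
  note hA = hcomp_closed[OF comp_graded(1)] and hB = hcomp_closed[OF comp_graded(4)]
  note fin = finite_hsupp[OF comp_graded(1)] finite_hsupp[OF comp_graded(4)]
  note defs = A1_def A2_def B1_def B2_def cmp_kernel_def
  note intros = linear_map_finsum_fun comp_module T.module_axioms linear_map_ksign_fun cmp_A_closed cmp_B_closed
  show "linear_map K (HA Y Z) (TT X Z) (\<lambda>\<alpha>1. cmp_kernel X Y Z \<alpha>1 \<beta>1 \<alpha>2 \<beta>2)"
    if "\<beta>1 \<in> B1" "\<alpha>2 \<in> A2" "\<beta>2 \<in> B2"
    using that unfolding defs by (intro intros fin linear_map_comp[OF cmp_A_left tXZ_left] hA hB)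
  show "linear_map K (HB X Y) (TT X Z) (\<lambda>\<beta>2. cmp_kernel X Y Z \<alpha>1 \<beta>1 \<alpha>2 \<beta>2)"
    if "\<alpha>1 \<in> A1" "\<beta>1 \<in> B1" "\<alpha>2 \<in> A2"
    using that unfolding defs by (intro intros fin linear_map_comp[OF cmp_B_right tXZ_right] hA hB)
  show "linear_map K (HB Y Z) (TT X Z) (\<lambda>\<beta>1. cmp_kernel X Y Z \<alpha>1 \<beta>1 \<alpha>2 \<beta>2)"
    if "\<alpha>1 \<in> A1" "\<alpha>2 \<in> A2" "\<beta>2 \<in> B2"
    using that unfolding defs
    by (intro linear_map_finsum_fun comp_module T.module_axioms fin graded_sum_linear[OF comp_graded(4)]
        linear_map_ksign_fun linear_map_comp[OF cmp_B_left tXZ_right] cmp_A_closed hA)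
  show "linear_map K (HA X Y) (TT X Z) (\<lambda>\<alpha>2. cmp_kernel X Y Z \<alpha>1 \<beta>1 \<alpha>2 \<beta>2)"
    if "\<alpha>1 \<in> A1" "\<beta>1 \<in> B1" "\<beta>2 \<in> B2"
    using that unfolding defs
    by (intro graded_sum_linear[OF comp_graded(1)] linear_map_finsum_fun comp_module T.module_axioms fin
        linear_map_ksign_fun linear_map_comp[OF cmp_A_right tXZ_left] cmp_B_closed hB)
qed

lemma cmp_kernel_homogeneous:
  assumes "\<alpha>1 \<in> carrier (HA Y Z)" "\<beta>1 \<in> grade (HB Y Z) n"
    and "\<alpha>2 \<in> grade (HA X Y) m" "\<beta>2 \<in> carrier (HB X Y)"
  shows "cmp_kernel X Y Z \<alpha>1 \<beta>1 \<alpha>2 \<beta>2 = ksign (TT X Z) (m * n) (tt X Z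
    (cA X Y Z \<alpha>1 \<alpha>2) (cB X Y Z \<beta>1 \<beta>2))"
proof -
  have cl: "\<alpha>2 \<in> carrier (HA X Y)" "\<beta>1 \<in> carrier (HB Y Z)"
    by (rule grade_closed[OF comp_graded(1) assms(3)], rule grade_closed[OF comp_graded(4) assms(2)])
  have "cmp_kernel X Y Z \<alpha>1 \<beta>1 \<alpha>2 \<beta>2 =
     (\<Oplus>\<^bsub>TT X Z\<^esub>n\<in>hsupp (HB Y Z) \<beta>1. ksign (TT X Z) (m * n) (tt X Z
          (cA X Y Z \<alpha>1 \<alpha>2)
          (cB X Y Z (hcomp (HB Y Z) \<beta>1 n) \<beta>2)))"
    unfolding cmp_kernel_def
    by (rule graded_sum_homogeneous[OF comp_graded(1) T.module_axioms _ assms(3)])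
      (intro linear_map_finsum_fun comp_module T.module_axioms finite_hsupp[OF comp_graded(4)]
        linear_map_ksign_fun linear_map_comp[OF cmp_A_right tXZ_left] cmp_B_closed
        hcomp_closed[OF comp_graded(4)] assms cl)
  also have "\<dots> = ksign (TT X Z) (m * n) (tt X Z
    (cA X Y Z \<alpha>1 \<alpha>2) (cB X Y Z \<beta>1 \<beta>2))"
    by (rule graded_sum_homogeneous[OF comp_graded(4) T.module_axioms _ assms(2)])
      (intro linear_map_ksign_fun T.module_axioms linear_map_comp[OF cmp_B_left tXZ_right] cmp_A_closed assms cl)
  finally show ?thesis .
qed

lemma cmp_kernel_bilinear:
  assumes "\<alpha>1 \<in> carrier (HA Y Z)" "\<beta>1 \<in> carrier (HB Y Z)"
  shows "bilinear_map K (HA X Y) (HB X Y) (TT X Z) (cmp_kernel X Y Z \<alpha>1 \<beta>1)"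
  by (intro bilinear_mapI cmp_kernel_linear assms)

lemma inner_lift_bilinear:
  assumes "w \<in> carrier (TT X Y)"
  shows "bilinear_map K (HA Y Z) (HB Y Z) (TT X Z)
    (\<lambda>\<alpha>1 \<beta>1. tensor_lift K (TT X Z) (cmp_kernel X Y Z \<alpha>1 \<beta>1) w)"
  by (intro bilinear_mapI)
    (rule tensor_lift_parameter[OF components_dg_module(1,2) comp_module(3) T.module_axioms _ _ assms]
      tensor_lift_parameter[OF components_dg_module(1,2) comp_module(4) T.module_axioms _ _ assms],
      (intro cmp_kernel_bilinear cmp_kernel_linear; assumption)+)+

lemma dgcat_tensor_Cmp_bilinear:
  "bilinear_map K (TT Y Z) (TT X Y) (TT X Z) (Cmp (dgcat_tensor K \<A> \<B>) X Y Z)"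
proof (rule bilinear_mapI)
  fix w assume w: "w \<in> carrier (TT X Y)"
  show "linear_map K (TT Y Z) (TT X Z) (\<lambda>z. Cmp (dgcat_tensor K \<A> \<B>) X Y Z z w)"
    unfolding dgcat_tensor_Cmp
    by (rule dg_tensor_lift_linear[OF components_dg_module(3,4) T.module_axioms inner_lift_bilinear[OF w]])
next
  fix z assume z: "z \<in> carrier (TT Y Z)"
  show "linear_map K (TT X Y) (TT X Z) (Cmp (dgcat_tensor K \<A> \<B>) X Y Z z)"
    unfolding dgcat_tensor_Cmp
    by (rule tensor_lift_parameter[OF components_dg_module(3,4)
          dg_tensor_module[OF components_dg_module(1,2)] T.module_axioms inner_lift_bilinear _ z])
      (auto intro!: dg_tensor_lift_linear[OF components_dg_module(1,2) T.module_axioms] cmp_kernel_bilinear)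
qed

lemma dgcat_tensor_Cmp_tens:
  assumes "\<alpha>1 \<in> carrier (HA Y Z)" "\<beta>1 \<in> grade (HB Y Z) n"
    and "\<alpha>2 \<in> grade (HA X Y) m" "\<beta>2 \<in> carrier (HB X Y)"
  shows "Cmp (dgcat_tensor K \<A> \<B>) X Y Z (tt Y Z \<alpha>1 \<beta>1) (tt X Y \<alpha>2 \<beta>2) =
    ksign (TT X Z) (m * n) (tt X Z
      (cA X Y Z \<alpha>1 \<alpha>2) (cB X Y Z \<beta>1 \<beta>2))"
proof -
  have cl: "\<alpha>2 \<in> carrier (HA X Y)" "\<beta>1 \<in> carrier (HB Y Z)"
    by (rule grade_closed[OF comp_graded(1) assms(3)], rule grade_closed[OF comp_graded(4) assms(2)])
  have w: "tt X Y \<alpha>2 \<beta>2 \<in> carrier (TT X Y)"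
    by (rule dg_tens_closed[OF components_dg_module(1,2) cl(1) assms(4)])
  show ?thesis
    unfolding dgcat_tensor_Cmp
    by (simp add: dg_tensor_lift_tens[OF components_dg_module(3,4) T.module_axioms inner_lift_bilinear[OF w] assms(1) cl(2)]
        dg_tensor_lift_tens[OF components_dg_module(1,2) T.module_axioms cmp_kernel_bilinear[OF assms(1) cl(2)] cl(1) assms(4)]
        cmp_kernel_homogeneous[OF assms])
qed

end


text \<open>
  The unit laws hold without a sign because identities have degree zero (\<open>Idn_degree\<close>). For
  associativity and the Leibniz rule both sides are linear in every argument, which leaves the
  comparison of Koszul signs on homogeneous pure tensors.
\<close>

theorem dg_category_dgcat_tensor: "dg_category K (dgcat_tensor K \<A> \<B>)"
proof (unfold_locales, unfold dgcat_tensor_simps)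
  let ?C = "Cmp (dgcat_tensor K \<A> \<B>)"
  have dgA: "dg_module K (HA X Y)" and dgB: "dg_module K (HB X Y)"
    if "X \<in> Obj \<A> \<times> Obj \<B>" "Y \<in> Obj \<A> \<times> Obj \<B>" for X Y
    using that by (auto simp: A.Hom_dg_module B.Hom_dg_module)
  show dgT: "dg_module K (TT X Y)" if "X \<in> Obj \<A> \<times> Obj \<B>" "Y \<in> Obj \<A> \<times> Obj \<B>" for X Y
    by (rule dg_tensor_dg_module[OF dgA[OF that] dgB[OF that]])
  note mdT = dg_module_module[OF dgT]
  note clA = dg_module_grade_closed[OF dgA] and clB = dg_module_grade_closed[OF dgB]
  show "tt X X (Idn \<A> (fst X)) (Idn \<B> (snd X)) \<in> carrier (TT X X)" if "X \<in> Obj \<A> \<times> Obj \<B>" for X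
    using that dg_tens_closed[OF dgA[OF that that] dgB[OF that that]] A.Idn_closed B.Idn_closed by auto
  show bil: "bilinear_map K (TT Y Z) (TT X Y) (TT X Z) (?C X Y Z)"
    if "X \<in> Obj \<A> \<times> Obj \<B>" "Y \<in> Obj \<A> \<times> Obj \<B>" "Z \<in> Obj \<A> \<times> Obj \<B>" for X Y Z
    by (rule dgcat_tensor_Cmp_bilinear[OF that])
  note left = bilinear_map_left[OF bil] and right = bilinear_map_right[OF bil]
  note tens = dgcat_tensor_Cmp_tens
  have tc: "tt X Y \<alpha> \<beta> \<in> carrier (TT X Y)"
    if "X \<in> Obj \<A> \<times> Obj \<B>" "Y \<in> Obj \<A> \<times> Obj \<B>"
      "\<alpha> \<in> carrier (HA X Y)" "\<beta> \<in> carrier (HB X Y)" for X Y \<alpha> \<beta>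
    by (rule dg_tens_closed[OF dgA[OF that(1,2)] dgB[OF that(1,2)] that(3,4)])
  show "?C X Y Y (tt Y Y (Idn \<A> (fst Y)) (Idn \<B> (snd Y))) f = f"
    if X: "X \<in> Obj \<A> \<times> Obj \<B>" and Y: "Y \<in> Obj \<A> \<times> Obj \<B>" and f: "f \<in> carrier (TT X Y)" for X Y f
  proof (rule dg_tensor_eqI[OF dgA[OF X Y] dgB[OF X Y] mdT[OF X Y] right[OF X Y Y] linear_map_id _ f])
    have id: "Idn \<A> (fst Y) \<in> carrier (HA Y Y)" "Idn \<B> (snd Y) \<in> grade (HB Y Y) 0"
      using Y by (auto intro: A.Idn_closed B.Idn_degree)
    show "tt Y Y (Idn \<A> (fst Y)) (Idn \<B> (snd Y)) \<in> carrier (TT Y Y)"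
      by (rule tc[OF Y Y id(1) clB[OF Y Y id(2)]])
    fix p q x y assume x: "x \<in> grade (HA X Y) p" and y: "y \<in> grade (HB X Y) q"
    note xy = clA[OF X Y x] clB[OF X Y y]
    show "?C X Y Y (tt Y Y (Idn \<A> (fst Y)) (Idn \<B> (snd Y))) (tt X Y x y) = tt X Y x y"
      using X Y xy by (subst tens[OF X Y Y id x xy(2)])
        (auto simp: ksign_def A.Cmp_Idn_left B.Cmp_Idn_left)
  qed
  show "?C X X Y f (tt X X (Idn \<A> (fst X)) (Idn \<B> (snd X))) = f"
    if X: "X \<in> Obj \<A> \<times> Obj \<B>" and Y: "Y \<in> Obj \<A> \<times> Obj \<B>" and f: "f \<in> carrier (TT X Y)" for X Y f
  proof (rule dg_tensor_eqI[OF dgA[OF X Y] dgB[OF X Y] mdT[OF X Y] left[OF X X Y] linear_map_id _ f])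
    have id: "Idn \<A> (fst X) \<in> grade (HA X X) 0" "Idn \<B> (snd X) \<in> carrier (HB X X)"
      using X by (auto intro: A.Idn_degree B.Idn_closed)
    show "tt X X (Idn \<A> (fst X)) (Idn \<B> (snd X)) \<in> carrier (TT X X)"
      by (rule tc[OF X X clA[OF X X id(1)] id(2)])
    fix p q x y assume x: "x \<in> grade (HA X Y) p" and y: "y \<in> grade (HB X Y) q"
    note xy = clA[OF X Y x] clB[OF X Y y]
    show "?C X X Y (tt X Y x y) (tt X X (Idn \<A> (fst X)) (Idn \<B> (snd X))) = tt X Y x y"
      using X Y xy by (subst tens[OF X X Y xy(1) y id])
        (auto simp: ksign_def A.Cmp_Idn_right B.Cmp_Idn_right)
  qed
  show "?C W Y Z h (?C W X Y g f) = ?C W X Z (?C X Y Z h g) f"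
    if W: "W \<in> Obj \<A> \<times> Obj \<B>" and X: "X \<in> Obj \<A> \<times> Obj \<B>" and Y: "Y \<in> Obj \<A> \<times> Obj \<B>"
      and Z: "Z \<in> Obj \<A> \<times> Obj \<B>" and f: "f \<in> carrier (TT W X)" and g: "g \<in> carrier (TT X Y)"
      and h: "h \<in> carrier (TT Y Z)" for W X Y Z f g h
  proof (rule dg_tensor_eqI[OF dgA[OF W X] dgB[OF W X] mdT[OF W Z]
        linear_map_comp[OF right[OF W X Y g] right[OF W Y Z h]]
        right[OF W X Z bilinear_map_closed[OF bil[OF X Y Z] h g]] _ f])
    fix p1 q1 x1 y1 assume x1: "x1 \<in> grade (HA W X) p1" and y1: "y1 \<in> grade (HB W X) q1"
    note c1 = clA[OF W X x1] clB[OF W X y1]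
    note t1 = tc[OF W X c1]
    show "?C W Y Z h (?C W X Y g (tt W X x1 y1)) = ?C W X Z (?C X Y Z h g) (tt W X x1 y1)"
    proof (rule dg_tensor_eqI[OF dgA[OF X Y] dgB[OF X Y] mdT[OF W Z]
          linear_map_comp[OF left[OF W X Y t1] right[OF W Y Z h]]
          linear_map_comp[OF right[OF X Y Z h] left[OF W X Z t1]] _ g])
      fix p2 q2 x2 y2 assume x2: "x2 \<in> grade (HA X Y) p2" and y2: "y2 \<in> grade (HB X Y) q2"
      note c2 = clA[OF X Y x2] clB[OF X Y y2]
      note t2 = tc[OF X Y c2]
      note t21 = bilinear_map_closed[OF bil[OF W X Y] t2 t1]
      show "?C W Y Z h (?C W X Y (tt X Y x2 y2) (tt W X x1 y1)) = ?C W X Z (?C X Y Z h (tt X Y x2 y2)) (tt W X x1 y1)"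
      proof (rule dg_tensor_eqI[OF dgA[OF Y Z] dgB[OF Y Z] mdT[OF W Z] left[OF W Y Z t21]
            linear_map_comp[OF left[OF X Y Z t2] left[OF W X Z t1]] _ h])
        fix p3 q3 x3 y3 assume x3: "x3 \<in> grade (HA Y Z) p3" and y3: "y3 \<in> grade (HB Y Z) q3"
        note c3 = clA[OF Y Z x3] clB[OF Y Z y3]
        note o = obj_components[OF W X Y] obj_components[OF X Y Z]
        let ?x21 = "cA W X Y x2 x1" and ?y21 = "cB W X Y y2 y1"
        let ?x32 = "cA X Y Z x3 x2" and ?y32 = "cB X Y Z y3 y2"
        let ?x = "cA W Y Z x3 ?x21" and ?y = "cB W Y Z y3 ?y21"
        have x21: "?x21 \<in> grade (HA W Y) (p2 + p1)" and y21: "?y21 \<in> carrier (HB W Y)"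
          and x32: "?x32 \<in> carrier (HA X Z)" and y32: "?y32 \<in> grade (HB X Z) (q3 + q2)"
          using o x1 x2 x3 y1 y2 y3 c1 c2 c3
          by (auto intro: A.Cmp_degree B.Cmp_degree A.Cmp_closed B.Cmp_closed)
        have xc: "tt W Z ?x ?y \<in> carrier (TT W Z)"
          using o c3 y21 clA[OF W Y x21] by (intro tc[OF W Z A.Cmp_closed B.Cmp_closed])
        have assoc: "cA W X Z ?x32 x1 = ?x" "cB W X Z ?y32 y1 = ?y"
          using o c1 c2 c3 by (simp_all add: A.Cmp_assoc B.Cmp_assoc)
        interpret WZ: module K "TT W Z" by (rule mdT[OF W Z])
        have "?C W Y Z (tt Y Z x3 y3) (?C W X Y (tt X Y x2 y2) (tt W X x1 y1)) =
            ksign (TT W Z) (p1 * q2 + (p2 + p1) * q3) (tt W Z ?x ?y)"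
          by (simp add: tens[OF W X Y c2(1) y2 x1 c1(2)] tens[OF W Y Z c3(1) y3 x21 y21] xc WZ.ksign_simps
              linear_map_ksign[OF mdT[OF W Y] mdT[OF W Z] right[OF W Y Z tc[OF Y Z c3]] tc[OF W Y clA[OF W Y x21] y21]])
        also have "\<dots> = ksign (TT W Z) (p2 * q3 + p1 * (q3 + q2)) (tt W Z ?x ?y)"
          by (rule ksign_cong) (simp add: algebra_simps)
        also have "\<dots> = ?C W X Z (?C X Y Z (tt Y Z x3 y3) (tt X Y x2 y2)) (tt W X x1 y1)"
          by (simp add: tens[OF X Y Z c3(1) y3 x2 c2(2)] tens[OF W X Z x32 y32 x1 c1(2)] xc WZ.ksign_simps assoc
              linear_map_ksign[OF mdT[OF X Z] mdT[OF W Z] left[OF W X Z t1] tc[OF X Z x32 clB[OF X Z y32]]])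
        finally show "?C W Y Z (tt Y Z x3 y3) (?C W X Y (tt X Y x2 y2) (tt W X x1 y1)) =
          ?C W X Z (?C X Y Z (tt Y Z x3 y3) (tt X Y x2 y2)) (tt W X x1 y1)" .
      qed
    qed
  qed
  fix X Y Z m g
  assume X: "X \<in> Obj \<A> \<times> Obj \<B>" and Y: "Y \<in> Obj \<A> \<times> Obj \<B>" and Z: "Z \<in> Obj \<A> \<times> Obj \<B>"
    and g: "g \<in> grade (TT Y Z) m"
  have gc: "g \<in> carrier (TT Y Z)" by (rule dg_module_grade_closed[OF dgT[OF Y Z] g])
  note o = obj_components[OF X Y Z]
  note sub = dg_tensor_grade_submodule[OF dgA[OF X Z] dgB[OF X Z]]
  interpret XZ: module K "TT X Z" by (rule mdT[OF X Z])
  show "?C X Y Z g f \<in> grade (TT X Z) (m + n)" if f: "f \<in> grade (TT X Y) n" for f n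
  proof (rule dg_tensor_grade_into[OF dgA[OF X Y] dgB[OF X Y] mdT[OF X Z] right[OF X Y Z gc] sub _ f])
    fix p2 q2 x2 y2 assume n: "p2 + q2 = n" and x2: "x2 \<in> grade (HA X Y) p2"
      and y2: "y2 \<in> grade (HB X Y) q2"
    note c2 = clA[OF X Y x2] clB[OF X Y y2]
    show "?C X Y Z g (tt X Y x2 y2) \<in> grade (TT X Z) (m + n)"
    proof (rule dg_tensor_grade_into[OF dgA[OF Y Z] dgB[OF Y Z] mdT[OF X Z] left[OF X Y Z tc[OF X Y c2]] sub _ g])
      fix p1 q1 x1 y1 assume m: "p1 + q1 = m" and x1: "x1 \<in> grade (HA Y Z) p1"
        and y1: "y1 \<in> grade (HB Y Z) q1"
      have "tt X Z (cA X Y Z x1 x2) (cB X Y Z y1 y2)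
          \<in> grade (TT X Z) ((p1 + p2) + (q1 + q2))"
        using o x1 x2 y1 y2 by (intro dg_tens_grade[OF dgA[OF X Z] dgB[OF X Z]] A.Cmp_degree B.Cmp_degree)
      moreover have "(p1 + p2) + (q1 + q2) = m + n" using m n by simp
      ultimately show "?C X Y Z (tt Y Z x1 y1) (tt X Y x2 y2) \<in> grade (TT X Z) (m + n)"
        by (simp add: tens[OF X Y Z clA[OF Y Z x1] y1 x2 c2(2)] submodule_ksign[OF sub])
    qed
  qed
  show "diff (TT X Z) (?C X Y Z g f) = ?C X Y Z (diff (TT Y Z) g) f \<oplus>\<^bsub>TT X Z\<^esub>
      ksign (TT X Z) m (?C X Y Z g (diff (TT X Y) f))" if f: "f \<in> carrier (TT X Y)" for f
  proof (rule dg_tensor_eqI[OF dgA[OF X Y] dgB[OF X Y] mdT[OF X Z]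
        linear_map_comp[OF right[OF X Y Z gc] diff_linear[OF dgT[OF X Z]]]
        linear_map_plus_fun[OF mdT[OF X Z] right[OF X Y Z diff_closed[OF dgT[OF Y Z] gc]]
          linear_map_ksign_fun[OF mdT[OF X Z] linear_map_comp[OF diff_linear[OF dgT[OF X Y]] right[OF X Y Z gc]]]] _ f])
    fix p2 q2 x2 y2 assume x2: "x2 \<in> grade (HA X Y) p2"
      and y2: "y2 \<in> grade (HB X Y) q2"
    note c2 = clA[OF X Y x2] clB[OF X Y y2]
    note t2 = tc[OF X Y c2] and dt2 = diff_closed[OF dgT[OF X Y] tc[OF X Y c2]]
    show "diff (TT X Z) (?C X Y Z g (tt X Y x2 y2)) = ?C X Y Z (diff (TT Y Z) g) (tt X Y x2 y2) \<oplus>\<^bsub>TT X Z\<^esub>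
      ksign (TT X Z) m (?C X Y Z g (diff (TT X Y) (tt X Y x2 y2)))"
    proof (rule dg_tensor_grade_eq[OF dgA[OF Y Z] dgB[OF Y Z] mdT[OF X Z]
          linear_map_comp[OF left[OF X Y Z t2] diff_linear[OF dgT[OF X Z]]]
          linear_map_plus_fun[OF mdT[OF X Z] linear_map_comp[OF diff_linear[OF dgT[OF Y Z]] left[OF X Y Z t2]]
            linear_map_ksign_fun[OF mdT[OF X Z] left[OF X Y Z dt2]]] _ g])
      fix p1 q1 x1 y1 assume m: "p1 + q1 = m" and x1: "x1 \<in> grade (HA Y Z) p1"
        and y1: "y1 \<in> grade (HB Y Z) q1"
      note c1 = clA[OF Y Z x1] clB[OF Y Z y1]
      let ?CA = "cA X Y Z" and ?CB = "cB X Y Z"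
      let ?dx1 = "diff (HA Y Z) x1" and ?dy1 = "diff (HB Y Z) y1"
      let ?dx2 = "diff (HA X Y) x2" and ?dy2 = "diff (HB X Y) y2"
      note dx1 = diff_grade[OF dgA[OF Y Z] x1] and dy1 = diff_grade[OF dgB[OF Y Z] y1]
      note dx2 = diff_grade[OF dgA[OF X Y] x2] and dy2 = diff_grade[OF dgB[OF X Y] y2]
      note dc = clA[OF Y Z dx1] clB[OF Y Z dy1] clA[OF X Y dx2] clB[OF X Y dy2]
      note AC = A.Cmp_closed[OF o(1,3,5)] and BC = B.Cmp_closed[OF o(2,4,6)]
      let ?k = "ksign (TT X Z)" and ?t = "tt X Z"
      (* In each of the four terms of the Leibniz rule one of the four factors is differentiated. *)
      let ?t1 = "?t (?CA ?dx1 x2) (?CB y1 y2)" and ?t2 = "?t (?CA x1 ?dx2) (?CB y1 y2)"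
      let ?t3 = "?t (?CA x1 x2) (?CB ?dy1 y2)" and ?t4 = "?t (?CA x1 x2) (?CB y1 ?dy2)"
      have t: "?t1 \<in> carrier (TT X Z)" "?t2 \<in> carrier (TT X Z)" "?t3 \<in> carrier (TT X Z)" "?t4 \<in> carrier (TT X Z)"
        "?t (?CA x1 x2) (?CB y1 y2) \<in> carrier (TT X Z)"
        by (intro tc[OF X Z] AC BC c1 c2 dc)+
      note cA = A.Cmp_degree[OF o(1,3,5) x1 x2] and cB = BC[OF c1(2) c2(2)]
      note lsA = linear_map_ksign[OF dg_module_module[OF dgA[OF X Z]] mdT[OF X Z] dg_tens_left[OF dgA[OF X Z] dgB[OF X Z]]]
      note lsB = linear_map_ksign[OF dg_module_module[OF dgB[OF X Z]] mdT[OF X Z] dg_tens_right[OF dgA[OF X Z] dgB[OF X Z]]]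
      note laA = linear_map_add[OF dg_tens_left[OF dgA[OF X Z] dgB[OF X Z]]]
      note laB = linear_map_add[OF dg_tens_right[OF dgA[OF X Z] dgB[OF X Z]]]
      interpret HA: module K "HA X Z" by (rule dg_module_module[OF dgA[OF X Z]])
      interpret HB: module K "HB X Z" by (rule dg_module_module[OF dgB[OF X Z]])
      have dA: "diff (HA X Z) (?CA x1 x2) = ?CA ?dx1 x2 \<oplus>\<^bsub>HA X Z\<^esub>
          ksign (HA X Z) p1 (?CA x1 ?dx2)"
        by (rule A.Cmp_diff[OF o(1,3,5) x1 c2(1)])
      have dB: "diff (HB X Z) (?CB y1 y2) = ?CB ?dy1 y2 \<oplus>\<^bsub>HB X Z\<^esub>
          ksign (HB X Z) q1 (?CB y1 ?dy2)"
        by (rule B.Cmp_diff[OF o(2,4,6) y1 c2(2)])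
      have L: "diff (TT X Z) (?C X Y Z (tt Y Z x1 y1) (tt X Y x2 y2)) =
        (?k (p2 * q1) ?t1 \<oplus>\<^bsub>TT X Z\<^esub> ?k (p2 * q1 + p1) ?t2) \<oplus>\<^bsub>TT X Z\<^esub>
        (?k (p2 * q1 + (p1 + p2)) ?t3 \<oplus>\<^bsub>TT X Z\<^esub> ?k (p2 * q1 + (p1 + p2 + q1)) ?t4)"
        by (simp add: tens[OF X Y Z c1(1) y1 x2 c2(2)]
            linear_map_ksign[OF mdT[OF X Z] mdT[OF X Z] diff_linear[OF dgT[OF X Z]]] t
            dg_tensor_diff_tens[OF dgA[OF X Z] dgB[OF X Z] cA cB] dA dB laA laB lsA lsB
            AC BC c1 c2 dc HA.ksign_simps HB.ksign_simps XZ.ksign_simps)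
      have R1: "?C X Y Z (diff (TT Y Z) (tt Y Z x1 y1)) (tt X Y x2 y2) =
          ?k (p2 * q1) ?t1 \<oplus>\<^bsub>TT X Z\<^esub> ?k (p1 + p2 * (q1 + 1)) ?t3"
      proof -
        interpret YZ: module K "TT Y Z" by (rule mdT[OF Y Z])
        show ?thesis
          by (simp add: dg_tensor_diff_tens[OF dgA[OF Y Z] dgB[OF Y Z] x1 c1(2)] linear_map_add[OF left[OF X Y Z t2]]
            linear_map_ksign[OF mdT[OF Y Z] mdT[OF X Z] left[OF X Y Z t2]] tc[OF Y Z] c1 c2 dc YZ.ksign_simps
            tens[OF X Y Z dc(1) y1 x2 c2(2)] tens[OF X Y Z c1(1) dy1 x2 c2(2)] t XZ.ksign_simps)
      qed
      have R2: "?C X Y Z (tt Y Z x1 y1) (diff (TT X Y) (tt X Y x2 y2)) =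
          ?k ((p2 + 1) * q1) ?t2 \<oplus>\<^bsub>TT X Z\<^esub> ?k (p2 + p2 * q1) ?t4"
      proof -
        interpret XY: module K "TT X Y" by (rule mdT[OF X Y])
        show ?thesis
          by (simp add: dg_tensor_diff_tens[OF dgA[OF X Y] dgB[OF X Y] x2 c2(2)] linear_map_add[OF right[OF X Y Z tc[OF Y Z c1]]]
            linear_map_ksign[OF mdT[OF X Y] mdT[OF X Z] right[OF X Y Z tc[OF Y Z c1]]] tc[OF X Y] c1 c2 dc XY.ksign_simps
            tens[OF X Y Z c1(1) y1 dx2 c2(2)] tens[OF X Y Z c1(1) y1 x2 dc(4)] t XZ.ksign_simps)
      qed
      have s: "?k (p2 * q1 + p1) ?t2 = ?k (m + (p2 + 1) * q1) ?t2"
        "?k (p2 * q1 + (p1 + p2)) ?t3 = ?k (p1 + p2 * (q1 + 1)) ?t3"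
        "?k (p2 * q1 + (p1 + p2 + q1)) ?t4 = ?k (m + (p2 + p2 * q1)) ?t4"
        using m by (auto intro!: ksign_cong simp: algebra_simps)
      show "diff (TT X Z) (?C X Y Z (tt Y Z x1 y1) (tt X Y x2 y2)) =
          ?C X Y Z (diff (TT Y Z) (tt Y Z x1 y1)) (tt X Y x2 y2) \<oplus>\<^bsub>TT X Z\<^esub>
          ksign (TT X Z) m (?C X Y Z (tt Y Z x1 y1) (diff (TT X Y) (tt X Y x2 y2)))"
        unfolding L R1 R2 s using t
        by (simp add: XZ.ksign_simps XZ.M.a_ac)
    qed
  qed
qed

end

section \<open>Bimodules over dg algebras with enough idempotents\<close>

subsection \<open>Local units\<close>

text \<open>
  For \<open>E j\<close> the multiplication by the idempotent \<open>e j\<close>, this says that all sufficiently large finite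
  sums of the idempotents act on \<open>x\<close> as a unit. Being stable under enlarging the sum, a common
  local unit exists for any two such elements.
\<close>

definition locally_unital :: "('k, 'm, 'r) module_scheme \<Rightarrow> 'i set \<Rightarrow> ('i \<Rightarrow> 'm \<Rightarrow> 'm) \<Rightarrow> 'm \<Rightarrow> bool" where
  "locally_unital M I E x \<longleftrightarrow> (\<exists>J\<^sub>0. finite J\<^sub>0 \<and> J\<^sub>0 \<subseteq> I \<and>
     (\<forall>J. finite J \<and> J\<^sub>0 \<subseteq> J \<and> J \<subseteq> I \<longrightarrow> (\<Oplus>\<^bsub>M\<^esub>j\<in>J. E j x) = x))"

lemma locally_unitalE:
  assumes "locally_unital M I E x"
  obtains J\<^sub>0 where "finite J\<^sub>0" "J\<^sub>0 \<subseteq> I"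
    "\<forall>J. finite J \<and> J\<^sub>0 \<subseteq> J \<and> J \<subseteq> I \<longrightarrow> (\<Oplus>\<^bsub>M\<^esub>j\<in>J. E j x) = x"
  using assms unfolding locally_unital_def by blast

lemma locally_unitalI:
  assumes "finite J\<^sub>0" "J\<^sub>0 \<subseteq> I"
    and "\<And>J. finite J \<Longrightarrow> J\<^sub>0 \<subseteq> J \<Longrightarrow> J \<subseteq> I \<Longrightarrow> (\<Oplus>\<^bsub>M\<^esub>j\<in>J. E j x) = x"
  shows "locally_unital M I E x"
  using assms unfolding locally_unital_def by blast

lemma locally_unital_common:
  assumes "locally_unital M I E x" "locally_unital M I E y"
  shows "\<exists>J. finite J \<and> J \<subseteq> I \<and> (\<Oplus>\<^bsub>M\<^esub>j\<in>J. E j x) = x \<and> (\<Oplus>\<^bsub>M\<^esub>j\<in>J. E j y) = y"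
proof -
  obtain J1 where J1: "finite J1" "J1 \<subseteq> I" "\<forall>J. finite J \<and> J1 \<subseteq> J \<and> J \<subseteq> I \<longrightarrow> (\<Oplus>\<^bsub>M\<^esub>j\<in>J. E j x) = x"
    using assms(1) by (rule locally_unitalE)
  obtain J2 where J2: "finite J2" "J2 \<subseteq> I" "\<forall>J. finite J \<and> J2 \<subseteq> J \<and> J \<subseteq> I \<longrightarrow> (\<Oplus>\<^bsub>M\<^esub>j\<in>J. E j y) = y"
    using assms(2) by (rule locally_unitalE)
  show ?thesis
    using J1(1,2) J2(1,2) J1(3)[rule_format, of "J1 \<union> J2"] J2(3)[rule_format, of "J1 \<union> J2"] by (intro exI[of _ "J1 \<union> J2"]) auto
qed

lemma locally_unital_submodule:
  assumes "module K M" "\<And>j. j \<in> I \<Longrightarrow> linear_map K M M (E j)"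
  shows "submodule {x \<in> carrier M. locally_unital M I E x} K M"
proof (rule submodule_if[OF assms(1)])
  interpret M: module K M by fact
  have lin: "linear_map K M M (\<lambda>x. \<Oplus>\<^bsub>M\<^esub>j\<in>J. E j x)" if "finite J" "J \<subseteq> I" for J
    using that assms(2) by (intro linear_map_finsum_fun M.module_axioms) auto
  show "\<zero>\<^bsub>M\<^esub> \<in> {x \<in> carrier M. locally_unital M I E x}"
    using linear_map_zero[OF assms(1,1) lin] by (auto intro!: locally_unitalI[of "{}"])
  show "k \<odot>\<^bsub>M\<^esub> x \<in> {x \<in> carrier M. locally_unital M I E x}"
    if k: "k \<in> carrier K" and x: "x \<in> {x \<in> carrier M. locally_unital M I E x}" for k x
  proof -
    have xc: "x \<in> carrier M" using x by simp
    have "locally_unital M I E x" using x by simp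
    then obtain J1 where J1: "finite J1" "J1 \<subseteq> I" "\<forall>J. finite J \<and> J1 \<subseteq> J \<and> J \<subseteq> I \<longrightarrow> (\<Oplus>\<^bsub>M\<^esub>j\<in>J. E j x) = x"
      by (rule locally_unitalE)
    have "(\<Oplus>\<^bsub>M\<^esub>j\<in>J. E j (k \<odot>\<^bsub>M\<^esub> x)) = k \<odot>\<^bsub>M\<^esub> x" if "finite J" "J1 \<subseteq> J" "J \<subseteq> I" for J
      using linear_map_smult[OF lin[OF that(1,3)] k xc] J1(3)[rule_format, of J] that by simp
    then have "locally_unital M I E (k \<odot>\<^bsub>M\<^esub> x)"
      using J1(1,2) by (intro locally_unitalI[of J1])
    then show ?thesis using xc k by simp
  qed
  show "x \<oplus>\<^bsub>M\<^esub> y \<in> {x \<in> carrier M. locally_unital M I E x}"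
    if "x \<in> {x \<in> carrier M. locally_unital M I E x}" "y \<in> {x \<in> carrier M. locally_unital M I E x}" for x y
  proof -
    have x: "x \<in> carrier M" "locally_unital M I E x" and y: "y \<in> carrier M" "locally_unital M I E y"
      using that by simp_all
    obtain J1 where J1: "finite J1" "J1 \<subseteq> I" "\<forall>J. finite J \<and> J1 \<subseteq> J \<and> J \<subseteq> I \<longrightarrow> (\<Oplus>\<^bsub>M\<^esub>j\<in>J. E j x) = x"
      using x(2) by (rule locally_unitalE)
    obtain J2 where J2: "finite J2" "J2 \<subseteq> I" "\<forall>J. finite J \<and> J2 \<subseteq> J \<and> J \<subseteq> I \<longrightarrow> (\<Oplus>\<^bsub>M\<^esub>j\<in>J. E j y) = y"
      using y(2) by (rule locally_unitalE)
    have "(\<Oplus>\<^bsub>M\<^esub>j\<in>J. E j (x \<oplus>\<^bsub>M\<^esub> y)) = x \<oplus>\<^bsub>M\<^esub> y" if "finite J" "J1 \<union> J2 \<subseteq> J" "J \<subseteq> I" for J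
      using linear_map_add[OF lin[OF that(1,3)] x(1) y(1)] J1(3)[rule_format, of J] J2(3)[rule_format, of J] that by simp
    then have "locally_unital M I E (x \<oplus>\<^bsub>M\<^esub> y)"
      using J1(1,2) J2(1,2) by (intro locally_unitalI[of "J1 \<union> J2"]) auto
    then show ?thesis using x y by simp
  qed
qed auto

context dg_algebra_idem
begin

lemma algebra_module: "module K A"
  by (rule dg_module_module[OF dg_module])

interpretation A: module K A by (rule algebra_module)

lemmas algebra_graded = dg_module_graded[OF dg_module]
lemmas algebra_grade_closed = grade_closed[OF algebra_graded]

lemma idem_closed: "i \<in> I \<Longrightarrow> e i \<in> carrier A"
  using idem_degree algebra_grade_closed by blast

lemma mult_closed: "a \<in> carrier A \<Longrightarrow> b \<in> carrier A \<Longrightarrow> a \<otimes>\<^bsub>A\<^esub> b \<in> carrier A"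
  by (rule bilinear_map_closed[OF mult_bilinear])

lemma idem_mult_idem: "i \<in> I \<Longrightarrow> j \<in> I \<Longrightarrow> e j \<otimes>\<^bsub>A\<^esub> e i = (if j = i then e i else \<zero>\<^bsub>A\<^esub>)"
  using idem_idem idem_orthogonal by auto

text \<open>
  A sum of idempotents that includes \<open>e i\<close> fixes the summand of index \<open>i\<close>, and every element involves
  finitely many summands.
\<close>

lemma internal_direct_sum_locally_unital:
  assumes "internal_direct_sum K A I S" "\<And>j. j \<in> I \<Longrightarrow> linear_map K A A (E j)"
    and "\<And>i j s. i \<in> I \<Longrightarrow> j \<in> I \<Longrightarrow> s \<in> S i \<Longrightarrow> E j s = (if j = i then s else \<zero>\<^bsub>A\<^esub>)"
    and "x \<in> carrier A"
  shows "locally_unital A I E x"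
proof -
  let ?H = "{x \<in> carrier A. locally_unital A I E x}"
  have sub: "submodule ?H K A" by (rule locally_unital_submodule[OF algebra_module assms(2)])
  have S: "s \<in> ?H" if i: "i \<in> I" and s: "s \<in> S i" for i s
  proof -
    have sc: "s \<in> carrier A"
      by (rule submodule_subset[OF _ s, of K]) (use assms(1) i in \<open>simp add: internal_direct_sum_def\<close>)
    have "(\<Oplus>\<^bsub>A\<^esub>j\<in>J. E j s) = s" if J: "finite J" "i \<in> J" "J \<subseteq> I" for J
    proof -
      have "(\<Oplus>\<^bsub>A\<^esub>j\<in>J. E j s) = (\<Oplus>\<^bsub>A\<^esub>j\<in>J. if i = j then s else \<zero>\<^bsub>A\<^esub>)"
        using J sc by (intro A.finsum_cong' refl) (auto simp: assms(3)[OF i _ s] subset_iff)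
      also have "\<dots> = s" using J sc A.finsum_singleton[of i J "\<lambda>_. s"] by auto
      finally show ?thesis .
    qed
    then have "locally_unital A I E s" using i by (intro locally_unitalI[of "{i}"]) auto
    then show ?thesis using sc by simp
  qed
  have "\<exists>!c. decomposes A I S x c"
    using assms(1,4) by (simp add: internal_direct_sum_def)
  then obtain c where c: "decomposes A I S x c" by blast
  have "c i \<in> S i" "i \<in> I" if "c i \<noteq> \<zero>\<^bsub>A\<^esub>" for i
    using c that by (auto simp: decomposes_def)
  then have "(\<Oplus>\<^bsub>A\<^esub>i\<in>{i. c i \<noteq> \<zero>\<^bsub>A\<^esub>}. c i) \<in> ?H"
    using c by (intro submodule_finsum[OF algebra_module sub] S) (auto simp: decomposes_def)
  then show ?thesis using c by (simp add: decomposes_def)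
qed

lemma locally_unital_left:
  assumes "a \<in> carrier A" shows "locally_unital A I (\<lambda>i a. e i \<otimes>\<^bsub>A\<^esub> a) a"
proof (rule internal_direct_sum_locally_unital[OF idem_right_sum _ _ assms])
  fix i j s assume i: "i \<in> I" and j: "j \<in> I" and "s \<in> (\<lambda>a. e i \<otimes>\<^bsub>A\<^esub> a) ` carrier A"
  then obtain a where a: "a \<in> carrier A" "s = e i \<otimes>\<^bsub>A\<^esub> a" by auto
  have "e j \<otimes>\<^bsub>A\<^esub> s = (e j \<otimes>\<^bsub>A\<^esub> e i) \<otimes>\<^bsub>A\<^esub> a" using a i j by (simp add: mult_assoc idem_closed)
  then show "e j \<otimes>\<^bsub>A\<^esub> s = (if j = i then s else \<zero>\<^bsub>A\<^esub>)"
    using a i j linear_map_zero[OF algebra_module algebra_module bilinear_map_left[OF mult_bilinear a(1)]]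
    by (simp add: idem_mult_idem)
qed (intro bilinear_map_right[OF mult_bilinear] idem_closed)

lemma locally_unital_right:
  assumes "a \<in> carrier A" shows "locally_unital A I (\<lambda>i a. a \<otimes>\<^bsub>A\<^esub> e i) a"
proof (rule internal_direct_sum_locally_unital[OF idem_left_sum _ _ assms])
  fix i j s assume i: "i \<in> I" and j: "j \<in> I" and "s \<in> (\<lambda>a. a \<otimes>\<^bsub>A\<^esub> e i) ` carrier A"
  then obtain a where a: "a \<in> carrier A" "s = a \<otimes>\<^bsub>A\<^esub> e i" by auto
  have "s \<otimes>\<^bsub>A\<^esub> e j = a \<otimes>\<^bsub>A\<^esub> (e i \<otimes>\<^bsub>A\<^esub> e j)" using a i j by (simp add: mult_assoc idem_closed)
  then show "s \<otimes>\<^bsub>A\<^esub> e j = (if j = i then s else \<zero>\<^bsub>A\<^esub>)"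
    using a i j linear_map_zero[OF algebra_module algebra_module bilinear_map_right[OF mult_bilinear a(1)]]
    by (auto simp: idem_mult_idem)
qed (intro bilinear_map_left[OF mult_bilinear] idem_closed)

text \<open>
  Local units are homogeneous of degree zero, cycles, and idempotent. The idempotency is what
  transports a local unit of \<open>x\<close> to the image of \<open>x\<close> under a bimodule map.
\<close>

lemma idem_sum:
  assumes "finite J" "J \<subseteq> I"
  shows "(\<Oplus>\<^bsub>A\<^esub>j\<in>J. e j) \<in> grade A 0" "diff A (\<Oplus>\<^bsub>A\<^esub>j\<in>J. e j) = \<zero>\<^bsub>A\<^esub>"
    and "(\<Oplus>\<^bsub>A\<^esub>j\<in>J. e j) \<otimes>\<^bsub>A\<^esub> (\<Oplus>\<^bsub>A\<^esub>j\<in>J. e j) = (\<Oplus>\<^bsub>A\<^esub>j\<in>J. e j)"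
proof -
  let ?u = "\<Oplus>\<^bsub>A\<^esub>j\<in>J. e j"
  have ec: "j \<in> J \<Longrightarrow> e j \<in> carrier A" for j using assms(2) idem_closed by blast
  have uc: "?u \<in> carrier A" using ec by (intro A.finsum_closed) auto
  have eu: "e j \<otimes>\<^bsub>A\<^esub> ?u = e j" if j: "j \<in> J" for j
  proof -
    have "e j \<otimes>\<^bsub>A\<^esub> ?u = (\<Oplus>\<^bsub>A\<^esub>i\<in>J. e j \<otimes>\<^bsub>A\<^esub> e i)"
      by (rule linear_map_finsum[OF algebra_module algebra_module bilinear_map_right[OF mult_bilinear ec[OF j]] assms(1) ec])
    also have "\<dots> = (\<Oplus>\<^bsub>A\<^esub>i\<in>J. if j = i then e i else \<zero>\<^bsub>A\<^esub>)"
      using j assms(2) ec by (intro A.finsum_cong' refl) (auto simp: idem_mult_idem subset_iff)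
    also have "\<dots> = e j" using j ec by (intro A.finsum_singleton assms(1)) auto
    finally show ?thesis .
  qed
  have "?u \<otimes>\<^bsub>A\<^esub> ?u = (\<Oplus>\<^bsub>A\<^esub>j\<in>J. e j \<otimes>\<^bsub>A\<^esub> ?u)"
    by (rule linear_map_finsum[OF algebra_module algebra_module bilinear_map_left[OF mult_bilinear uc] assms(1) ec])
  also have "\<dots> = ?u" using eu ec by (intro A.finsum_cong' refl) auto
  finally show "?u \<otimes>\<^bsub>A\<^esub> ?u = ?u" .
  show "(\<Oplus>\<^bsub>A\<^esub>j\<in>J. e j) \<in> grade A 0"
    using assms idem_degree by (intro submodule_finsum[OF algebra_module grade_submodule[OF algebra_graded]]) auto
  have "diff A (\<Oplus>\<^bsub>A\<^esub>j\<in>J. e j) = (\<Oplus>\<^bsub>A\<^esub>j\<in>J. diff A (e j))"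
    using assms idem_closed by (intro linear_map_finsum[OF algebra_module algebra_module diff_linear[OF dg_module]]) auto
  also have "\<dots> = (\<Oplus>\<^bsub>A\<^esub>j\<in>J. \<zero>\<^bsub>A\<^esub>)"
    using assms idem_diff by (intro A.finsum_cong') auto
  finally show "diff A (\<Oplus>\<^bsub>A\<^esub>j\<in>J. e j) = \<zero>\<^bsub>A\<^esub>" by simp
qed

end

context dg_bimodule
begin

lemmas bimod_module = dg_module_module[OF dg_module]
lemmas bimod_graded = dg_module_graded[OF dg_module]
lemmas bimod_grade_closed = grade_closed[OF bimod_graded]

lemma lact_closed: "b \<in> carrier B \<Longrightarrow> x \<in> carrier X \<Longrightarrow> lact X b x \<in> carrier X"
  by (rule bilinear_map_closed[OF lact_bilinear])

lemma ract_closed: "x \<in> carrier X \<Longrightarrow> a \<in> carrier A \<Longrightarrow> ract X x a \<in> carrier X"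
  by (rule bilinear_map_closed[OF ract_bilinear])

lemmas lact_right = bilinear_map_right[OF lact_bilinear]
lemmas lact_left = bilinear_map_left[OF lact_bilinear]
lemmas ract_right = bilinear_map_right[OF ract_bilinear]
lemmas ract_left = bilinear_map_left[OF ract_bilinear]

text \<open>
  A sum of idempotents that fixes \<open>b\<close> fixes \<open>b x\<close>, and the elements \<open>b x\<close> span \<open>X\<close> since the action
  is unitary.
\<close>

lemma left_local_unit:
  assumes B: "dg_algebra_idem K B I e" and x: "x \<in> carrier X" and y: "y \<in> carrier X"
  shows "\<exists>u. u \<in> grade B 0 \<and> diff B u = \<zero>\<^bsub>B\<^esub> \<and> u \<otimes>\<^bsub>B\<^esub> u = u \<and> lact X u x = x \<and> lact X u y = y"
proof -
  interpret B: dg_algebra_idem K B I e by (rule B)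
  let ?H = "{x \<in> carrier X. locally_unital X I (\<lambda>i. lact X (e i)) x}"
  have "submodule ?H K X"
    by (intro locally_unital_submodule bimod_module lact_right B.idem_closed)
  moreover have "{lact X b x |b x. b \<in> carrier B \<and> x \<in> carrier X} \<subseteq> ?H"
  proof safe
    fix b x assume b: "b \<in> carrier B" and x: "x \<in> carrier X"
    then show "lact X b x \<in> carrier X" by (rule lact_closed)
    obtain J\<^sub>0 where J\<^sub>0: "finite J\<^sub>0" "J\<^sub>0 \<subseteq> I"
      "\<forall>J. finite J \<and> J\<^sub>0 \<subseteq> J \<and> J \<subseteq> I \<longrightarrow> (\<Oplus>\<^bsub>B\<^esub>j\<in>J. e j \<otimes>\<^bsub>B\<^esub> b) = b"
      using B.locally_unital_left[OF b] by (rule locally_unitalE)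
    have "(\<Oplus>\<^bsub>X\<^esub>j\<in>J. lact X (e j) (lact X b x)) = lact X b x" if J: "finite J" "J\<^sub>0 \<subseteq> J" "J \<subseteq> I" for J
    proof -
      interpret X: module K X by (rule bimod_module)
      have "(\<Oplus>\<^bsub>X\<^esub>j\<in>J. lact X (e j) (lact X b x)) = (\<Oplus>\<^bsub>X\<^esub>j\<in>J. lact X (e j \<otimes>\<^bsub>B\<^esub> b) x)"
        using J b x B.idem_closed
        by (intro X.finsum_cong' refl) (auto simp: lact_assoc intro!: lact_closed B.mult_closed)
      also have "\<dots> = lact X (\<Oplus>\<^bsub>B\<^esub>j\<in>J. e j \<otimes>\<^bsub>B\<^esub> b) x"
        using J b B.idem_closed B.mult_closed
        by (intro linear_map_finsum[OF B.algebra_module bimod_module lact_left[OF x], symmetric]) auto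
      finally show ?thesis using J\<^sub>0(3)[rule_format, of J] J by simp
    qed
    then show "locally_unital X I (\<lambda>i. lact X (e i)) (lact X b x)"
      using J\<^sub>0(1,2) by (intro locally_unitalI[of J\<^sub>0])
  qed
  ultimately have "span_mod K X {lact X b x |b x. b \<in> carrier B \<and> x \<in> carrier X} \<subseteq> ?H" by (rule span_mod_least)
  then have H: "carrier X \<subseteq> ?H" by (simp only: lact_unitary)
  have "locally_unital X I (\<lambda>i. lact X (e i)) x" "locally_unital X I (\<lambda>i. lact X (e i)) y"
    using subsetD[OF H x] subsetD[OF H y] by simp_all
  from locally_unital_common[OF this] obtain J where J: "finite J" "J \<subseteq> I"
    "(\<Oplus>\<^bsub>X\<^esub>j\<in>J. lact X (e j) x) = x" "(\<Oplus>\<^bsub>X\<^esub>j\<in>J. lact X (e j) y) = y"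
    by (elim exE conjE)
  have "lact X (\<Oplus>\<^bsub>B\<^esub>j\<in>J. e j) z = (\<Oplus>\<^bsub>X\<^esub>j\<in>J. lact X (e j) z)" if "z \<in> carrier X" for z
    using J(1,2) B.idem_closed by (intro linear_map_finsum[OF B.algebra_module bimod_module lact_left[OF that]]) auto
  then show ?thesis
    using B.idem_sum[OF J(1,2)] J(3,4) x y by (intro exI[of _ "\<Oplus>\<^bsub>B\<^esub>j\<in>J. e j"]) simp
qed

lemma right_local_unit:
  assumes A: "dg_algebra_idem K A I e" and x: "x \<in> carrier X" and y: "y \<in> carrier X"
  shows "\<exists>u. u \<in> grade A 0 \<and> diff A u = \<zero>\<^bsub>A\<^esub> \<and> u \<otimes>\<^bsub>A\<^esub> u = u \<and> ract X x u = x \<and> ract X y u = y"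
proof -
  interpret A: dg_algebra_idem K A I e by (rule A)
  let ?E = "\<lambda>i x. ract X x (e i)"
  let ?H = "{x \<in> carrier X. locally_unital X I ?E x}"
  have "submodule ?H K X"
    by (intro locally_unital_submodule bimod_module ract_left A.idem_closed)
  moreover have "{ract X x a |x a. x \<in> carrier X \<and> a \<in> carrier A} \<subseteq> ?H"
  proof safe
    fix a x assume a: "a \<in> carrier A" and x: "x \<in> carrier X"
    then show "ract X x a \<in> carrier X" by (intro ract_closed)
    obtain J\<^sub>0 where J\<^sub>0: "finite J\<^sub>0" "J\<^sub>0 \<subseteq> I"
      "\<forall>J. finite J \<and> J\<^sub>0 \<subseteq> J \<and> J \<subseteq> I \<longrightarrow> (\<Oplus>\<^bsub>A\<^esub>j\<in>J. a \<otimes>\<^bsub>A\<^esub> e j) = a"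
      using A.locally_unital_right[OF a] by (rule locally_unitalE)
    have "(\<Oplus>\<^bsub>X\<^esub>j\<in>J. ?E j (ract X x a)) = ract X x a" if J: "finite J" "J\<^sub>0 \<subseteq> J" "J \<subseteq> I" for J
    proof -
      interpret X: module K X by (rule bimod_module)
      have "(\<Oplus>\<^bsub>X\<^esub>j\<in>J. ?E j (ract X x a)) = (\<Oplus>\<^bsub>X\<^esub>j\<in>J. ract X x (a \<otimes>\<^bsub>A\<^esub> e j))"
        using J a x A.idem_closed
        by (intro X.finsum_cong' refl) (auto simp: ract_assoc intro!: ract_closed A.mult_closed)
      also have "\<dots> = ract X x (\<Oplus>\<^bsub>A\<^esub>j\<in>J. a \<otimes>\<^bsub>A\<^esub> e j)"
        using J a A.idem_closed A.mult_closed
        by (intro linear_map_finsum[OF A.algebra_module bimod_module ract_right[OF x], symmetric]) auto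
      finally show ?thesis using J\<^sub>0(3)[rule_format, of J] J by simp
    qed
    then show "locally_unital X I ?E (ract X x a)"
      using J\<^sub>0(1,2) by (intro locally_unitalI[of J\<^sub>0])
  qed
  ultimately have "span_mod K X {ract X x a |x a. x \<in> carrier X \<and> a \<in> carrier A} \<subseteq> ?H" by (rule span_mod_least)
  then have H: "carrier X \<subseteq> ?H" by (simp only: ract_unitary)
  have "locally_unital X I ?E x" "locally_unital X I ?E y"
    using subsetD[OF H x] subsetD[OF H y] by simp_all
  from locally_unital_common[OF this] obtain J where J: "finite J" "J \<subseteq> I"
    "(\<Oplus>\<^bsub>X\<^esub>j\<in>J. ?E j x) = x" "(\<Oplus>\<^bsub>X\<^esub>j\<in>J. ?E j y) = y"
    by (elim exE conjE)
  have "ract X z (\<Oplus>\<^bsub>A\<^esub>j\<in>J. e j) = (\<Oplus>\<^bsub>X\<^esub>j\<in>J. ?E j z)" if "z \<in> carrier X" for z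
    using J(1,2) A.idem_closed by (intro linear_map_finsum[OF A.algebra_module bimod_module ract_right[OF that]]) auto
  then show ?thesis
    using A.idem_sum[OF J(1,2)] J(3,4) x y by (intro exI[of _ "\<Oplus>\<^bsub>A\<^esub>j\<in>J. e j"]) simp
qed

text \<open>
  The Leibniz rule of a bimodule involves both actions at once. Inserting a local unit, which is a
  cycle of degree zero, on one side isolates the other side.
\<close>

lemma lact_diff:
  assumes A: "dg_algebra_idem K A I e" and B: "dg_module K B"
    and b: "b \<in> grade B m" and x: "x \<in> carrier X"
  shows "diff X (lact X b x) = lact X (diff B b) x \<oplus>\<^bsub>X\<^esub> ksign X m (lact X b (diff X x))"
proof (rule linear_map_graded_eq[OF bimod_graded bimod_module _ _ _ x])
  interpret A: dg_algebra_idem K A I e by (rule A)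
  interpret X: module K X by (rule bimod_module)
  have bc: "b \<in> carrier B" "diff B b \<in> carrier B"
    using dg_module_grade_closed[OF B b] diff_closed[OF B] by auto
  show "linear_map K X X (\<lambda>x. diff X (lact X b x))"
    by (rule linear_map_comp[OF lact_right[OF bc(1)] diff_linear[OF dg_module]])
  show "linear_map K X X (\<lambda>x. lact X (diff B b) x \<oplus>\<^bsub>X\<^esub> ksign X m (lact X b (diff X x)))"
    by (intro linear_map_plus_fun linear_map_ksign_fun X.module_axioms lact_right bc
        linear_map_comp[OF diff_linear[OF dg_module] lact_right])
  fix n x assume x: "x \<in> grade X n"
  have xc: "x \<in> carrier X" and dx: "diff X x \<in> carrier X"
    using bimod_grade_closed[OF x] diff_closed[OF dg_module] by auto
  obtain u where u: "u \<in> grade A 0" "diff A u = \<zero>\<^bsub>A\<^esub>" "ract X x u = x" "ract X (diff X x) u = diff X x"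
    using right_local_unit[OF A xc dx] by blast
  have uc: "u \<in> carrier A" by (rule A.algebra_grade_closed[OF u(1)])
  have "diff X (ract X (lact X b x) u) = ract X (lact X (diff B b) x) u \<oplus>\<^bsub>X\<^esub>
        ksign X m (ract X (lact X b (diff X x)) u) \<oplus>\<^bsub>X\<^esub> ksign X (m + n) (ract X (lact X b x) (diff A u))"
    by (rule act_diff[OF b x uc])
  then show "diff X (lact X b x) = lact X (diff B b) x \<oplus>\<^bsub>X\<^esub> ksign X m (lact X b (diff X x))"
    using u xc dx bc uc linear_map_zero[OF A.algebra_module bimod_module ract_right[OF lact_closed[OF bc(1) xc]]]
    by (simp add: lact_ract X.ksign_simps lact_closed)
qed

lemma ract_diff:
  assumes B: "dg_algebra_idem K B I e" and A: "dg_module K A"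
    and x: "x \<in> grade X n" and a: "a \<in> carrier A"
  shows "diff X (ract X x a) = ract X (diff X x) a \<oplus>\<^bsub>X\<^esub> ksign X n (ract X x (diff A a))"
proof -
  interpret B: dg_algebra_idem K B I e by (rule B)
  interpret X: module K X by (rule bimod_module)
  have xc: "x \<in> carrier X" and dx: "diff X x \<in> carrier X"
    using bimod_grade_closed[OF x] diff_closed[OF dg_module] by auto
  obtain u where u: "u \<in> grade B 0" "diff B u = \<zero>\<^bsub>B\<^esub>" "lact X u x = x" "lact X u (diff X x) = diff X x"
    using left_local_unit[OF B xc dx] by blast
  have "diff X (ract X (lact X u x) a) = ract X (lact X (diff B u) x) a \<oplus>\<^bsub>X\<^esub>
        ksign X 0 (ract X (lact X u (diff X x)) a) \<oplus>\<^bsub>X\<^esub> ksign X (0 + n) (ract X (lact X u x) (diff A a))"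
    by (rule act_diff[OF u(1) x a])
  moreover have "ract X (lact X (diff B u) x) a = \<zero>\<^bsub>X\<^esub>"
    using u(2) linear_map_zero[OF B.algebra_module bimod_module lact_left[OF xc]]
      linear_map_zero[OF bimod_module bimod_module ract_left[OF a]] by simp
  ultimately show ?thesis
    using u a dx ract_closed by (simp add: ksign_def)
qed

end

section \<open>The dg category of dg bimodules\<close>

subsection \<open>Modules of linear maps\<close>

lemma lin_maps_simps:
  "carrier (lin_maps K X Y) = {f \<in> extensional (carrier X). linear_map K X Y f}"
  "\<zero>\<^bsub>lin_maps K X Y\<^esub> = (\<lambda>x\<in>carrier X. \<zero>\<^bsub>Y\<^esub>)"
  "f \<oplus>\<^bsub>lin_maps K X Y\<^esub> g = (\<lambda>x\<in>carrier X. f x \<oplus>\<^bsub>Y\<^esub> g x)"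
  "k \<odot>\<^bsub>lin_maps K X Y\<^esub> f = (\<lambda>x\<in>carrier X. k \<odot>\<^bsub>Y\<^esub> f x)"
  by (simp_all add: lin_maps_def)

lemma lin_maps_linear: "f \<in> carrier (lin_maps K X Y) \<Longrightarrow> linear_map K X Y f"
  by (simp add: lin_maps_simps)

lemma lin_maps_eqI:
  assumes "f \<in> carrier (lin_maps K X Y)" "g \<in> carrier (lin_maps K X Y)"
    and "\<And>x. x \<in> carrier X \<Longrightarrow> f x = g x"
  shows "f = g"
  using assms by (intro extensionalityI[of f "carrier X" g]) (auto simp: lin_maps_simps)

context
  fixes K :: "'k ring" and X :: "('k, 'x, 'r) module_scheme" and Y :: "('k, 'y, 's) module_scheme"
  assumes X: "module K X" and Y: "module K Y"
begin

interpretation X: module K X by (rule X)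
interpretation Y: module K Y by (rule Y)

lemma lin_maps_restrict:
  assumes "linear_map K X Y f"
  shows "(\<lambda>x\<in>carrier X. f x) \<in> carrier (lin_maps K X Y)"
proof -
  have "linear_map K X Y (\<lambda>x\<in>carrier X. f x) \<longleftrightarrow> linear_map K X Y f"
    by (rule linear_map_cong[OF _ X]) simp
  then show ?thesis using assms by (simp add: lin_maps_simps)
qed

lemma lin_maps_module: "module K (lin_maps K X Y)"
proof -
  let ?L = "lin_maps K X Y"
  have add: "f \<oplus>\<^bsub>?L\<^esub> g \<in> carrier ?L" if "f \<in> carrier ?L" "g \<in> carrier ?L" for f g
    unfolding lin_maps_simps(3) by (intro lin_maps_restrict linear_map_plus_fun Y lin_maps_linear that)
  have smult: "k \<odot>\<^bsub>?L\<^esub> f \<in> carrier ?L" if "k \<in> carrier K" "f \<in> carrier ?L" for k f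
    unfolding lin_maps_simps(4) by (intro lin_maps_restrict linear_map_smult_fun Y lin_maps_linear that)
  have zero: "\<zero>\<^bsub>?L\<^esub> \<in> carrier ?L"
    unfolding lin_maps_simps(2) by (intro lin_maps_restrict linear_map_zero_fun Y)
  have neg: "(\<lambda>x\<in>carrier X. \<ominus>\<^bsub>Y\<^esub> f x) \<in> carrier ?L" if "f \<in> carrier ?L" for f
    by (intro lin_maps_restrict linear_map_a_inv_fun Y lin_maps_linear that)
  have cl: "f x \<in> carrier Y" if "f \<in> carrier ?L" "x \<in> carrier X" for f x
    by (rule linear_map_closed[OF lin_maps_linear[OF that(1)] that(2)])
  have ap: "(f \<oplus>\<^bsub>?L\<^esub> g) x = f x \<oplus>\<^bsub>Y\<^esub> g x" "(k \<odot>\<^bsub>?L\<^esub> f) x = k \<odot>\<^bsub>Y\<^esub> f x" "\<zero>\<^bsub>?L\<^esub> x = \<zero>\<^bsub>Y\<^esub>"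
    if "x \<in> carrier X" for f g k x
    using that by (simp_all add: lin_maps_simps(2-4))
  note eqI = lin_maps_eqI[of _ K X Y]
  have "abelian_group ?L"
  proof (rule abelian_groupI)
    fix f g h assume f: "f \<in> carrier ?L" and g: "g \<in> carrier ?L" and h: "h \<in> carrier ?L"
    show "f \<oplus>\<^bsub>?L\<^esub> g \<oplus>\<^bsub>?L\<^esub> h = f \<oplus>\<^bsub>?L\<^esub> (g \<oplus>\<^bsub>?L\<^esub> h)"
      by (rule eqI) (simp_all add: f g h add ap cl Y.M.a_assoc)
  next
    fix f g assume f: "f \<in> carrier ?L" and g: "g \<in> carrier ?L"
    show "f \<oplus>\<^bsub>?L\<^esub> g = g \<oplus>\<^bsub>?L\<^esub> f"
      by (rule eqI) (simp_all add: f g add ap cl Y.M.a_comm)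
  next
    fix f assume f: "f \<in> carrier ?L"
    show "\<zero>\<^bsub>?L\<^esub> \<oplus>\<^bsub>?L\<^esub> f = f"
      by (rule eqI) (simp_all add: f zero add ap cl)
    have "(\<lambda>x\<in>carrier X. \<ominus>\<^bsub>Y\<^esub> f x) \<oplus>\<^bsub>?L\<^esub> f = \<zero>\<^bsub>?L\<^esub>"
      by (rule eqI) (simp_all add: f zero add neg ap cl Y.M.l_neg)
    then show "\<exists>g\<in>carrier ?L. g \<oplus>\<^bsub>?L\<^esub> f = \<zero>\<^bsub>?L\<^esub>" using neg[OF f] by blast
  qed (simp_all add: zero add)
  then show ?thesis
  proof (rule moduleI[OF X.R.is_cring])
    fix a f g assume a: "a \<in> carrier K" and f: "f \<in> carrier ?L" and g: "g \<in> carrier ?L"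
    show "a \<odot>\<^bsub>?L\<^esub> (f \<oplus>\<^bsub>?L\<^esub> g) = a \<odot>\<^bsub>?L\<^esub> f \<oplus>\<^bsub>?L\<^esub> a \<odot>\<^bsub>?L\<^esub> g"
      by (rule eqI) (simp_all add: a f g add smult ap cl Y.smult_r_distr)
  next
    fix a b f assume a: "a \<in> carrier K" and b: "b \<in> carrier K" and f: "f \<in> carrier ?L"
    show "(a \<oplus>\<^bsub>K\<^esub> b) \<odot>\<^bsub>?L\<^esub> f = a \<odot>\<^bsub>?L\<^esub> f \<oplus>\<^bsub>?L\<^esub> b \<odot>\<^bsub>?L\<^esub> f"
      by (rule eqI) (simp_all add: a b f add smult ap cl Y.smult_l_distr)
    show "(a \<otimes>\<^bsub>K\<^esub> b) \<odot>\<^bsub>?L\<^esub> f = a \<odot>\<^bsub>?L\<^esub> (b \<odot>\<^bsub>?L\<^esub> f)"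
      by (rule eqI) (simp_all add: a b f smult ap cl Y.smult_assoc1)
  next
    fix a f assume a: "a \<in> carrier K" and f: "f \<in> carrier ?L"
    show "a \<odot>\<^bsub>?L\<^esub> f \<in> carrier ?L" by (rule smult[OF a f])
  next
    fix f assume f: "f \<in> carrier ?L"
    show "\<one>\<^bsub>K\<^esub> \<odot>\<^bsub>?L\<^esub> f = f"
      by (rule eqI) (simp_all add: f smult ap cl)
  qed
qed

lemma lin_maps_ev: "x \<in> carrier X \<Longrightarrow> linear_map K (lin_maps K X Y) Y (\<lambda>f. f x)"
  by (rule linear_mapI) (auto simp: lin_maps_simps linear_map_closed)

lemma linear_map_into_lin_maps:
  assumes M: "module K M" and mem: "\<And>m. m \<in> carrier M \<Longrightarrow> F m \<in> carrier (lin_maps K X Y)"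
    and ev: "\<And>x. x \<in> carrier X \<Longrightarrow> linear_map K M Y (\<lambda>m. F m x)"
  shows "linear_map K M (lin_maps K X Y) F"
proof -
  interpret M: module K M by (rule M)
  interpret L: module K "lin_maps K X Y" by (rule lin_maps_module)
  show ?thesis
  proof (rule linear_mapI)
    show "F m \<in> carrier (lin_maps K X Y)" if "m \<in> carrier M" for m by (rule mem[OF that])
    show "F (m \<oplus>\<^bsub>M\<^esub> m') = F m \<oplus>\<^bsub>lin_maps K X Y\<^esub> F m'" if "m \<in> carrier M" "m' \<in> carrier M" for m m'
      by (rule lin_maps_eqI[of _ K X Y])
        (use that in \<open>simp_all add: mem L.M.add.m_closed linear_map_add[OF ev], simp add: lin_maps_simps(3)\<close>)
    show "F (k \<odot>\<^bsub>M\<^esub> m) = k \<odot>\<^bsub>lin_maps K X Y\<^esub> F m" if "k \<in> carrier K" "m \<in> carrier M" for k m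
      by (rule lin_maps_eqI[of _ K X Y])
        (use that in \<open>simp_all add: mem L.smult_closed linear_map_smult[OF ev], simp add: lin_maps_simps(4)\<close>)
  qed
qed

end

subsection \<open>Submodules as modules\<close>

context
  fixes K :: "'k ring" and L :: "('k, 'm, 'r) module_scheme" and R :: "('k, 'm, 's) module_scheme"
  assumes L: "module K L" and sub: "submodule (carrier R) K L"
    and ops: "add R = add L" "zero R = zero L" "smult R = smult L"
begin

lemma submodule_record_module: "module K R"
  by (rule same_module_module[OF _ submodule.submodule_is_module[OF sub L]]) (simp add: same_module_def ops)

lemma submodule_record_closed: "x \<in> carrier R \<Longrightarrow> x \<in> carrier L"
  by (rule submodule_subset[OF sub])

lemma linear_map_from_submodule: "linear_map K L N f \<Longrightarrow> linear_map K R N f"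
  using submodule_record_closed by (auto simp: linear_map_def ops Pi_iff)

lemma linear_map_into_submodule:
  "linear_map K M L f \<Longrightarrow> (\<And>x. x \<in> carrier M \<Longrightarrow> f x \<in> carrier R) \<Longrightarrow> linear_map K M R f"
  by (auto simp: linear_map_def ops Pi_iff)

lemma submodule_of_submodule:
  assumes "submodule H K L" "H \<subseteq> carrier R" shows "submodule H K R"
  by (rule submodule_if[OF submodule_record_module assms(2)])
    (use assms(1) in \<open>auto simp: ops intro: submodule_zero submodule_add submodule_smult\<close>)

lemma span_mod_in_submodule:
  assumes "S \<subseteq> carrier R" shows "span_mod K L S \<subseteq> span_mod K R S"
proof (rule span_mod_least)
  have H: "submodule (span_mod K R S) K R" by (rule span_mod_submodule[OF submodule_record_module assms])
  show "submodule (span_mod K R S) K L"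
    by (rule submodule_if[OF L])
      (use submodule_subset[OF H] submodule_record_closed submodule_zero[OF H] submodule_add[OF H] submodule_smult[OF H]
        in \<open>auto simp: ops\<close>)
qed (auto intro: span_mod_base)

end

lemma same_module_graded:
  fixes M :: "('k, 'm, 'r) gmod_scheme" and M' :: "('k, 'm, 's) gmod_scheme"
  assumes "same_module M M'" "grade M = grade M'" "graded_module K M"
  shows "graded_module K M'"
proof -
  have e: "carrier M' = carrier M" "zero M' = zero M" using assms(1) by (simp_all add: same_module_def)
  have "decomposes M' UNIV (grade M') x c \<longleftrightarrow> decomposes M UNIV (grade M) x c" for x c
    by (simp add: decomposes_def e assms(2) same_module_simps(7)[OF assms(1)])
  moreover have "module K M'" by (rule same_module_module[OF assms(1) graded_module_module[OF assms(3)]])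
  ultimately show ?thesis
    using assms(3) same_module_simps(3)[OF assms(1)]
    by (simp add: graded_module_def internal_direct_sum_def assms(2) e)
qed

subsection \<open>Homogeneous bimodule maps\<close>

lemma bimod_ghom_simps:
  "carrier (bimod_ghom K B A X Y) = span_mod K (lin_maps K X Y) (\<Union>n. bimod_hom_deg K B A X Y n)"
  "add (bimod_ghom K B A X Y) = add (lin_maps K X Y)" "zero (bimod_ghom K B A X Y) = zero (lin_maps K X Y)"
  "smult (bimod_ghom K B A X Y) = smult (lin_maps K X Y)"
  "grade (bimod_ghom K B A X Y) = bimod_hom_deg K B A X Y"
  by (simp_all add: bimod_ghom_def Let_def)

lemma bimod_hom_simps:
  "carrier (bimod_hom K B A X Y) = carrier (bimod_ghom K B A X Y)"
  "add (bimod_hom K B A X Y) = add (lin_maps K X Y)" "zero (bimod_hom K B A X Y) = zero (lin_maps K X Y)"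
  "smult (bimod_hom K B A X Y) = smult (lin_maps K X Y)"
  "grade (bimod_hom K B A X Y) = bimod_hom_deg K B A X Y"
  "diff (bimod_hom K B A X Y) = (\<lambda>f. \<lambda>x\<in>carrier X.
      diff Y (f x) \<ominus>\<^bsub>Y\<^esub> twist (bimod_ghom K B A X Y) f (diff X x))"
  by (simp_all add: bimod_hom_def bimod_ghom_def Let_def gmod.defs dgmod.defs)

lemma bimod_hom_degD:
  assumes "f \<in> bimod_hom_deg K B A X Y n"
  shows "f \<in> carrier (lin_maps K X Y)" "linear_map K X Y f"
    and "x \<in> grade X p \<Longrightarrow> f x \<in> grade Y (p + n)"
    and "b \<in> grade B p \<Longrightarrow> x \<in> carrier X \<Longrightarrow> a \<in> carrier A \<Longrightarrow>
      f (ract X (lact X b x) a) = ksign Y (n * p) (ract Y (lact Y b (f x)) a)"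
  using assms by (auto simp: bimod_hom_deg_def lin_maps_simps)

context
  fixes K :: "'k ring" and A :: "('k, 'a) dgmod" and I\<^sub>A :: "'i set" and e\<^sub>A :: "'i \<Rightarrow> 'a"
    and B :: "('k, 'b) dgmod" and I\<^sub>B :: "'j set" and e\<^sub>B :: "'j \<Rightarrow> 'b"
    and X :: "('k, 'b, 'a, 'x) dgbimod" and Y :: "('k, 'b, 'a, 'y) dgbimod"
  assumes algA: "dg_algebra_idem K A I\<^sub>A e\<^sub>A" and algB: "dg_algebra_idem K B I\<^sub>B e\<^sub>B"
    and bimX: "dg_bimodule K B A X" and bimY: "dg_bimodule K B A Y"
begin

interpretation A: dg_algebra_idem K A I\<^sub>A e\<^sub>A by (rule algA)
interpretation B: dg_algebra_idem K B I\<^sub>B e\<^sub>B by (rule algB)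
interpretation X: dg_bimodule K B A X by (rule bimX)
interpretation Y: dg_bimodule K B A Y by (rule bimY)
interpretation MX: module K X by (rule X.bimod_module)
interpretation MY: module K Y by (rule Y.bimod_module)
interpretation L: module K "lin_maps K X Y" by (rule lin_maps_module[OF X.bimod_module Y.bimod_module])

private abbreviation (input) "LXY \<equiv> lin_maps K X Y"
private abbreviation (input) "Deg \<equiv> bimod_hom_deg K B A X Y"
private abbreviation (input) "G \<equiv> bimod_ghom K B A X Y"
private abbreviation (input) "H \<equiv> bimod_hom K B A X Y"

private lemmas ev = lin_maps_ev[OF X.bimod_module Y.bimod_module]

text \<open>
  Since \<open>v x u = x\<close> and \<open>v\<close> has degree zero, \<open>f x = v (f x) u\<close>; now \<open>v\<close> and \<open>u\<close> are idempotent.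
  As for the Leibniz rule, this separates the condition on a bimodule map into one for each action.
\<close>

lemma bimod_hom_deg_local_unit:
  assumes f: "f \<in> Deg n" and x: "x \<in> carrier X" and v: "v \<in> grade B 0" "v \<otimes>\<^bsub>B\<^esub> v = v" "lact X v x = x"
    and u: "u \<in> carrier A" "u \<otimes>\<^bsub>A\<^esub> u = u" "ract X x u = x"
  shows "ract Y (f x) u = f x" "lact Y v (f x) = f x"
proof -
  have fx: "f x \<in> carrier Y" and vc: "v \<in> carrier B"
    using linear_map_closed[OF bimod_hom_degD(2)[OF f] x] B.algebra_grade_closed[OF v(1)] by auto
  have fxe: "f x = ract Y (lact Y v (f x)) u"
    using bimod_hom_degD(4)[OF f v(1) x u(1)] v(3) u(3) by (simp add: ksign_def)
  have "ract Y (ract Y (lact Y v (f x)) u) u = ract Y (lact Y v (f x)) u"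
    using Y.ract_assoc[of "lact Y v (f x)" u u] u Y.lact_closed[OF vc fx] by simp
  then show "ract Y (f x) u = f x" using fxe by simp
  have "lact Y v (ract Y (lact Y v (f x)) u) = ract Y (lact Y v (f x)) u"
    using Y.lact_ract[OF vc Y.lact_closed[OF vc fx] u(1)] Y.lact_assoc[OF vc vc fx] v(2) by simp
  then show "lact Y v (f x) = f x" using fxe by simp
qed

lemma bimod_hom_deg_lact:
  assumes f: "f \<in> Deg n" and b: "b \<in> grade B p" and x: "x \<in> carrier X"
  shows "f (lact X b x) = ksign Y (n * p) (lact Y b (f x))"
proof -
  obtain v where v: "v \<in> grade B 0" "v \<otimes>\<^bsub>B\<^esub> v = v" "lact X v x = x"
    using X.left_local_unit[OF algB x x] by blast
  obtain u where u: "u \<in> grade A 0" "u \<otimes>\<^bsub>A\<^esub> u = u" "ract X x u = x"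
    using X.right_local_unit[OF algA x x] by blast
  have uc: "u \<in> carrier A" by (rule A.algebra_grade_closed[OF u(1)])
  have fx: "f x \<in> carrier Y" by (rule linear_map_closed[OF bimod_hom_degD(2)[OF f] x])
  have bc: "b \<in> carrier B" by (rule B.algebra_grade_closed[OF b])
  have "f (ract X (lact X b x) u) = ksign Y (n * p) (ract Y (lact Y b (f x)) u)"
    by (rule bimod_hom_degD(4)[OF f b x uc])
  then show ?thesis
    using bimod_hom_deg_local_unit(1)[OF f x v uc u(2,3)] X.lact_ract[OF bc x uc] Y.lact_ract[OF bc fx uc] u(3)
    by simp
qed

lemma bimod_hom_deg_ract:
  assumes f: "f \<in> Deg n" and a: "a \<in> carrier A" and x: "x \<in> carrier X"
  shows "f (ract X x a) = ract Y (f x) a"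
proof -
  obtain v where v: "v \<in> grade B 0" "v \<otimes>\<^bsub>B\<^esub> v = v" "lact X v x = x"
    using X.left_local_unit[OF algB x x] by blast
  obtain u where u: "u \<in> grade A 0" "u \<otimes>\<^bsub>A\<^esub> u = u" "ract X x u = x"
    using X.right_local_unit[OF algA x x] by blast
  have uc: "u \<in> carrier A" by (rule A.algebra_grade_closed[OF u(1)])
  show ?thesis
    using bimod_hom_degD(4)[OF f v(1) x a] bimod_hom_deg_local_unit(2)[OF f x v uc u(2,3)] v(3)
    by (simp add: ksign_def)
qed

lemma bimod_hom_degI:
  assumes f: "f \<in> carrier LXY" and deg: "\<And>p x. x \<in> grade X p \<Longrightarrow> f x \<in> grade Y (p + n)"
    and l: "\<And>p b x. b \<in> grade B p \<Longrightarrow> x \<in> carrier X \<Longrightarrow> f (lact X b x) = ksign Y (n * p) (lact Y b (f x))"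
    and r: "\<And>a x. a \<in> carrier A \<Longrightarrow> x \<in> carrier X \<Longrightarrow> f (ract X x a) = ract Y (f x) a"
  shows "f \<in> Deg n"
proof -
  have "f (ract X (lact X b x) a) = ksign Y (n * p) (ract Y (lact Y b (f x)) a)"
    if b: "b \<in> grade B p" and x: "x \<in> carrier X" and a: "a \<in> carrier A" for b x a p
  proof -
    have bc: "b \<in> carrier B" by (rule B.algebra_grade_closed[OF b])
    have fx: "f x \<in> carrier Y" by (rule linear_map_closed[OF lin_maps_linear[OF f] x])
    show ?thesis
      using linear_map_ksign[OF Y.bimod_module Y.bimod_module Y.ract_left[OF a] Y.lact_closed[OF bc fx]]
      by (simp add: r[OF a X.lact_closed[OF bc x]] l[OF b x])
  qed
  then show ?thesis using f deg by (auto simp: bimod_hom_deg_def)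
qed

lemma bimod_hom_deg_submodule: "submodule (Deg n) K LXY"
proof (rule submodule_if[OF L.module_axioms])
  show "Deg n \<subseteq> carrier LXY" using bimod_hom_degD(1) by blast
  note gY = grade_submodule[OF Y.bimod_graded]
  have z: "\<zero>\<^bsub>LXY\<^esub> x = \<zero>\<^bsub>Y\<^esub>" if "x \<in> carrier X" for x using that by (simp add: lin_maps_simps(2))
  show "\<zero>\<^bsub>LXY\<^esub> \<in> Deg n"
    by (rule bimod_hom_degI)
      (use X.bimod_grade_closed X.lact_closed X.ract_closed B.algebra_grade_closed submodule_zero[OF gY]
        linear_map_zero[OF Y.bimod_module Y.bimod_module Y.lact_right]
        linear_map_zero[OF Y.bimod_module Y.bimod_module Y.ract_left] in \<open>auto simp: z MY.ksign_zero\<close>)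
  fix f g assume f: "f \<in> Deg n" and g: "g \<in> Deg n"
  note fgL = bimod_hom_degD(1)[OF f] bimod_hom_degD(1)[OF g]
  have p: "(f \<oplus>\<^bsub>LXY\<^esub> g) x = f x \<oplus>\<^bsub>Y\<^esub> g x" if "x \<in> carrier X" for x using that by (simp add: lin_maps_simps(3))
  note cl = linear_map_closed[OF bimod_hom_degD(2)[OF f]] linear_map_closed[OF bimod_hom_degD(2)[OF g]]
  show "f \<oplus>\<^bsub>LXY\<^esub> g \<in> Deg n"
  proof (rule bimod_hom_degI)
    show "f \<oplus>\<^bsub>LXY\<^esub> g \<in> carrier LXY" using fgL by simp
    show "(f \<oplus>\<^bsub>LXY\<^esub> g) x \<in> grade Y (p + n)" if "x \<in> grade X p" for p x
      using that bimod_hom_degD(3)[OF f that] bimod_hom_degD(3)[OF g that]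
      by (simp add: p X.bimod_grade_closed submodule_add[OF gY])
    show "(f \<oplus>\<^bsub>LXY\<^esub> g) (lact X b x) = ksign Y (n * p) (lact Y b ((f \<oplus>\<^bsub>LXY\<^esub> g) x))"
      if "b \<in> grade B p" "x \<in> carrier X" for b p x
      using that B.algebra_grade_closed[OF that(1)] cl
      by (simp add: p X.lact_closed bimod_hom_deg_lact[OF f] bimod_hom_deg_lact[OF g]
          linear_map_add[OF Y.lact_right] MY.ksign_add Y.lact_closed)
    show "(f \<oplus>\<^bsub>LXY\<^esub> g) (ract X x a) = ract Y ((f \<oplus>\<^bsub>LXY\<^esub> g) x) a" if "a \<in> carrier A" "x \<in> carrier X" for a x
      using that cl
      by (simp add: p X.ract_closed bimod_hom_deg_ract[OF f] bimod_hom_deg_ract[OF g] linear_map_add[OF Y.ract_left])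
  qed
next
  note gY = grade_submodule[OF Y.bimod_graded]
  fix k f assume k: "k \<in> carrier K" and f: "f \<in> Deg n"
  note fL = bimod_hom_degD(1)[OF f]
  have p: "(k \<odot>\<^bsub>LXY\<^esub> f) x = k \<odot>\<^bsub>Y\<^esub> f x" if "x \<in> carrier X" for x using that by (simp add: lin_maps_simps(4))
  note cl = linear_map_closed[OF bimod_hom_degD(2)[OF f]]
  show "k \<odot>\<^bsub>LXY\<^esub> f \<in> Deg n"
  proof (rule bimod_hom_degI)
    show "k \<odot>\<^bsub>LXY\<^esub> f \<in> carrier LXY" using k fL by simp
    show "(k \<odot>\<^bsub>LXY\<^esub> f) x \<in> grade Y (p + n)" if "x \<in> grade X p" for p x
      using that bimod_hom_degD(3)[OF f that] k
      by (simp add: p X.bimod_grade_closed submodule_smult[OF gY])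
    show "(k \<odot>\<^bsub>LXY\<^esub> f) (lact X b x) = ksign Y (n * p) (lact Y b ((k \<odot>\<^bsub>LXY\<^esub> f) x))"
      if "b \<in> grade B p" "x \<in> carrier X" for b p x
      using that B.algebra_grade_closed[OF that(1)] cl k
      by (simp add: p X.lact_closed bimod_hom_deg_lact[OF f]
          linear_map_smult[OF Y.lact_right] Y.lact_closed ksign_def MY.smult_r_minus)
    show "(k \<odot>\<^bsub>LXY\<^esub> f) (ract X x a) = ract Y ((k \<odot>\<^bsub>LXY\<^esub> f) x) a" if "a \<in> carrier A" "x \<in> carrier X" for a x
      using that cl k
      by (simp add: p X.ract_closed bimod_hom_deg_ract[OF f] linear_map_smult[OF Y.ract_left])
  qed
qed

lemma deg_union_subset: "(\<Union>n. Deg n) \<subseteq> carrier LXY"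
  using bimod_hom_degD(1) by blast

lemma hom_carrier_submodule: "submodule (carrier H) K LXY"
  unfolding bimod_hom_simps(1) bimod_ghom_simps(1) by (rule span_mod_submodule[OF L.module_axioms deg_union_subset])

lemma ghom_carrier_submodule: "submodule (carrier G) K LXY"
  using hom_carrier_submodule by (simp add: bimod_hom_simps(1))

private lemmas hom_sub = L.module_axioms hom_carrier_submodule bimod_hom_simps(2,3,4)
private lemmas ghom_sub = L.module_axioms ghom_carrier_submodule bimod_ghom_simps(2,3,4)
lemmas hom_module = submodule_record_module[OF hom_sub]
lemmas ghom_module = submodule_record_module[OF ghom_sub]
lemmas hom_closed_lin = submodule_record_closed[OF hom_sub]
lemmas hom_from = linear_map_from_submodule[OF hom_sub]
lemmas hom_into = linear_map_into_submodule[OF hom_sub]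

lemma deg_closed: "f \<in> Deg n \<Longrightarrow> f \<in> carrier H"
  unfolding bimod_hom_simps(1) bimod_ghom_simps(1) by (rule span_mod_base) blast

lemma hom_linear: "f \<in> carrier H \<Longrightarrow> linear_map K X Y f"
  by (rule lin_maps_linear[OF hom_closed_lin])

lemma hom_apply_closed: "f \<in> carrier H \<Longrightarrow> x \<in> carrier X \<Longrightarrow> f x \<in> carrier Y"
  by (rule linear_map_closed[OF hom_linear])

lemma hom_ev: "x \<in> carrier X \<Longrightarrow> linear_map K H Y (\<lambda>f. f x)"
  by (rule hom_from[OF ev])

lemma hom_eqI:
  assumes "f \<in> carrier H" "g \<in> carrier H" "\<And>p x. x \<in> grade X p \<Longrightarrow> f x = g x"
  shows "f = g"
  by (rule lin_maps_eqI[OF hom_closed_lin[OF assms(1)] hom_closed_lin[OF assms(2)]])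
    (rule linear_map_graded_eq[OF X.bimod_graded Y.bimod_module hom_linear[OF assms(1)] hom_linear[OF assms(2)] assms(3)])

text \<open>The component of degree \<open>n\<close> of \<open>f\<close> sends \<open>x\<close> of degree \<open>p\<close> to the component of \<open>f x\<close> of degree \<open>p + n\<close>.\<close>

lemma ghom_graded: "graded_module K G"
proof (rule graded_moduleI[OF ghom_module])
  let ?h = "\<lambda>n f p x. hcomp Y (f x) (p + n)"
  let ?pi = "\<lambda>n f. \<lambda>x\<in>carrier X. \<Oplus>\<^bsub>Y\<^esub>p\<in>hsupp X x. ?h n f p (hcomp X x p)"
  have h: "linear_map K X Y (?h n f p)" if "f \<in> carrier LXY" for n f p
    by (rule linear_map_comp[OF lin_maps_linear[OF that] hcomp_linear[OF Y.bimod_graded]])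
  have piL: "?pi n f \<in> carrier LXY" if "f \<in> carrier LXY" for n f
    by (intro lin_maps_restrict[OF X.bimod_module Y.bimod_module]
        graded_sum_linear[OF X.bimod_graded Y.bimod_module] h that)
  have pi_lin: "linear_map K LXY LXY (?pi n)" for n
  proof (rule linear_map_into_lin_maps[OF X.bimod_module Y.bimod_module L.module_axioms piL])
    fix x assume x: "x \<in> carrier X"
    have "linear_map K LXY Y (\<lambda>f. \<Oplus>\<^bsub>Y\<^esub>p\<in>hsupp X x. ?h n f p (hcomp X x p))"
      by (intro linear_map_finsum_fun L.module_axioms Y.bimod_module finite_hsupp[OF X.bimod_graded] x
          linear_map_comp[OF ev hcomp_linear[OF Y.bimod_graded]] hcomp_closed[OF X.bimod_graded])
    then show "linear_map K LXY Y (\<lambda>f. ?pi n f x)" using x by simp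
  qed
  have pi_deg: "?pi n f = (if m = n then f else \<zero>\<^bsub>LXY\<^esub>)" if f: "f \<in> Deg m" for f m n
  proof (rule lin_maps_eqI)
    note fL = bimod_hom_degD(1)[OF f]
    show "?pi n f \<in> carrier LXY" by (rule piL[OF fL])
    show R: "(if m = n then f else \<zero>\<^bsub>LXY\<^esub>) \<in> carrier LXY" using fL by simp
    fix x assume x: "x \<in> carrier X"
    show "?pi n f x = (if m = n then f else \<zero>\<^bsub>LXY\<^esub>) x"
    proof (rule linear_map_graded_eq[OF X.bimod_graded Y.bimod_module lin_maps_linear[OF piL[OF fL]] lin_maps_linear[OF R] _ x])
      fix p x assume x: "x \<in> grade X p"
      have "?pi n f x = hcomp Y (f x) (p + n)"
        using graded_sum_homogeneous[OF X.bimod_graded Y.bimod_module h[OF fL] x] X.bimod_grade_closed[OF x] by simp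
      then show "?pi n f x = (if m = n then f else \<zero>\<^bsub>LXY\<^esub>) x"
        using hcomp_homogeneous[OF Y.bimod_graded bimod_hom_degD(3)[OF f x]] X.bimod_grade_closed[OF x]
        by (simp add: lin_maps_simps(2))
    qed
  qed
  have Gsub: "Deg n \<subseteq> carrier G" for n using deg_closed bimod_hom_simps(1) by blast
  show "submodule (grade G n) K G" for n
    unfolding bimod_ghom_simps(5) by (rule submodule_of_submodule[OF ghom_sub bimod_hom_deg_submodule Gsub])
  show "carrier G \<subseteq> span_mod K G (\<Union>n. grade G n)"
    unfolding bimod_ghom_simps(5)
    using span_mod_in_submodule[OF ghom_sub, of "\<Union>n. Deg n"] Gsub by (auto simp: bimod_ghom_simps(1))
  show "?pi n f = (if m = n then f else \<zero>\<^bsub>G\<^esub>)" if "f \<in> grade G m" for m n f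
    using pi_deg that by (simp add: bimod_ghom_simps)
  show "linear_map K G G (?pi n)" for n
  proof (rule linear_map_into_submodule[OF ghom_sub linear_map_from_submodule[OF ghom_sub pi_lin]])
    fix f assume f: "f \<in> carrier G"
    have "?pi n s \<in> carrier G" if "s \<in> (\<Union>n. Deg n)" for s
    proof -
      obtain m where s: "s \<in> Deg m" using \<open>s \<in> (\<Union>n. Deg n)\<close> by blast
      then have "s \<in> carrier G" "\<zero>\<^bsub>LXY\<^esub> \<in> carrier G"
        using Gsub submodule_zero[OF ghom_carrier_submodule] by auto
      then show ?thesis by (simp add: pi_deg[OF s])
    qed
    then show "?pi n f \<in> carrier G"
      by (rule linear_map_span_into[OF L.module_axioms L.module_axioms pi_lin
            ghom_carrier_submodule deg_union_subset _ f[unfolded bimod_ghom_simps(1)]])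
  qed
qed

lemma hom_graded: "graded_module K H"
  by (rule same_module_graded[OF _ _ ghom_graded])
    (simp_all add: same_module_def bimod_hom_simps bimod_ghom_simps)

lemma hom_ksign: "f \<in> carrier H \<Longrightarrow> x \<in> carrier X \<Longrightarrow> ksign H n f x = ksign Y n (f x)"
  using linear_map_ksign[OF hom_module Y.bimod_module hom_ev] by simp

lemma hom_diff_apply:
  assumes f: "f \<in> Deg n" and x: "x \<in> carrier X"
  shows "diff H f x = diff Y (f x) \<ominus>\<^bsub>Y\<^esub> ksign Y n (f (diff X x))"
proof -
  have "twist G f = ksign G n f"
    using twist_homogeneous[OF ghom_graded] f by (simp add: bimod_ghom_simps(5))
  moreover have "ksign G n f = ksign H n f"
    by (rule fun_cong[OF same_module_simps(8)]) (simp add: same_module_def bimod_hom_simps bimod_ghom_simps)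
  ultimately show ?thesis
    using x hom_ksign[OF deg_closed[OF f] diff_closed[OF X.dg_module x]] by (simp add: bimod_hom_simps(6))
qed

lemma hom_diff_linear_lin: "linear_map K H (lin_maps K X Y) (diff H)"
proof (rule linear_map_into_lin_maps[OF X.bimod_module Y.bimod_module hom_module])
  note md = X.bimod_module Y.bimod_module
  have tw: "linear_map K G G (twist G)" by (rule twist_linear[OF ghom_graded])
  have sm: "same_module G H" by (simp add: same_module_def bimod_hom_simps bimod_ghom_simps)
  have twf: "twist G f \<in> carrier (lin_maps K X Y)" if "f \<in> carrier H" for f
    using linear_map_closed[OF tw] that hom_closed_lin by (simp add: bimod_hom_simps(1))
  have dx: "x \<in> carrier X \<Longrightarrow> diff X x \<in> carrier X" for x by (rule diff_closed[OF X.dg_module])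
  show "diff H f \<in> carrier (lin_maps K X Y)" if f: "f \<in> carrier H" for f
    unfolding bimod_hom_simps(6)
    by (intro lin_maps_restrict md linear_map_minus_fun linear_map_comp[OF hom_linear[OF f] diff_linear[OF Y.dg_module]]
        linear_map_comp[OF diff_linear[OF X.dg_module] lin_maps_linear[OF twf[OF f]]])
  fix x assume x: "x \<in> carrier X"
  have "linear_map K G Y (\<lambda>f. twist G f (diff X x))"
    by (rule linear_map_comp[OF tw linear_map_from_submodule[OF ghom_sub lin_maps_ev[OF md dx[OF x]]]])
  then have "linear_map K H Y (\<lambda>f. twist G f (diff X x))"
    by (simp add: same_module_simps(1)[OF sm])
  then have "linear_map K H Y (\<lambda>f. diff Y (f x) \<ominus>\<^bsub>Y\<^esub> twist G f (diff X x))"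
    by (intro linear_map_minus_fun Y.bimod_module linear_map_comp[OF hom_ev[OF x] diff_linear[OF Y.dg_module]])
  then show "linear_map K H Y (\<lambda>f. diff H f x)" using x by (simp add: bimod_hom_simps(6))
qed

text \<open>
  In the test of \<open>d f\<close> on \<open>b x\<close> the terms with \<open>d b\<close> from the two summands of \<open>d f\<close> cancel, and on
  \<open>x a\<close> those with \<open>d a\<close>.
\<close>

lemma hom_diff_deg:
  assumes f: "f \<in> Deg n"
  shows "diff H f \<in> Deg (n + 1)"
proof (rule bimod_hom_degI)
  note ap = hom_diff_apply[OF f]
  note fc = linear_map_closed[OF bimod_hom_degD(2)[OF f]]
  note dX = diff_closed[OF X.dg_module] and dY = diff_closed[OF Y.dg_module]
  note dYk = linear_map_ksign[OF Y.bimod_module Y.bimod_module diff_linear[OF Y.dg_module]]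
  note fk = linear_map_ksign[OF X.bimod_module Y.bimod_module bimod_hom_degD(2)[OF f]]
  note fadd = linear_map_add[OF bimod_hom_degD(2)[OF f]]
  show "diff H f \<in> carrier (lin_maps K X Y)"
    by (rule linear_map_closed[OF hom_diff_linear_lin deg_closed[OF f]])
  show "diff H f x \<in> grade Y (p + (n + 1))" if x: "x \<in> grade X p" for p x
  proof -
    have "diff Y (f x) \<in> grade Y (p + n + 1)"
      by (rule diff_grade[OF Y.dg_module bimod_hom_degD(3)[OF f x]])
    moreover have "f (diff X x) \<in> grade Y (p + 1 + n)"
      by (rule bimod_hom_degD(3)[OF f diff_grade[OF X.dg_module x]])
    moreover have "p + n + 1 = p + (n + 1)" "p + 1 + n = p + (n + 1)" by simp_all
    ultimately show ?thesis
      using ap[OF X.bimod_grade_closed[OF x]] grade_submodule[OF Y.bimod_graded]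
      by (metis submodule_minus submodule_ksign)
  qed
  show "diff H f (lact X b x) = ksign Y ((n + 1) * p) (lact Y b (diff H f x))"
    if b: "b \<in> grade B p" and x: "x \<in> carrier X" for p b x
  proof -
    note db = diff_grade[OF B.dg_module b]
    note bc = B.algebra_grade_closed[OF b] and dbc = B.algebra_grade_closed[OF db]
    note dx = dX[OF x] and fx = fc[OF x]
    note cl = bc dbc dx fx x fc[OF dx] dY[OF fx] X.lact_closed Y.lact_closed
    note hl = bimod_hom_deg_lact[OF f]
    (* ?s comes from d (f (b x)) and, with the same sign, from (-1)^n f (d (b x)). *)
    let ?s = "ksign Y (n * p) (lact Y (diff B b) (f x))"
    have "diff H f (lact X b x) = (?s \<oplus>\<^bsub>Y\<^esub> ksign Y (n * p + p) (lact Y b (diff Y (f x)))) \<ominus>\<^bsub>Y\<^esub>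
        (ksign Y (n + n * (p + 1)) (lact Y (diff B b) (f x)) \<oplus>\<^bsub>Y\<^esub> ksign Y (n + (p + n * p)) (lact Y b (f (diff X x))))"
      by (simp add: ap cl hl[OF b] hl[OF db] dYk fk fadd X.lact_diff[OF algA B.dg_module b] Y.lact_diff[OF algA B.dg_module b]
          MY.ksign_simps MX.ksign_simps)
    also have "ksign Y (n + n * (p + 1)) (lact Y (diff B b) (f x)) = ?s"
      by (rule ksign_cong) (simp add: algebra_simps)
    also have "ksign Y (n + (p + n * p)) (lact Y b (f (diff X x))) = ksign Y (n * p + p + n) (lact Y b (f (diff X x)))"
      by (rule ksign_cong) (simp add: algebra_simps)
    also have "(?s \<oplus>\<^bsub>Y\<^esub> ksign Y (n * p + p) (lact Y b (diff Y (f x)))) \<ominus>\<^bsub>Y\<^esub>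
        (?s \<oplus>\<^bsub>Y\<^esub> ksign Y (n * p + p + n) (lact Y b (f (diff X x)))) =
      ksign Y (n * p + p) (lact Y b (diff Y (f x))) \<ominus>\<^bsub>Y\<^esub> ksign Y (n * p + p + n) (lact Y b (f (diff X x)))"
      by (rule MY.a_minus_cancel_left) (simp_all add: cl MY.ksign_simps)
    also have "\<dots> = ksign Y ((n + 1) * p) (lact Y b (diff H f x))"
      by (simp add: ap[OF x] cl linear_map_minus[OF Y.bimod_module Y.bimod_module Y.lact_right]
          linear_map_ksign[OF Y.bimod_module Y.bimod_module Y.lact_right] MY.ksign_simps MY.ksign_minus algebra_simps)
    finally show ?thesis .
  qed
  show "diff H f (ract X x a) = ract Y (diff H f x) a" if a: "a \<in> carrier A" and x: "x \<in> carrier X" for a x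
  proof (rule linear_map_graded_eq[OF X.bimod_graded Y.bimod_module _ _ _ x])
    have "linear_map K X Y (diff H f)"
      by (rule lin_maps_linear[OF linear_map_closed[OF hom_diff_linear_lin deg_closed[OF f]]])
    then show "linear_map K X Y (\<lambda>x. diff H f (ract X x a))" "linear_map K X Y (\<lambda>x. ract Y (diff H f x) a)"
      using linear_map_comp[OF X.ract_left[OF a]] linear_map_comp[OF _ Y.ract_left[OF a]] by blast+
    fix m x assume x: "x \<in> grade X m"
    note xc = X.bimod_grade_closed[OF x]
    note da = diff_closed[OF A.dg_module a] and dx = dX[OF xc] and fx = fc[OF xc]
    note cl = a da dx fx xc fc[OF dx] dY[OF fx] X.ract_closed Y.ract_closed
    note hr = bimod_hom_deg_ract[OF f]
    (* Again the term that occurs on both sides of the difference. *)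
    let ?s = "ksign Y (m + n) (ract Y (f x) (diff A a))"
    have "diff H f (ract X x a) = (ract Y (diff Y (f x)) a \<oplus>\<^bsub>Y\<^esub> ?s) \<ominus>\<^bsub>Y\<^esub>
        (ksign Y n (ract Y (f (diff X x)) a) \<oplus>\<^bsub>Y\<^esub> ksign Y (n + m) (ract Y (f x) (diff A a)))"
      by (simp add: ap cl hr fk fadd X.ract_diff[OF algB A.dg_module x] Y.ract_diff[OF algB A.dg_module bimod_hom_degD(3)[OF f x]]
          MY.ksign_simps MX.ksign_simps)
    also have "ksign Y (n + m) (ract Y (f x) (diff A a)) = ?s"
      by (simp add: add.commute)
    also have "(ract Y (diff Y (f x)) a \<oplus>\<^bsub>Y\<^esub> ?s) \<ominus>\<^bsub>Y\<^esub> (ksign Y n (ract Y (f (diff X x)) a) \<oplus>\<^bsub>Y\<^esub> ?s) =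
        ract Y (diff Y (f x)) a \<ominus>\<^bsub>Y\<^esub> ksign Y n (ract Y (f (diff X x)) a)"
      by (rule MY.a_minus_cancel_right) (simp_all add: cl MY.ksign_simps)
    also have "\<dots> = ract Y (diff H f x) a"
      by (simp add: ap[OF xc] cl linear_map_minus[OF Y.bimod_module Y.bimod_module Y.ract_left]
          linear_map_ksign[OF Y.bimod_module Y.bimod_module Y.ract_left] MY.ksign_simps)
    finally show "diff H f (ract X x a) = ract Y (diff H f x) a" .
  qed
qed

lemma hom_dg_module: "dg_module K H"
proof -
  interpret MH: module K H by (rule hom_module)
  note gr = hom_graded
  have g: "grade H n = Deg n" for n by (simp add: bimod_hom_simps(5))
  have cl: "diff H f \<in> carrier H" if "f \<in> carrier H" for f
    using that
  proof (induction rule: graded_induct[OF gr, consumes 1, case_names zero add grade])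
    case zero
    have "diff H \<zero>\<^bsub>H\<^esub> = \<zero>\<^bsub>lin_maps K X Y\<^esub>"
      by (rule linear_map_zero[OF MH.module_axioms lin_maps_module[OF X.bimod_module Y.bimod_module] hom_diff_linear_lin])
    then show ?case using submodule_zero[OF hom_carrier_submodule] by simp
  next
    case (add f f')
    then show ?case
      using linear_map_add[OF hom_diff_linear_lin add(1,2)] submodule_add[OF hom_carrier_submodule] by simp
  next
    case (grade n f)
    then show ?case using deg_closed[OF hom_diff_deg] by (simp add: g)
  qed
  have lin: "linear_map K H H (diff H)" by (rule hom_into[OF hom_diff_linear_lin cl])
  have "diff H (diff H f) = \<zero>\<^bsub>H\<^esub>" if f: "f \<in> carrier H" for f
  proof (rule linear_map_graded_eq[OF gr MH.module_axioms linear_map_comp[OF lin lin] linear_map_zero_fun[OF MH.module_axioms] _ f])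
    fix n f assume "f \<in> grade H n"
    then have f: "f \<in> Deg n" by (simp add: g)
    note fc = deg_closed[OF f]
    show "diff H (diff H f) = \<zero>\<^bsub>H\<^esub>"
    proof (rule hom_eqI)
      show "diff H (diff H f) \<in> carrier H" by (intro cl fc)
      show "\<zero>\<^bsub>H\<^esub> \<in> carrier H" by simp
      fix p x assume "x \<in> grade X p"
      then have x: "x \<in> carrier X" by (rule X.bimod_grade_closed)
      note dx = diff_closed[OF X.dg_module x]
      note f1 = hom_apply_closed[OF fc x] and f2 = hom_apply_closed[OF fc dx]
      note d1 = diff_closed[OF Y.dg_module f1] and d2 = diff_closed[OF Y.dg_module f2]
      note dlin = diff_linear[OF Y.dg_module]
      have "diff H (diff H f) x = diff Y (diff H f x) \<ominus>\<^bsub>Y\<^esub> ksign Y (n + 1) (diff H f (diff X x))"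
        by (rule hom_diff_apply[OF hom_diff_deg[OF f] x])
      also have "diff Y (diff H f x) = \<ominus>\<^bsub>Y\<^esub> ksign Y n (diff Y (f (diff X x)))"
        using f1 f2 d1 d2
        by (simp add: hom_diff_apply[OF f x] linear_map_minus[OF Y.bimod_module Y.bimod_module dlin] MY.ksign_simps
            linear_map_ksign[OF Y.bimod_module Y.bimod_module dlin] diff_diff[OF Y.dg_module])
          (simp add: a_minus_def MY.ksign_closed)
      also have "diff H f (diff X x) = diff Y (f (diff X x))"
        using d2 linear_map_zero[OF X.bimod_module Y.bimod_module hom_linear[OF fc]]
        by (simp add: hom_diff_apply[OF f dx] diff_diff[OF X.dg_module x] MY.ksign_zero a_minus_def)
      also have "(\<ominus>\<^bsub>Y\<^esub> ksign Y n (diff Y (f (diff X x)))) \<ominus>\<^bsub>Y\<^esub> ksign Y (n + 1) (diff Y (f (diff X x))) = \<zero>\<^bsub>Y\<^esub>"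
        using d2 by (simp add: ksign_def a_minus_def MY.l_neg MY.r_neg)
      finally show "diff H (diff H f) x = \<zero>\<^bsub>H\<^esub> x"
        using x by (simp add: bimod_hom_simps(3) lin_maps_simps(2))
    qed
  qed
  then show ?thesis
    unfolding dg_module_def using gr lin hom_diff_deg by (auto simp: g)
qed

end

context
  fixes K :: "'k ring" and A :: "('k, 'a) dgmod" and I\<^sub>A :: "'i set" and e\<^sub>A :: "'i \<Rightarrow> 'a"
    and B :: "('k, 'b) dgmod" and I\<^sub>B :: "'j set" and e\<^sub>B :: "'j \<Rightarrow> 'b"
  assumes algA: "dg_algebra_idem K A I\<^sub>A e\<^sub>A" and algB: "dg_algebra_idem K B I\<^sub>B e\<^sub>B"
begin

interpretation A: dg_algebra_idem K A I\<^sub>A e\<^sub>A by (rule algA)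
interpretation B: dg_algebra_idem K B I\<^sub>B e\<^sub>B by (rule algB)

subsection \<open>Composition\<close>

context
  fixes X :: "('k, 'b, 'a, 'x) dgbimod" and Y :: "('k, 'b, 'a, 'y) dgbimod" and Z :: "('k, 'b, 'a, 'z) dgbimod"
  assumes bX: "dg_bimodule K B A X" and bY: "dg_bimodule K B A Y" and bZ: "dg_bimodule K B A Z"
begin

interpretation X: dg_bimodule K B A X by (rule bX)
interpretation Y: dg_bimodule K B A Y by (rule bY)
interpretation Z: dg_bimodule K B A Z by (rule bZ)
interpretation MZ: module K Z by (rule Z.bimod_module)

private abbreviation (input) "HXY \<equiv> bimod_hom K B A X Y"
private abbreviation (input) "HYZ \<equiv> bimod_hom K B A Y Z"
private abbreviation (input) "HXZ \<equiv> bimod_hom K B A X Z"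
private abbreviation (input) "DXY \<equiv> bimod_hom_deg K B A X Y"
private abbreviation (input) "DYZ \<equiv> bimod_hom_deg K B A Y Z"
private abbreviation (input) "DXZ \<equiv> bimod_hom_deg K B A X Z"

private lemmas aXY = algA algB bX bY and aYZ = algA algB bY bZ and aXZ = algA algB bX bZ
private lemmas dgXY = hom_dg_module[OF aXY] and dgYZ = hom_dg_module[OF aYZ] and dgXZ = hom_dg_module[OF aXZ]

lemma compose_deg:
  assumes g: "g \<in> DYZ m" and f: "f \<in> DXY n"
  shows "compose (carrier X) g f \<in> DXZ (m + n)"
proof (rule bimod_hom_degI[OF aXZ])
  note fc = linear_map_closed[OF bimod_hom_degD(2)[OF f]] and gc = linear_map_closed[OF bimod_hom_degD(2)[OF g]]
  show "compose (carrier X) g f \<in> carrier (lin_maps K X Z)"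
    unfolding compose_def
    by (intro lin_maps_restrict X.bimod_module Z.bimod_module linear_map_comp[OF bimod_hom_degD(2)[OF f] bimod_hom_degD(2)[OF g]])
  show "compose (carrier X) g f x \<in> grade Z (p + (m + n))" if "x \<in> grade X p" for x p
    using bimod_hom_degD(3)[OF g bimod_hom_degD(3)[OF f that]] X.bimod_grade_closed[OF that]
    by (simp add: compose_eq algebra_simps)
  show "compose (carrier X) g f (lact X b x) = ksign Z ((m + n) * p) (lact Z b (compose (carrier X) g f x))"
    if b: "b \<in> grade B p" and x: "x \<in> carrier X" for p b x
  proof -
    note bc = B.algebra_grade_closed[OF b]
    have "compose (carrier X) g f (lact X b x) = ksign Z (n * p) (ksign Z (m * p) (lact Z b (g (f x))))"
      using linear_map_ksign[OF Y.bimod_module Z.bimod_module bimod_hom_degD(2)[OF g] Y.lact_closed[OF bc fc[OF x]]]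
      by (simp add: compose_eq X.lact_closed bc x bimod_hom_deg_lact[OF aXY f b x] bimod_hom_deg_lact[OF aYZ g b fc[OF x]])
    then show ?thesis
      using Z.lact_closed[OF bc gc[OF fc[OF x]]] by (simp add: MZ.ksign_simps compose_eq x algebra_simps)
  qed
  show "compose (carrier X) g f (ract X x a) = ract Z (compose (carrier X) g f x) a"
    if a: "a \<in> carrier A" and x: "x \<in> carrier X" for a x
    by (simp add: compose_eq X.ract_closed a x bimod_hom_deg_ract[OF aXY f a x] bimod_hom_deg_ract[OF aYZ g a fc[OF x]])
qed

lemma compose_bilinear_lin:
  "bilinear_map K HYZ HXY (lin_maps K X Z) (compose (carrier X))"
proof -
  have mem: "compose (carrier X) g f \<in> carrier (lin_maps K X Z)"
    if "g \<in> carrier HYZ" "f \<in> carrier HXY" for g f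
    unfolding compose_def
    by (intro lin_maps_restrict X.bimod_module Z.bimod_module linear_map_comp[OF hom_linear[OF aXY that(2)] hom_linear[OF aYZ that(1)]])
  show ?thesis
  proof (rule bilinear_mapI)
    fix g assume g: "g \<in> carrier HYZ"
    show "linear_map K HXY (lin_maps K X Z) (compose (carrier X) g)"
      by (rule linear_map_into_lin_maps[OF X.bimod_module Z.bimod_module hom_module[OF aXY] mem[OF g]])
        (simp_all add: compose_eq linear_map_comp[OF hom_ev[OF aXY] hom_linear[OF aYZ g]])
  next
    fix f assume f: "f \<in> carrier HXY"
    show "linear_map K HYZ (lin_maps K X Z) (\<lambda>g. compose (carrier X) g f)"
      by (rule linear_map_into_lin_maps[OF X.bimod_module Z.bimod_module hom_module[OF aYZ] mem[OF _ f]])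
        (simp_all add: compose_eq hom_ev[OF aYZ] hom_apply_closed[OF aXY f])
  qed
qed

lemma compose_closed:
  assumes g: "g \<in> carrier HYZ" and f: "f \<in> carrier HXY"
  shows "compose (carrier X) g f \<in> carrier HXZ"
proof -
  note L = lin_maps_module[OF X.bimod_module Z.bimod_module]
  note sub = hom_carrier_submodule[OF aXZ]
  note mYZ = hom_module[OF aYZ] and mXY = hom_module[OF aXY]
  have 1: "compose (carrier X) g f \<in> carrier HXZ"
    if g: "g \<in> DYZ m" and f: "f \<in> carrier HXY" for g f m
    using f
  proof (induction rule: graded_induct[OF hom_graded[OF aXY], consumes 1, case_names zero add grade])
    note lin = bilinear_map_right[OF compose_bilinear_lin deg_closed[OF aYZ g]]
    {
      case zero
      then show ?case using linear_map_zero[OF mXY L lin] submodule_zero[OF sub] by simp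
    next
      case (add f f')
      then show ?case using linear_map_add[OF lin] submodule_add[OF sub] by simp
    next
      case (grade n f)
      then show ?case using deg_closed[OF aXZ compose_deg[OF g]] by (simp add: bimod_hom_simps(5))
    }
  qed
  note lin = bilinear_map_left[OF compose_bilinear_lin f]
  from g show ?thesis
  proof (induction rule: graded_induct[OF hom_graded[OF aYZ], consumes 1, case_names zero add grade])
    case zero
    then show ?case using linear_map_zero[OF mYZ L lin] submodule_zero[OF sub] by simp
  next
    case (add g g')
    then show ?case using linear_map_add[OF lin] submodule_add[OF sub] by simp
  next
    case (grade n g)
    then show ?case using 1 f by (simp add: bimod_hom_simps(5))
  qed
qed

lemma compose_bilinear:
  "bilinear_map K HYZ HXY HXZ (compose (carrier X))"
  by (intro bilinear_mapI hom_into[OF aXZ] bilinear_map_right[OF compose_bilinear_lin]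
      bilinear_map_left[OF compose_bilinear_lin] compose_closed)

text \<open>
  The terms \<open>g (d (f x))\<close> of the two summands on the right cancel.
\<close>

lemma compose_diff:
  assumes g: "g \<in> DYZ m" and f: "f \<in> carrier HXY"
  shows "diff HXZ (compose (carrier X) g f) =
    compose (carrier X) (diff HYZ g) f \<oplus>\<^bsub>HXZ\<^esub>
    ksign HXZ m (compose (carrier X) g (diff HXY f))"
proof -
  note gc = deg_closed[OF aYZ g]
  note mXZ = hom_module[OF aXZ]
  interpret XZ: module K HXZ by (rule mXZ)
  note right = bilinear_map_right[OF compose_bilinear]
  show ?thesis
  proof (rule linear_map_graded_eq[OF hom_graded[OF aXY] mXZ
        linear_map_comp[OF right[OF gc] diff_linear[OF dgXZ]]
        linear_map_plus_fun[OF mXZ right[OF diff_closed[OF dgYZ gc]]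
          linear_map_ksign_fun[OF mXZ linear_map_comp[OF diff_linear[OF dgXY] right[OF gc]]]] _ f])
    fix n f assume "f \<in> grade HXY n"
    then have f: "f \<in> DXY n" by (simp add: bimod_hom_simps(5))
    note fc = deg_closed[OF aXY f]
    note dg = diff_closed[OF dgYZ gc] and df = diff_closed[OF dgXY fc]
    note c1 = compose_closed[OF dg fc] and c2 = compose_closed[OF gc df]
    show "diff HXZ (compose (carrier X) g f) =
      compose (carrier X) (diff HYZ g) f \<oplus>\<^bsub>HXZ\<^esub> ksign HXZ m (compose (carrier X) g (diff HXY f))"
    proof (rule hom_eqI[OF aXZ])
      show "diff HXZ (compose (carrier X) g f) \<in> carrier HXZ"
        by (intro diff_closed[OF dgXZ] compose_closed gc fc)
      show "compose (carrier X) (diff HYZ g) f \<oplus>\<^bsub>HXZ\<^esub> ksign HXZ m (compose (carrier X) g (diff HXY f)) \<in> carrier HXZ"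
        using c1 c2 by (simp add: XZ.ksign_closed)
      fix p x assume "x \<in> grade X p"
      then have x: "x \<in> carrier X" by (rule X.bimod_grade_closed)
      note dx = diff_closed[OF X.dg_module x]
      note fx = hom_apply_closed[OF aXY fc x] and fdx = hom_apply_closed[OF aXY fc dx]
      note dfx = diff_closed[OF Y.dg_module fx]
      note gfx = hom_apply_closed[OF aYZ gc fx] and gfdx = hom_apply_closed[OF aYZ gc fdx]
        and gdfx = hom_apply_closed[OF aYZ gc dfx]
      note dgfx = diff_closed[OF Z.dg_module gfx]
      interpret MY: module K Y by (rule Y.bimod_module)
      have L: "diff HXZ (compose (carrier X) g f) x = diff Z (g (f x)) \<ominus>\<^bsub>Z\<^esub> ksign Z (m + n) (g (f (diff X x)))"
        by (simp add: hom_diff_apply[OF aXZ compose_deg[OF g f] x] compose_eq x dx)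
      have R1: "compose (carrier X) (diff HYZ g) f x = diff Z (g (f x)) \<ominus>\<^bsub>Z\<^esub> ksign Z m (g (diff Y (f x)))"
        by (simp add: compose_eq x hom_diff_apply[OF aYZ g fx])
      have R2: "ksign HXZ m (compose (carrier X) g (diff HXY f)) x =
          ksign Z m (g (diff Y (f x))) \<ominus>\<^bsub>Z\<^esub> ksign Z (m + n) (g (f (diff X x)))"
        using x by (simp add: hom_ksign[OF aXZ c2] compose_eq hom_diff_apply[OF aXY f x] fdx dfx gfdx gdfx
            linear_map_minus[OF Y.bimod_module Z.bimod_module hom_linear[OF aYZ gc]] MY.ksign_simps
            linear_map_ksign[OF Y.bimod_module Z.bimod_module hom_linear[OF aYZ gc]] MZ.ksign_minus MZ.ksign_simps)
      have R: "(compose (carrier X) (diff HYZ g) f \<oplus>\<^bsub>HXZ\<^esub> ksign HXZ m (compose (carrier X) g (diff HXY f))) x =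
          compose (carrier X) (diff HYZ g) f x \<oplus>\<^bsub>Z\<^esub> ksign HXZ m (compose (carrier X) g (diff HXY f)) x"
        using linear_map_add[OF hom_ev[OF aXZ x] c1 XZ.ksign_closed[OF c2]] .
      show "diff HXZ (compose (carrier X) g f) x =
        (compose (carrier X) (diff HYZ g) f \<oplus>\<^bsub>HXZ\<^esub> ksign HXZ m (compose (carrier X) g (diff HXY f))) x"
        unfolding L R R1 R2
        by (rule MZ.a_minus_telescope[symmetric]) (simp_all add: dgfx gdfx gfdx MZ.ksign_closed)
    qed
  qed
qed

end

lemma identity_deg:
  assumes "dg_bimodule K B A X"
  shows "(\<lambda>x\<in>carrier X. x) \<in> bimod_hom_deg K B A X X 0"
proof -
  interpret X: dg_bimodule K B A X by fact
  show ?thesis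
    by (rule bimod_hom_degI[OF algA algB assms assms])
      (auto intro!: lin_maps_restrict X.bimod_module linear_map_id
        simp: X.bimod_grade_closed X.lact_closed X.ract_closed B.algebra_grade_closed ksign_def)
qed

theorem dg_category_Dg_bimod: "dg_category K (Dg_bimod K B A)"
proof
  note D = Dg_bimod_def
  fix X Y :: "('k, 'b, 'a, 'x) dgbimod"
  assume "X \<in> Obj (Dg_bimod K B A)" "Y \<in> Obj (Dg_bimod K B A)"
  then have X: "dg_bimodule K B A X" and Y: "dg_bimodule K B A Y" by (simp_all add: D)
  show "dg_module K (Hom (Dg_bimod K B A) X Y)" using hom_dg_module[OF algA algB X Y] by (simp add: D)
  fix f assume f: "f \<in> carrier (Hom (Dg_bimod K B A) X Y)"
  then have fc: "f \<in> carrier (bimod_hom K B A X Y)" by (simp add: D)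
  note id = deg_closed[OF algA algB X X identity_deg[OF X]] deg_closed[OF algA algB Y Y identity_deg[OF Y]]
  show "Cmp (Dg_bimod K B A) X Y Y (Idn (Dg_bimod K B A) Y) f = f"
    unfolding D dgcat.simps
    by (rule hom_eqI[OF algA algB X Y compose_closed[OF X Y Y id(2) fc] fc])
      (use hom_apply_closed[OF algA algB X Y fc] dg_bimodule.bimod_grade_closed[OF X] in \<open>auto simp: compose_def\<close>)
  show "Cmp (Dg_bimod K B A) X X Y f (Idn (Dg_bimod K B A) X) = f"
    unfolding D dgcat.simps
    by (rule hom_eqI[OF algA algB X Y compose_closed[OF X X Y fc id(1)] fc])
      (use dg_bimodule.bimod_grade_closed[OF X] in \<open>auto simp: compose_def\<close>)
next
  note D = Dg_bimod_def
  fix X :: "('k, 'b, 'a, 'x) dgbimod"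
  assume "X \<in> Obj (Dg_bimod K B A)"
  then have X: "dg_bimodule K B A X" by (simp add: D)
  show "Idn (Dg_bimod K B A) X \<in> carrier (Hom (Dg_bimod K B A) X X)"
    using deg_closed[OF algA algB X X identity_deg[OF X]] by (simp add: D)
next
  note D = Dg_bimod_def
  fix X Y Z :: "('k, 'b, 'a, 'x) dgbimod"
  assume "X \<in> Obj (Dg_bimod K B A)" "Y \<in> Obj (Dg_bimod K B A)" "Z \<in> Obj (Dg_bimod K B A)"
  then have X: "dg_bimodule K B A X" and Y: "dg_bimodule K B A Y" and Z: "dg_bimodule K B A Z" by (simp_all add: D)
  show "bilinear_map K (Hom (Dg_bimod K B A) Y Z) (Hom (Dg_bimod K B A) X Y) (Hom (Dg_bimod K B A) X Z)
      (Cmp (Dg_bimod K B A) X Y Z)"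
    using compose_bilinear[OF X Y Z] by (simp add: D)
  fix g f m
  assume g: "g \<in> grade (Hom (Dg_bimod K B A) Y Z) m"
  show "f \<in> grade (Hom (Dg_bimod K B A) X Y) n \<Longrightarrow>
      Cmp (Dg_bimod K B A) X Y Z g f \<in> grade (Hom (Dg_bimod K B A) X Z) (m + n)" for n
    using g compose_deg[OF X Y Z] by (simp add: D bimod_hom_simps(5))
  show "f \<in> carrier (Hom (Dg_bimod K B A) X Y) \<Longrightarrow>
      diff (Hom (Dg_bimod K B A) X Z) (Cmp (Dg_bimod K B A) X Y Z g f) =
      Cmp (Dg_bimod K B A) X Y Z (diff (Hom (Dg_bimod K B A) Y Z) g) f \<oplus>\<^bsub>Hom (Dg_bimod K B A) X Z\<^esub>
      ksign (Hom (Dg_bimod K B A) X Z) m (Cmp (Dg_bimod K B A) X Y Z g (diff (Hom (Dg_bimod K B A) X Y) f))"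
    using g compose_diff[OF X Y Z] by (simp add: D bimod_hom_simps(5))
next
  note D = Dg_bimod_def
  fix W X Y Z :: "('k, 'b, 'a, 'x) dgbimod" and f g h
  assume "W \<in> Obj (Dg_bimod K B A)" "X \<in> Obj (Dg_bimod K B A)"
    and "f \<in> carrier (Hom (Dg_bimod K B A) W X)"
  then have "f \<in> carrier W \<rightarrow> carrier X"
    using hom_apply_closed[OF algA algB] by (auto simp: D)
  then show "Cmp (Dg_bimod K B A) W Y Z h (Cmp (Dg_bimod K B A) W X Y g f) =
      Cmp (Dg_bimod K B A) W X Z (Cmp (Dg_bimod K B A) X Y Z h g) f"
    by (simp add: D compose_assoc)
qed

end

section \<open>The tensor product over a dg algebra\<close>

lemma linear_map_graded_into:
  assumes "graded_module K M" "module K P" "linear_map K M P f" "submodule H K P"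
    and "\<And>n x. x \<in> grade M n \<Longrightarrow> f x \<in> H" "x \<in> carrier M"
  shows "f x \<in> H"
  by (rule linear_map_span_into[OF graded_module_module[OF assms(1)] assms(2-4), of "\<Union>n. grade M n"])
    (use assms(5,6) grade_closed[OF assms(1)] in \<open>auto simp: span_grades[OF assms(1)]\<close>)

lemma tensor_over_simps:
  "carrier (tensor_over K B U X) = carrier (quot_mod (dg_tensor K U X) (balancing K B U X))"
  "same_module (quot_mod (dg_tensor K U X) (balancing K B U X)) (tensor_over K B U X)"
  "grade (tensor_over K B U X) n = (\<lambda>z. balancing K B U X +>\<^bsub>dg_tensor K U X\<^esub> z) ` grade (dg_tensor K U X) n"
  "diff (tensor_over K B U X) = quot_map (dg_tensor K U X) (balancing K B U X) (diff (dg_tensor K U X))"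
  "lact (tensor_over K B U X) c = quot_map (dg_tensor K U X) (balancing K B U X)
      (tensor_lift K (dg_tensor K U X) (\<lambda>u x. tens K U X (lact U c u) x))"
  "ract (tensor_over K B U X) w a = quot_map (dg_tensor K U X) (balancing K B U X)
      (tensor_lift K (dg_tensor K U X) (\<lambda>u x. tens K U X u (ract X x a))) w"
  by (simp_all add: tensor_over_def Let_def same_module_def)

text \<open>
  The linear map out of \<open>U \<otimes>\<^sub>B X\<close> induced by a balanced bilinear map \<open>b\<close>: elements are cosets of
  tensors, and the map on tensors is constant on each coset.
\<close>

definition over_lift ::
  "'k ring \<Rightarrow> ('k, 'p, 't) module_scheme \<Rightarrow> ('u \<Rightarrow> 'x \<Rightarrow> 'p) \<Rightarrow> ('u \<times> 'x \<Rightarrow> 'k) set set \<Rightarrow> 'p" where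
  "over_lift K P b w = the_elem (tensor_lift K P b ` w)"

context
  fixes K :: "'k ring" and A :: "('k, 'a) dgmod" and I\<^sub>A :: "'i set" and e\<^sub>A :: "'i \<Rightarrow> 'a"
    and B :: "('k, 'b) dgmod" and I\<^sub>B :: "'j set" and e\<^sub>B :: "'j \<Rightarrow> 'b"
    and C :: "('k, 'c) dgmod" and I\<^sub>C :: "'l set" and e\<^sub>C :: "'l \<Rightarrow> 'c"
    and U :: "('k, 'c, 'b, 'u) dgbimod" and X :: "('k, 'b, 'a, 'x) dgbimod"
  assumes algA: "dg_algebra_idem K A I\<^sub>A e\<^sub>A" and algB: "dg_algebra_idem K B I\<^sub>B e\<^sub>B"
    and algC: "dg_algebra_idem K C I\<^sub>C e\<^sub>C"
    and bimU: "dg_bimodule K C B U" and bimX: "dg_bimodule K B A X"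
begin

interpretation A: dg_algebra_idem K A I\<^sub>A e\<^sub>A by (rule algA)
interpretation B: dg_algebra_idem K B I\<^sub>B e\<^sub>B by (rule algB)
interpretation C: dg_algebra_idem K C I\<^sub>C e\<^sub>C by (rule algC)
interpretation U: dg_bimodule K C B U by (rule bimU)
interpretation X: dg_bimodule K B A X by (rule bimX)

private abbreviation (input) "TK \<equiv> dg_tensor K U X"
private abbreviation (input) "tk \<equiv> tens K U X"
private abbreviation (input) "N \<equiv> balancing K B U X"
private abbreviation (input) "W \<equiv> tensor_over K B U X"
private abbreviation (input) "to \<equiv> tens_over K B U X"
private abbreviation (input) "proj z \<equiv> balancing K B U X +>\<^bsub>dg_tensor K U X\<^esub> z"

private lemmas UX = U.dg_module X.dg_module
private lemmas T_dg = dg_tensor_dg_module[OF UX]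
private lemmas T_module = dg_tensor_module[OF UX]
private lemmas T_graded = dg_module_graded[OF T_dg]

interpretation MT: module K TK by (rule T_module)

lemma balancing_generators:
  "{tk (ract U u b) x \<ominus>\<^bsub>TK\<^esub> tk u (lact X b x) |u b x. u \<in> carrier U \<and> b \<in> carrier B \<and> x \<in> carrier X} \<subseteq> carrier TK"
  by (auto intro!: MT.M.minus_closed dg_tens_closed[OF UX] U.ract_closed X.lact_closed)

lemma balancing_submodule: "submodule N K TK"
  unfolding balancing_def Let_def by (rule span_mod_submodule[OF T_module balancing_generators])

private lemmas W_same = tensor_over_simps(2)[of K U X B]
lemmas W_module = same_module_module[OF W_same quot_module[OF T_module balancing_submodule]]

interpretation MW: module K W by (rule W_module)

lemma over_carrier: "carrier W = (\<lambda>z. proj z) ` carrier TK"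
  unfolding tensor_over_simps(1) by (rule quot_carrier[OF T_module balancing_submodule])

lemma over_proj_linear: "linear_map K TK W (\<lambda>z. proj z)"
  using quot_proj_linear[OF T_module balancing_submodule] by (simp add: same_module_simps(2)[OF W_same])

lemma over_tens_def: "to u x = proj (tk u x)"
  by (simp add: tens_over_def)

lemma over_tens_bilinear: "bilinear_map K U X W to"
  unfolding over_tens_def
  by (intro bilinear_mapI linear_map_comp[OF dg_tens_left[OF UX] over_proj_linear]
      linear_map_comp[OF dg_tens_right[OF UX] over_proj_linear])

lemmas over_tens_left = bilinear_map_left[OF over_tens_bilinear]
lemmas over_tens_right = bilinear_map_right[OF over_tens_bilinear]
lemmas over_tens_closed = bilinear_map_closed[OF over_tens_bilinear]

lemma over_proj_eq_zero:
  assumes z: "z \<in> carrier TK"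
  shows "proj z = \<zero>\<^bsub>W\<^esub> \<longleftrightarrow> z \<in> N"
proof -
  have "\<zero>\<^bsub>W\<^esub> = proj \<zero>\<^bsub>TK\<^esub>" using linear_map_zero[OF T_module W_module over_proj_linear] by simp
  then show ?thesis
    using quot_coset_eq[OF T_module balancing_submodule z MT.M.zero_closed] z
      MT.M.minus_equality[of "\<zero>\<^bsub>TK\<^esub>" "\<zero>\<^bsub>TK\<^esub>"]
    by (simp add: a_minus_def)
qed

lemma over_tens_balanced:
  assumes u: "u \<in> carrier U" and b: "b \<in> carrier B" and x: "x \<in> carrier X"
  shows "to (ract U u b) x = to u (lact X b x)"
  unfolding over_tens_def
proof (rule quot_coset_eq[OF T_module balancing_submodule, THEN iffD2])
  show "tk (ract U u b) x \<in> carrier TK" "tk u (lact X b x) \<in> carrier TK"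
    using u b x by (auto intro!: dg_tens_closed[OF UX] U.ract_closed X.lact_closed)
  show "tk (ract U u b) x \<ominus>\<^bsub>TK\<^esub> tk u (lact X b x) \<in> N"
    unfolding balancing_def Let_def using u b x by (intro span_mod_base) blast
qed

lemma over_induct [consumes -3, case_names zero add tens]:
  assumes "w \<in> carrier W" and "P \<zero>\<^bsub>W\<^esub>"
    and "\<And>x y. x \<in> carrier W \<Longrightarrow> y \<in> carrier W \<Longrightarrow> P x \<Longrightarrow> P y \<Longrightarrow> P (x \<oplus>\<^bsub>W\<^esub> y)"
    and "\<And>p q u x. u \<in> grade U p \<Longrightarrow> x \<in> grade X q \<Longrightarrow> P (to u x)"
  shows "P w"
proof -
  obtain z where z: "z \<in> carrier TK" "w = proj z" using assms(1) unfolding over_carrier by blast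
  have "P (proj z)"
    using z(1)
  proof (induction rule: dg_tensor_induct[OF UX, consumes 1, case_names zero add tens])
    case zero
    then show ?case using assms(2) linear_map_zero[OF T_module W_module over_proj_linear] by simp
  next
    case (add y z)
    then show ?case
      using assms(3) by (simp add: linear_map_add[OF over_proj_linear] linear_map_closed[OF over_proj_linear])
  next
    case (tens p q u x)
    then show ?case using assms(4) by (simp add: over_tens_def)
  qed
  then show ?thesis using z by simp
qed

lemma over_eqI:
  assumes "module K P" "linear_map K W P f" "linear_map K W P g"
    and "\<And>p q u x. u \<in> grade U p \<Longrightarrow> x \<in> grade X q \<Longrightarrow> f (to u x) = g (to u x)"
    and "w \<in> carrier W"
  shows "f w = g w"
  using assms(5)
  by (induction rule: over_induct)
    (use assms W_module in \<open>simp_all add: linear_map_zero linear_map_add\<close>)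

lemma over_grade_eq:
  assumes "module K P" "linear_map K W P f" "linear_map K W P g"
    and "\<And>p q u x. p + q = n \<Longrightarrow> u \<in> grade U p \<Longrightarrow> x \<in> grade X q \<Longrightarrow> f (to u x) = g (to u x)"
    and "w \<in> grade W n"
  shows "f w = g w"
proof -
  obtain z where z: "z \<in> grade TK n" "w = proj z" using assms(5) by (auto simp: tensor_over_simps(3))
  have "f (proj z) = g (proj z)"
    by (rule dg_tensor_grade_eq[OF UX assms(1) linear_map_comp[OF over_proj_linear assms(2)]
          linear_map_comp[OF over_proj_linear assms(3)] _ z(1)])
      (use assms(4) in \<open>simp add: over_tens_def\<close>)
  then show ?thesis using z by simp
qed

lemma over_grade_into:
  assumes "module K P" "linear_map K W P f" "submodule H K P"
    and "\<And>p q u x. p + q = n \<Longrightarrow> u \<in> grade U p \<Longrightarrow> x \<in> grade X q \<Longrightarrow> f (to u x) \<in> H"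
    and "w \<in> grade W n"
  shows "f w \<in> H"
proof -
  obtain z where z: "z \<in> grade TK n" "w = proj z" using assms(5) by (auto simp: tensor_over_simps(3))
  have "f (proj z) \<in> H"
    by (rule dg_tensor_grade_into[OF UX assms(1) linear_map_comp[OF over_proj_linear assms(2)] assms(3) _ z(1)])
      (use assms(4) in \<open>simp add: over_tens_def\<close>)
  then show ?thesis using z by simp
qed

lemma over_tens_grade: "u \<in> grade U p \<Longrightarrow> x \<in> grade X q \<Longrightarrow> to u x \<in> grade W (p + q)"
  unfolding tensor_over_simps(3) over_tens_def by (intro imageI dg_tens_grade[OF UX])

text \<open>The relation is trilinear, so a linear map that respects it on homogeneous elements respects it.\<close>

lemma balancing_into:
  assumes P: "module K P" and f: "linear_map K TK P f" and H: "submodule H K P"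
    and h: "\<And>p q r u b x. u \<in> grade U p \<Longrightarrow> b \<in> grade B q \<Longrightarrow> x \<in> grade X r \<Longrightarrow>
      f (tk (ract U u b) x \<ominus>\<^bsub>TK\<^esub> tk u (lact X b x)) \<in> H"
    and z: "z \<in> N"
  shows "f z \<in> H"
proof (rule linear_map_span_into[OF T_module P f H balancing_generators _ z[unfolded balancing_def Let_def]])
  fix s assume "s \<in> {tk (ract U u b) x \<ominus>\<^bsub>TK\<^esub> tk u (lact X b x) |u b x. u \<in> carrier U \<and> b \<in> carrier B \<and> x \<in> carrier X}"
  then obtain u b x where s: "s = tk (ract U u b) x \<ominus>\<^bsub>TK\<^esub> tk u (lact X b x)"
    and u: "u \<in> carrier U" and b: "b \<in> carrier B" and x: "x \<in> carrier X" by auto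
  let ?D = "\<lambda>u b x. f (tk (ract U u b) x \<ominus>\<^bsub>TK\<^esub> tk u (lact X b x))"
  have 1: "linear_map K U P (\<lambda>u. ?D u b x)" if "b \<in> carrier B" "x \<in> carrier X" for b x
    using that
    by (intro linear_map_comp[OF _ f] linear_map_minus_fun T_module
        linear_map_comp[OF U.ract_left dg_tens_left[OF UX]] dg_tens_left[OF UX] X.lact_closed)
  have 2: "linear_map K B P (\<lambda>b. ?D u b x)" if "u \<in> carrier U" "x \<in> carrier X" for u x
    using that
    by (intro linear_map_comp[OF _ f] linear_map_minus_fun T_module
        linear_map_comp[OF U.ract_right dg_tens_left[OF UX]] linear_map_comp[OF X.lact_left dg_tens_right[OF UX]])
  have 3: "linear_map K X P (\<lambda>x. ?D u b x)" if "u \<in> carrier U" "b \<in> carrier B" for u b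
    using that
    by (intro linear_map_comp[OF _ f] linear_map_minus_fun T_module dg_tens_right[OF UX] U.ract_closed
        linear_map_comp[OF X.lact_right dg_tens_right[OF UX]])
  have "?D u b x \<in> H"
  proof (rule linear_map_graded_into[OF U.bimod_graded P 1[OF b x] H _ u])
    fix p u assume u: "u \<in> grade U p"
    note uc = U.bimod_grade_closed[OF u]
    show "?D u b x \<in> H"
    proof (rule linear_map_graded_into[OF B.algebra_graded P 2[OF uc x] H _ b])
      fix q b assume b: "b \<in> grade B q"
      show "?D u b x \<in> H"
        by (rule linear_map_graded_into[OF X.bimod_graded P 3[OF uc B.algebra_grade_closed[OF b]] H h[OF u b] x])
    qed
  qed
  then show "f s \<in> H" by (simp add: s)
qed

lemma balancing_killed:
  assumes P: "module K P" and f: "linear_map K TK P f"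
    and h: "\<And>p q r u b x. u \<in> grade U p \<Longrightarrow> b \<in> grade B q \<Longrightarrow> x \<in> grade X r \<Longrightarrow>
      f (tk (ract U u b) x) = f (tk u (lact X b x))"
    and z: "z \<in> N"
  shows "f z = \<zero>\<^bsub>P\<^esub>"
proof -
  interpret P: module K P by (rule P)
  have sub: "submodule {\<zero>\<^bsub>P\<^esub>} K P" by (rule submodule_if[OF P]) auto
  have "f z \<in> {\<zero>\<^bsub>P\<^esub>}"
  proof (rule balancing_into[OF P f sub _ z])
    fix p q r u b x assume u: "u \<in> grade U p" and b: "b \<in> grade B q" and x: "x \<in> grade X r"
    note c = U.bimod_grade_closed[OF u] B.algebra_grade_closed[OF b] X.bimod_grade_closed[OF x]
    have t: "tk (ract U u b) x \<in> carrier TK" "tk u (lact X b x) \<in> carrier TK"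
      using c by (auto intro!: dg_tens_closed[OF UX] U.ract_closed X.lact_closed)
    show "f (tk (ract U u b) x \<ominus>\<^bsub>TK\<^esub> tk u (lact X b x)) \<in> {\<zero>\<^bsub>P\<^esub>}"
      using linear_map_closed[OF f t(2)]
      by (simp add: linear_map_minus[OF T_module P f t] h[OF u b x] P.minus_eq_zero_iff)
  qed
  then show ?thesis by simp
qed

text \<open>
  It suffices to compare both sides of the relation after projection to the quotient, where the
  relation is an equation that can be used.
\<close>

lemma balancing_preserved:
  assumes h: "linear_map K TK TK h"
    and "\<And>p q r u b x. u \<in> grade U p \<Longrightarrow> b \<in> grade B q \<Longrightarrow> x \<in> grade X r \<Longrightarrow>
      proj (h (tk (ract U u b) x)) = proj (h (tk u (lact X b x)))"
    and z: "z \<in> N"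
  shows "h z \<in> N"
proof -
  have "proj (h z) = \<zero>\<^bsub>W\<^esub>"
    by (rule balancing_killed[OF W_module linear_map_comp[OF h over_proj_linear] assms(2) z])
  then show ?thesis
    using over_proj_eq_zero[OF linear_map_closed[OF h submodule_subset[OF balancing_submodule z]]] by simp
qed

lemma over_quot_map_linear:
  "linear_map K TK TK h \<Longrightarrow> (\<And>z. z \<in> N \<Longrightarrow> h z \<in> N) \<Longrightarrow> linear_map K W W (quot_map TK N h)"
  using quot_map_linear[OF T_module balancing_submodule]
  by (simp add: same_module_simps(1)[OF W_same] same_module_simps(2)[OF W_same])

lemmas over_quot_map_eq = quot_map_eq[OF T_module balancing_submodule]

context
  fixes P :: "('k, 'p, 't) module_scheme" and b :: "'u \<Rightarrow> 'x \<Rightarrow> 'p"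
  assumes P: "module K P" and b: "bilinear_map K U X P b"
    and bal: "\<And>p q r u v x. u \<in> grade U p \<Longrightarrow> v \<in> grade B q \<Longrightarrow> x \<in> grade X r \<Longrightarrow>
      b (ract U u v) x = b u (lact X v x)"
begin

lemma lift_kills_balancing: "z \<in> N \<Longrightarrow> tensor_lift K P b z = \<zero>\<^bsub>P\<^esub>"
proof (rule balancing_killed[OF P dg_tensor_lift_linear[OF UX P b]])
  fix p q r u v x assume h: "u \<in> grade U p" "v \<in> grade B q" "x \<in> grade X r"
  note c = U.bimod_grade_closed[OF h(1)] B.algebra_grade_closed[OF h(2)] X.bimod_grade_closed[OF h(3)]
  show "tensor_lift K P b (tk (ract U u v) x) = tensor_lift K P b (tk u (lact X v x))"
    using c by (simp add: dg_tensor_lift_tens[OF UX P b] U.ract_closed X.lact_closed bal[OF h])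
qed

lemma over_lift_linear: "linear_map K W P (over_lift K P b)"
  using quot_factor_linear[OF T_module balancing_submodule P dg_tensor_lift_linear[OF UX P b] lift_kills_balancing]
  by (simp add: same_module_simps(1)[OF W_same] over_lift_def[abs_def])

lemma over_lift_tens:
  assumes "u \<in> carrier U" "x \<in> carrier X"
  shows "over_lift K P b (to u x) = b u x"
  unfolding over_lift_def over_tens_def
  using quot_factor_eq[OF T_module balancing_submodule P dg_tensor_lift_linear[OF UX P b] lift_kills_balancing
      dg_tens_closed[OF UX assms]] dg_tensor_lift_tens[OF UX P b assms] by simp

end

subsection \<open>The bimodule structure\<close>

text \<open>
  On homogeneous arguments the relation is a difference of elements of equal degree, so the component
  projections of the tensor product preserve it and descend.
\<close>

lemma over_graded: "graded_module K W"
proof (rule graded_moduleI[OF W_module])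
  have lin: "linear_map K TK TK (\<lambda>z. hcomp TK z n)" for n by (rule hcomp_linear[OF T_graded])
  have pres: "hcomp TK z n \<in> N" if z: "z \<in> N" for z n
  proof (rule balancing_into[OF T_module lin balancing_submodule _ z])
    fix p q r u b x assume u: "u \<in> grade U p" and b: "b \<in> grade B q" and x: "x \<in> grade X r"
    note c = U.bimod_grade_closed[OF u] B.algebra_grade_closed[OF b] X.bimod_grade_closed[OF x]
    let ?d = "tk (ract U u b) x \<ominus>\<^bsub>TK\<^esub> tk u (lact X b x)"
    have "tk (ract U u b) x \<in> grade TK (p + q + r)" "tk u (lact X b x) \<in> grade TK (p + (q + r))"
      by (intro dg_tens_grade[OF UX] U.ract_degree X.lact_degree u b x)+
    then have "?d \<in> grade TK (p + q + r)"
      by (intro submodule_minus[OF grade_submodule[OF T_graded]]) (simp_all add: add.assoc)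
    moreover have "?d \<in> N" unfolding balancing_def Let_def using c by (intro span_mod_base) blast
    ultimately show "hcomp TK ?d n \<in> N"
      using submodule_zero[OF balancing_submodule] by (simp add: hcomp_homogeneous[OF T_graded])
  qed
  show "linear_map K W W (quot_map TK N (\<lambda>z. hcomp TK z n))" for n
    by (rule over_quot_map_linear[OF lin pres])
  show "quot_map TK N (\<lambda>z. hcomp TK z n) w = (if m = n then w else \<zero>\<^bsub>W\<^esub>)" if w: "w \<in> grade W m" for m n w
  proof -
    obtain z where z: "z \<in> grade TK m" "w = proj z" using w by (auto simp: tensor_over_simps(3))
    show ?thesis
      using over_quot_map_eq[OF lin pres grade_closed[OF T_graded z(1)]] linear_map_zero[OF T_module W_module over_proj_linear]
      by (simp add: z(2) hcomp_homogeneous[OF T_graded z(1)])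
  qed
  show sub: "submodule (grade W n) K W" for n
    unfolding tensor_over_simps(3) by (rule submodule_image[OF T_module W_module over_proj_linear grade_submodule[OF T_graded]])
  show "carrier W \<subseteq> span_mod K W (\<Union>n. grade W n)"
  proof
    have s: "submodule (span_mod K W (\<Union>n. grade W n)) K W"
      using submodule_subset[OF sub] by (intro span_mod_submodule[OF W_module]) blast
    fix w assume "w \<in> carrier W"
    then show "w \<in> span_mod K W (\<Union>n. grade W n)"
    proof (induction rule: over_induct)
      case (tens p q u x)
      then show ?case using over_tens_grade by (intro span_mod_base) blast
    qed (simp_all add: submodule_zero[OF s] submodule_add[OF s])
  qed
qed

text \<open>
  By the Leibniz rules for the two actions, the differential of the relation for \<open>(u, b, x)\<close> is a signed
  sum of the relations for \<open>(du, b, x)\<close>, \<open>(u, db, x)\<close> and \<open>(u, b, dx)\<close>.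
\<close>

lemma over_diff_preserves: "z \<in> N \<Longrightarrow> diff TK z \<in> N"
proof (rule balancing_preserved[OF diff_linear[OF T_dg]])
  fix p q r u b x assume u: "u \<in> grade U p" and b: "b \<in> grade B q" and x: "x \<in> grade X r"
  interpret MU: module K U by (rule U.bimod_module)
  interpret MX: module K X by (rule X.bimod_module)
  note c = U.bimod_grade_closed[OF u] B.algebra_grade_closed[OF b] X.bimod_grade_closed[OF x]
  note dc = diff_closed[OF U.dg_module c(1)] diff_closed[OF B.dg_module c(2)] diff_closed[OF X.dg_module c(3)]
  note cl = U.ract_closed X.lact_closed c dc MU.ksign_closed MX.ksign_closed
  note pk = linear_map_ksign[OF T_module W_module over_proj_linear]
  note lk = linear_map_ksign[OF U.bimod_module W_module over_tens_left] linear_map_ksign[OF X.bimod_module W_module over_tens_right]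
  have dT: "proj (diff TK (tk v y)) = to (diff U v) y \<oplus>\<^bsub>W\<^esub> ksign W n (to v (diff X y))"
    if "v \<in> grade U n" "y \<in> carrier X" for v y n
  proof -
    have vc: "v \<in> carrier U" by (rule U.bimod_grade_closed[OF that(1)])
    show ?thesis
      using dg_tens_closed[OF UX vc diff_closed[OF X.dg_module that(2)]]
        dg_tens_closed[OF UX diff_closed[OF U.dg_module vc] that(2)]
      by (simp add: dg_tensor_diff_tens[OF UX that] linear_map_add[OF over_proj_linear] MT.ksign_closed pk over_tens_def)
  qed
  have L: "proj (diff TK (tk (ract U u b) x)) = (to (ract U (diff U u) b) x \<oplus>\<^bsub>W\<^esub> ksign W p (to (ract U u (diff B b)) x))
      \<oplus>\<^bsub>W\<^esub> ksign W (p + q) (to (ract U u b) (diff X x))"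
    by (simp add: dT[OF U.ract_degree[OF u b] c(3)] U.ract_diff[OF algC B.dg_module u c(2)] cl
        linear_map_add[OF over_tens_left] lk)
  have R: "proj (diff TK (tk u (lact X b x))) = to (diff U u) (lact X b x) \<oplus>\<^bsub>W\<^esub>
      (ksign W p (to u (lact X (diff B b) x)) \<oplus>\<^bsub>W\<^esub> ksign W (p + q) (to u (lact X b (diff X x))))"
    by (simp add: dT[OF u X.lact_closed[OF c(2,3)]] X.lact_diff[OF algA B.dg_module b c(3)] cl
        linear_map_add[OF over_tens_right] lk over_tens_closed MW.ksign_simps)
  show "proj (diff TK (tk (ract U u b) x)) = proj (diff TK (tk u (lact X b x)))"
    unfolding L R
    by (simp add: over_tens_balanced cl MW.ksign_closed over_tens_closed MW.M.a_assoc)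
qed

lemma over_diff_linear: "linear_map K W W (diff W)"
  unfolding tensor_over_simps(4) by (rule over_quot_map_linear[OF diff_linear[OF T_dg] over_diff_preserves])

lemma over_diff_tens:
  assumes u: "u \<in> grade U p" and x: "x \<in> carrier X"
  shows "diff W (to u x) = to (diff U u) x \<oplus>\<^bsub>W\<^esub> ksign W p (to u (diff X x))"
proof -
  note uc = U.bimod_grade_closed[OF u]
  note t = dg_tens_closed[OF UX uc x] dg_tens_closed[OF UX diff_closed[OF U.dg_module uc] x]
    dg_tens_closed[OF UX uc diff_closed[OF X.dg_module x]]
  have "diff W (to u x) = proj (diff TK (tk u x))"
    unfolding tensor_over_simps(4) over_tens_def
    by (rule over_quot_map_eq[OF diff_linear[OF T_dg] over_diff_preserves t(1)])
  then show ?thesis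
    using t by (simp add: dg_tensor_diff_tens[OF UX u x] linear_map_add[OF over_proj_linear] MT.ksign_closed
        linear_map_ksign[OF T_module W_module over_proj_linear] over_tens_def)
qed

lemma over_dg_module: "dg_module K W"
  unfolding dg_module_def
proof (intro conjI allI ballI over_graded over_diff_linear)
  fix n w assume "w \<in> grade W n"
  then obtain z where z: "z \<in> grade TK n" "w = proj z" by (auto simp: tensor_over_simps(3))
  have "diff W w = proj (diff TK z)"
    unfolding tensor_over_simps(4) z(2)
    by (rule over_quot_map_eq[OF diff_linear[OF T_dg] over_diff_preserves grade_closed[OF T_graded z(1)]])
  then show "diff W w \<in> grade W (n + 1)"
    using diff_grade[OF T_dg z(1)] by (simp add: tensor_over_simps(3))
next
  fix w assume "w \<in> carrier W"
  then obtain z where z: "z \<in> carrier TK" "w = proj z" unfolding over_carrier by blast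
  have "diff W (proj y) = proj (diff TK y)" if "y \<in> carrier TK" for y
    unfolding tensor_over_simps(4)
    by (rule over_quot_map_eq[OF diff_linear[OF T_dg] over_diff_preserves that])
  then show "diff W (diff W w) = \<zero>\<^bsub>W\<^esub>"
    using z diff_closed[OF T_dg z(1)] diff_diff[OF T_dg z(1)] linear_map_zero[OF T_module W_module over_proj_linear]
    by simp
qed

lemma over_lact:
  assumes c: "c \<in> carrier C"
  shows "linear_map K W W (lact W c)"
    and "u \<in> carrier U \<Longrightarrow> x \<in> carrier X \<Longrightarrow> lact W c (to u x) = to (lact U c u) x"
proof -
  let ?b = "\<lambda>u x. tk (lact U c u) x"
  have b: "bilinear_map K U X TK ?b"
    using c by (intro bilinear_mapI linear_map_comp[OF U.lact_right dg_tens_left[OF UX]] dg_tens_right[OF UX] U.lact_closed)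
  note lin = dg_tensor_lift_linear[OF UX T_module b] and val = dg_tensor_lift_tens[OF UX T_module b]
  have pres: "tensor_lift K TK ?b z \<in> N" if "z \<in> N" for z
  proof (rule balancing_preserved[OF lin _ that])
    fix p q r u b x assume u: "u \<in> grade U p" and b: "b \<in> grade B q" and x: "x \<in> grade X r"
    note cl = U.bimod_grade_closed[OF u] B.algebra_grade_closed[OF b] X.bimod_grade_closed[OF x]
    show "proj (tensor_lift K TK ?b (tk (ract U u b) x)) = proj (tensor_lift K TK ?b (tk u (lact X b x)))"
      using over_tens_balanced[OF U.lact_closed[OF c cl(1)] cl(2,3)] U.lact_ract[OF c cl(1,2)]
      by (simp add: val U.ract_closed X.lact_closed cl over_tens_def)
  qed
  show "linear_map K W W (lact W c)"
    unfolding tensor_over_simps(5) by (rule over_quot_map_linear[OF lin pres])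
  show "lact W c (to u x) = to (lact U c u) x" if u: "u \<in> carrier U" and x: "x \<in> carrier X"
    unfolding tensor_over_simps(5) over_tens_def
    by (simp add: over_quot_map_eq[OF lin pres dg_tens_closed[OF UX u x]] val[OF u x])
qed

lemma over_ract:
  assumes a: "a \<in> carrier A"
  shows "linear_map K W W (\<lambda>w. ract W w a)"
    and "u \<in> carrier U \<Longrightarrow> x \<in> carrier X \<Longrightarrow> ract W (to u x) a = to u (ract X x a)"
proof -
  let ?b = "\<lambda>u x. tk u (ract X x a)"
  have b: "bilinear_map K U X TK ?b"
    using a by (intro bilinear_mapI linear_map_comp[OF X.ract_left dg_tens_right[OF UX]] dg_tens_left[OF UX] X.ract_closed)
  note lin = dg_tensor_lift_linear[OF UX T_module b] and val = dg_tensor_lift_tens[OF UX T_module b]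
  have pres: "tensor_lift K TK ?b z \<in> N" if "z \<in> N" for z
  proof (rule balancing_preserved[OF lin _ that])
    fix p q r u b x assume u: "u \<in> grade U p" and b: "b \<in> grade B q" and x: "x \<in> grade X r"
    note cl = U.bimod_grade_closed[OF u] B.algebra_grade_closed[OF b] X.bimod_grade_closed[OF x]
    show "proj (tensor_lift K TK ?b (tk (ract U u b) x)) = proj (tensor_lift K TK ?b (tk u (lact X b x)))"
      using over_tens_balanced[OF cl(1,2) X.ract_closed[OF cl(3) a]] X.lact_ract[OF cl(2,3) a]
      by (simp add: val U.ract_closed X.lact_closed cl over_tens_def)
  qed
  show "linear_map K W W (\<lambda>w. ract W w a)"
    unfolding tensor_over_simps(6) by (rule over_quot_map_linear[OF lin pres])
  show "ract W (to u x) a = to u (ract X x a)" if u: "u \<in> carrier U" and x: "x \<in> carrier X"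
    unfolding tensor_over_simps(6) over_tens_def
    by (simp add: over_quot_map_eq[OF lin pres dg_tens_closed[OF UX u x]] val[OF u x])
qed

text \<open>
  The left action moves only \<open>u\<close> and the right action only \<open>x\<close>, so the axioms are inherited from
  the two factors. In the Leibniz rule the sign of \<open>d a\<close> collects the degrees of \<open>c\<close>, \<open>u\<close> and \<open>x\<close>.
\<close>

theorem tensor_over_dg_bimodule: "dg_bimodule K C A W"
proof
  note gc = U.bimod_grade_closed X.bimod_grade_closed
  note mC = C.algebra_module and mA = A.algebra_module
  show "dg_module K W" by (rule over_dg_module)
  show lbil: "bilinear_map K C W W (lact W)"
  proof (rule bilinear_mapI[OF over_lact(1)])
    fix w assume "w \<in> carrier W"
    then show "linear_map K C W (\<lambda>c. lact W c w)"
    proof (induction rule: over_induct)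
      case zero
      show ?case
        by (subst linear_map_cong[OF linear_map_zero[OF W_module W_module over_lact(1)] mC], assumption)
          (rule linear_map_zero_fun[OF W_module])
    next
      case (add w w')
      show ?case
        by (subst linear_map_cong[OF linear_map_add[OF over_lact(1) add(1,2)] mC], assumption)
          (rule linear_map_plus_fun[OF W_module add(3,4)])
    next
      case (tens p q u x)
      note ux = gc(1)[OF tens(1)] gc(2)[OF tens(2)]
      show ?case
        by (subst linear_map_cong[OF over_lact(2)[OF _ ux] mC], assumption)
          (rule linear_map_comp[OF U.lact_left[OF ux(1)] over_tens_left[OF ux(2)]])
    qed
  qed
  show rbil: "bilinear_map K W A W (ract W)"
  proof (rule bilinear_mapI[OF _ over_ract(1)])
    fix w assume "w \<in> carrier W"
    then show "linear_map K A W (ract W w)"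
    proof (induction rule: over_induct)
      case zero
      show ?case
        by (subst linear_map_cong[OF linear_map_zero[OF W_module W_module over_ract(1)] mA], assumption)
          (rule linear_map_zero_fun[OF W_module])
    next
      case (add w w')
      show ?case
        by (subst linear_map_cong[OF linear_map_add[OF over_ract(1) add(1,2)] mA], assumption)
          (rule linear_map_plus_fun[OF W_module add(3,4)])
    next
      case (tens p q u x)
      note ux = gc(1)[OF tens(1)] gc(2)[OF tens(2)]
      show ?case
        by (subst linear_map_cong[OF over_ract(2)[OF _ ux] mA], assumption)
          (rule linear_map_comp[OF X.ract_right[OF ux(2)] over_tens_right[OF ux(1)]])
    qed
  qed
  note wl = bilinear_map_closed[OF lbil] and wr = bilinear_map_closed[OF rbil]
  show "lact W (b \<otimes>\<^bsub>C\<^esub> b') w = lact W b (lact W b' w)"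
    if b: "b \<in> carrier C" and b': "b' \<in> carrier C" and w: "w \<in> carrier W" for b b' w
    by (rule over_eqI[OF W_module over_lact(1)[OF C.mult_closed[OF b b']] linear_map_comp[OF over_lact(1)[OF b'] over_lact(1)[OF b]] _ w])
      (simp add: over_lact(2) gc b b' C.mult_closed U.lact_closed U.lact_assoc)
  show "ract W w (a \<otimes>\<^bsub>A\<^esub> a') = ract W (ract W w a) a'"
    if w: "w \<in> carrier W" and a: "a \<in> carrier A" and a': "a' \<in> carrier A" for w a a'
    by (rule over_eqI[OF W_module over_ract(1)[OF A.mult_closed[OF a a']] linear_map_comp[OF over_ract(1)[OF a] over_ract(1)[OF a']] _ w])
      (simp add: over_ract(2) gc a a' A.mult_closed X.ract_closed X.ract_assoc)
  show "ract W (lact W b w) a = lact W b (ract W w a)"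
    if b: "b \<in> carrier C" and w: "w \<in> carrier W" and a: "a \<in> carrier A" for b w a
    by (rule over_eqI[OF W_module linear_map_comp[OF over_lact(1)[OF b] over_ract(1)[OF a]]
          linear_map_comp[OF over_ract(1)[OF a] over_lact(1)[OF b]] _ w])
      (simp add: over_lact(2) over_ract(2) gc a b U.lact_closed X.ract_closed)
  show "span_mod K W {lact W b w |b w. b \<in> carrier C \<and> w \<in> carrier W} = carrier W" (is "?S = _")
  proof
    have cl: "{lact W b w |b w. b \<in> carrier C \<and> w \<in> carrier W} \<subseteq> carrier W" using wl by auto
    show "?S \<subseteq> carrier W" by (rule span_mod_subset_carrier[OF W_module cl])
    have sub: "submodule ?S K W" by (rule span_mod_submodule[OF W_module cl])
    show "carrier W \<subseteq> ?S"
    proof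
      fix w assume "w \<in> carrier W"
      then show "w \<in> ?S"
      proof (induction rule: over_induct)
        case (tens p q u x)
        note ux = gc(1)[OF tens(1)] gc(2)[OF tens(2)]
        show ?case
        proof (rule linear_map_span_into[OF U.bimod_module W_module over_tens_left[OF ux(2)] sub])
          show "u \<in> span_mod K U {lact U b x |b x. b \<in> carrier C \<and> x \<in> carrier U}"
            using ux(1) by (simp only: U.lact_unitary)
          show "{lact U b x |b x. b \<in> carrier C \<and> x \<in> carrier U} \<subseteq> carrier U" using U.lact_closed by auto
          fix s assume "s \<in> {lact U b x |b x. b \<in> carrier C \<and> x \<in> carrier U}"
          then obtain b v where "s = lact U b v" "b \<in> carrier C" "v \<in> carrier U" by auto
          then show "to s x \<in> ?S"
            using over_lact(2)[of b v x] over_tens_closed[of v x] ux(2) by (intro span_mod_base) force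
        qed
      qed (simp_all add: submodule_zero[OF sub] submodule_add[OF sub])
    qed
  qed
  show "span_mod K W {ract W w a |w a. w \<in> carrier W \<and> a \<in> carrier A} = carrier W" (is "?S = _")
  proof
    have cl: "{ract W w a |w a. w \<in> carrier W \<and> a \<in> carrier A} \<subseteq> carrier W" using wr by auto
    show "?S \<subseteq> carrier W" by (rule span_mod_subset_carrier[OF W_module cl])
    have sub: "submodule ?S K W" by (rule span_mod_submodule[OF W_module cl])
    show "carrier W \<subseteq> ?S"
    proof
      fix w assume "w \<in> carrier W"
      then show "w \<in> ?S"
      proof (induction rule: over_induct)
        case (tens p q u x)
        note ux = gc(1)[OF tens(1)] gc(2)[OF tens(2)]
        show ?case
        proof (rule linear_map_span_into[OF X.bimod_module W_module over_tens_right[OF ux(1)] sub])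
          show "x \<in> span_mod K X {ract X x a |x a. x \<in> carrier X \<and> a \<in> carrier A}"
            using ux(2) by (simp only: X.ract_unitary)
          show "{ract X x a |x a. x \<in> carrier X \<and> a \<in> carrier A} \<subseteq> carrier X" using X.ract_closed by auto
          fix s assume "s \<in> {ract X x a |x a. x \<in> carrier X \<and> a \<in> carrier A}"
          then obtain a v where "s = ract X v a" "a \<in> carrier A" "v \<in> carrier X" by auto
          then show "to u s \<in> ?S"
            using over_ract(2)[of a u v] over_tens_closed[of u v] ux(1) by (intro span_mod_base) force
        qed
      qed (simp_all add: submodule_zero[OF sub] submodule_add[OF sub])
    qed
  qed
  note gW = grade_submodule[OF over_graded]
  show "lact W b w \<in> grade W (m + n)" if b: "b \<in> grade C m" and w: "w \<in> grade W n" for b m w n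
  proof (rule over_grade_into[OF W_module over_lact(1)[OF C.algebra_grade_closed[OF b]] gW _ w])
    fix p q u x assume n: "p + q = n" and u: "u \<in> grade U p" and x: "x \<in> grade X q"
    show "lact W b (to u x) \<in> grade W (m + n)"
      using over_tens_grade[OF U.lact_degree[OF b u] x]
      by (simp add: over_lact(2)[OF C.algebra_grade_closed[OF b] gc(1)[OF u] gc(2)[OF x]] add.assoc n[symmetric])
  qed
  show "ract W w a \<in> grade W (m + n)" if w: "w \<in> grade W m" and a: "a \<in> grade A n" for w m a n
  proof (rule over_grade_into[OF W_module over_ract(1)[OF A.algebra_grade_closed[OF a]] gW _ w])
    fix p q u x assume n: "p + q = m" and u: "u \<in> grade U p" and x: "x \<in> grade X q"
    show "ract W (to u x) a \<in> grade W (m + n)"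
      using over_tens_grade[OF u X.ract_degree[OF x a]]
      by (simp add: over_ract(2)[OF A.algebra_grade_closed[OF a] gc(1)[OF u] gc(2)[OF x]] add.assoc n[symmetric])
  qed
  fix c m w n a assume c: "c \<in> grade C m" and w: "w \<in> grade W n" and a: "a \<in> carrier A"
  note cc = C.algebra_grade_closed[OF c]
  note dc = diff_closed[OF C.dg_module cc] and da = diff_closed[OF A.dg_module a]
  note lc = over_lact(1)[OF cc] and ldc = over_lact(1)[OF dc] and ra = over_ract(1)[OF a] and rda = over_ract(1)[OF da]
  show "diff W (ract W (lact W c w) a) = ract W (lact W (diff C c) w) a \<oplus>\<^bsub>W\<^esub>
      ksign W m (ract W (lact W c (diff W w)) a) \<oplus>\<^bsub>W\<^esub> ksign W (m + n) (ract W (lact W c w) (diff A a))"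
  proof (rule over_grade_eq[OF W_module linear_map_comp[OF linear_map_comp[OF lc ra] over_diff_linear]
        linear_map_plus_fun[OF W_module linear_map_plus_fun[OF W_module linear_map_comp[OF ldc ra]
          linear_map_ksign_fun[OF W_module linear_map_comp[OF linear_map_comp[OF over_diff_linear lc] ra]]]
          linear_map_ksign_fun[OF W_module linear_map_comp[OF lc rda]]] _ w])
    fix p q u x assume n: "p + q = n" and u: "u \<in> grade U p" and x: "x \<in> grade X q"
    note uc = gc(1)[OF u] and xc = gc(2)[OF x]
    note du = diff_closed[OF U.dg_module uc] and dx = diff_closed[OF X.dg_module xc]
    interpret MU: module K U by (rule U.bimod_module)
    interpret MX: module K X by (rule X.bimod_module)
    note cl = cc dc a da uc xc du dx U.lact_closed X.ract_closed over_tens_closed MU.ksign_closed MX.ksign_closed MW.ksign_closed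
    note val = over_lact(2)[OF cc] over_lact(2)[OF dc] over_ract(2)[OF a] over_ract(2)[OF da]
    note lk = linear_map_ksign[OF U.bimod_module W_module over_tens_left] linear_map_ksign[OF X.bimod_module W_module over_tens_right]
    let ?t1 = "to (lact U (diff C c) u) (ract X x a)" and ?t2 = "to (lact U c (diff U u)) (ract X x a)"
    let ?t3 = "to (lact U c u) (ract X (diff X x) a)" and ?t4 = "to (lact U c u) (ract X x (diff A a))"
    have L: "diff W (ract W (lact W c (to u x)) a) = (?t1 \<oplus>\<^bsub>W\<^esub> ksign W m ?t2) \<oplus>\<^bsub>W\<^esub>
        (ksign W (m + p) ?t3 \<oplus>\<^bsub>W\<^esub> ksign W (m + p + q) ?t4)"
      by (simp add: val cl over_diff_tens[OF U.lact_degree[OF c u]] U.lact_diff[OF algB C.dg_module c uc]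
          X.ract_diff[OF algB A.dg_module x a] linear_map_add[OF over_tens_left] linear_map_add[OF over_tens_right]
          lk MW.ksign_simps)
    have R: "ract W (lact W c (diff W (to u x))) a = ?t2 \<oplus>\<^bsub>W\<^esub> ksign W p ?t3"
      by (simp add: val cl over_diff_tens[OF u xc] linear_map_add[OF lc] linear_map_add[OF ra]
          linear_map_ksign[OF W_module W_module lc] linear_map_ksign[OF W_module W_module ra])
    show "diff W (ract W (lact W c (to u x)) a) = ract W (lact W (diff C c) (to u x)) a \<oplus>\<^bsub>W\<^esub>
      ksign W m (ract W (lact W c (diff W (to u x))) a) \<oplus>\<^bsub>W\<^esub> ksign W (m + n) (ract W (lact W c (to u x)) (diff A a))"
      unfolding L R
      by (simp add: val cl MW.ksign_simps n[symmetric] MW.M.a_assoc add.assoc)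
  qed
qed

end

section \<open>The tensor product of morphisms\<close>

text \<open>
  The \<open>n\<close>-th power of the twist for every integer \<open>n\<close>; only the parity matters, since the twist is an
  involution.
\<close>

definition twist_pow :: "('k, 'm, 'r) gmod_scheme \<Rightarrow> int \<Rightarrow> 'm \<Rightarrow> 'm" where
  "twist_pow M n x = (if even n then x else twist M x)"

lemma twist_pow_linear: "graded_module K M \<Longrightarrow> linear_map K M M (twist_pow M n)"
  using twist_linear[of K M] linear_map_id[of K M] by (cases "even n") (simp_all add: twist_pow_def[abs_def])

lemma twist_pow_homogeneous: "graded_module K M \<Longrightarrow> x \<in> grade M m \<Longrightarrow> twist_pow M n x = ksign M (n * m) x"
  using twist_homogeneous[of K M x m] by (auto simp: twist_pow_def ksign_def)

lemmas twist_pow_closed = linear_map_closed[OF twist_pow_linear]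

context
  fixes K :: "'k ring" and A :: "('k, 'a) dgmod" and I\<^sub>A :: "'i set" and e\<^sub>A :: "'i \<Rightarrow> 'a"
    and B :: "('k, 'b) dgmod" and I\<^sub>B :: "'j set" and e\<^sub>B :: "'j \<Rightarrow> 'b"
    and C :: "('k, 'c) dgmod" and I\<^sub>C :: "'l set" and e\<^sub>C :: "'l \<Rightarrow> 'c"
  assumes algA: "dg_algebra_idem K A I\<^sub>A e\<^sub>A" and algB: "dg_algebra_idem K B I\<^sub>B e\<^sub>B"
    and algC: "dg_algebra_idem K C I\<^sub>C e\<^sub>C"
begin

interpretation A: dg_algebra_idem K A I\<^sub>A e\<^sub>A by (rule algA)
interpretation B: dg_algebra_idem K B I\<^sub>B e\<^sub>B by (rule algB)
interpretation C: dg_algebra_idem K C I\<^sub>C e\<^sub>C by (rule algC)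

context
  fixes U :: "('k, 'c, 'b, 'u) dgbimod" and V :: "('k, 'c, 'b, 'v) dgbimod"
    and X :: "('k, 'b, 'a, 'x) dgbimod" and Y :: "('k, 'b, 'a, 'y) dgbimod"
  assumes bimU: "dg_bimodule K C B U" and bimV: "dg_bimodule K C B V"
    and bimX: "dg_bimodule K B A X" and bimY: "dg_bimodule K B A Y"
begin

interpretation U: dg_bimodule K C B U by (rule bimU)
interpretation V: dg_bimodule K C B V by (rule bimV)
interpretation X: dg_bimodule K B A X by (rule bimX)
interpretation Y: dg_bimodule K B A Y by (rule bimY)

private abbreviation (input) "HU \<equiv> bimod_hom K C B U V"
private abbreviation (input) "HX \<equiv> bimod_hom K B A X Y"
private abbreviation (input) "WX \<equiv> tensor_over K B U X"
private abbreviation (input) "WY \<equiv> tensor_over K B V Y"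
private abbreviation (input) "tX \<equiv> tens_over K B U X"
private abbreviation (input) "tY \<equiv> tens_over K B V Y"
private abbreviation (input) "HW \<equiv> bimod_hom K C A (tensor_over K B U X) (tensor_over K B V Y)"

private lemmas aUV = algB algC bimU bimV
private lemmas aXY' = algA algB bimX bimY
private lemmas aW = algA algB algC bimU bimX
private lemmas aW' = algA algB algC bimV bimY
private lemmas bimW = tensor_over_dg_bimodule[OF aW]
private lemmas bimW' = tensor_over_dg_bimodule[OF aW']
private lemmas aWW' = algA algC bimW bimW'
private lemmas HU_graded = hom_graded[OF aUV] and HX_graded = hom_graded[OF aXY']
private lemmas HU_module = hom_module[OF aUV] and HX_module = hom_module[OF aXY']
private lemmas W_mod = W_module[OF aW] and W'_mod = W_module[OF aW']

interpretation MW': module K WY by (rule W'_mod)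
interpretation MY: module K Y by (rule Y.bimod_module)
interpretation MV: module K V by (rule V.bimod_module)

lemma hom_ract:
  assumes \<alpha>: "\<alpha> \<in> carrier HU" and u: "u \<in> carrier U" and b: "b \<in> carrier B"
  shows "\<alpha> (ract U u b) = ract V (\<alpha> u) b"
  by (rule linear_map_graded_eq[OF HU_graded V.bimod_module hom_ev[OF aUV U.ract_closed[OF u b]]
        linear_map_comp[OF hom_ev[OF aUV u] V.ract_left[OF b]] _ \<alpha>])
    (simp add: bimod_hom_simps(5) bimod_hom_deg_ract[OF aUV _ b u])

text \<open>Moving \<open>\<phi>\<close> past \<open>b\<close> costs the sign \<open>(-1)\<^bsup>|\<phi>| |b|\<^esup>\<close>, which the change of exponent accounts for.\<close>

lemma hom_lact_twist:
  assumes \<phi>: "\<phi> \<in> carrier HX" and b: "b \<in> grade B q" and x: "x \<in> carrier X"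
  shows "twist_pow HX p \<phi> (lact X b x) = lact Y b (twist_pow HX (p + q) \<phi> x)"
proof (rule linear_map_graded_eq[OF HX_graded Y.bimod_module _ _ _ \<phi>])
  note bc = B.algebra_grade_closed[OF b]
  note bx = X.lact_closed[OF bc x]
  show "linear_map K HX Y (\<lambda>\<phi>. twist_pow HX p \<phi> (lact X b x))"
    by (rule linear_map_comp[OF twist_pow_linear[OF HX_graded] hom_ev[OF aXY' bx]])
  show "linear_map K HX Y (\<lambda>\<phi>. lact Y b (twist_pow HX (p + q) \<phi> x))"
    by (rule linear_map_comp[OF linear_map_comp[OF twist_pow_linear[OF HX_graded] hom_ev[OF aXY' x]] Y.lact_right[OF bc]])
  fix n \<phi> assume g: "\<phi> \<in> grade HX n"
  then have d: "\<phi> \<in> bimod_hom_deg K B A X Y n" by (simp add: bimod_hom_simps(5))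
  note c = deg_closed[OF aXY' d]
  note \<phi>x = hom_apply_closed[OF aXY' c x]
  show "twist_pow HX p \<phi> (lact X b x) = lact Y b (twist_pow HX (p + q) \<phi> x)"
    using Y.lact_closed[OF bc \<phi>x]
    by (simp add: twist_pow_homogeneous[OF HX_graded g] hom_ksign[OF aXY' c] bx x bimod_hom_deg_lact[OF aXY' d b x]
        MY.ksign_simps linear_map_ksign[OF Y.bimod_module Y.bimod_module Y.lact_right[OF bc] \<phi>x] algebra_simps)
qed

text \<open>
  The total form of \<open>u \<otimes> x \<mapsto> (-1)\<^bsup>|\<phi>| |u|\<^esup> \<alpha> u \<otimes> \<phi> x\<close>: only \<open>u\<close> is split into components, and the degree
  of \<open>\<phi>\<close> enters through the twist of \<open>Hom(X, Y)\<close>, so that the formula is linear in all four variables.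
\<close>

definition tensor_hom_kernel :: "('u \<Rightarrow> 'v) \<Rightarrow> ('x \<Rightarrow> 'y) \<Rightarrow> 'u \<Rightarrow> 'x \<Rightarrow> ('v \<times> 'y \<Rightarrow> 'k) set set" where
  "tensor_hom_kernel \<alpha> \<phi> u x =
     (\<Oplus>\<^bsub>WY\<^esub>r\<in>hsupp U u. tY (\<alpha> (hcomp U u r)) (twist_pow HX r \<phi> x))"

private lemmas tY_left = over_tens_left[OF aW'] and tY_right = over_tens_right[OF aW']
private lemmas tY_closed = over_tens_closed[OF aW']

lemma twist_pow_apply_closed: "\<phi> \<in> carrier HX \<Longrightarrow> x \<in> carrier X \<Longrightarrow> twist_pow HX r \<phi> x \<in> carrier Y"
  by (rule hom_apply_closed[OF aXY' twist_pow_closed[OF HX_graded]])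

lemma kernel_summand_linear:
  assumes "\<alpha> \<in> carrier HU" "\<phi> \<in> carrier HX" "x \<in> carrier X"
  shows "linear_map K U WY (\<lambda>u. tY (\<alpha> u) (twist_pow HX r \<phi> x))"
  by (rule linear_map_comp[OF hom_linear[OF aUV assms(1)] tY_left[OF twist_pow_apply_closed[OF assms(2,3)]]])

lemma kernel_homogeneous:
  assumes "\<alpha> \<in> carrier HU" "\<phi> \<in> carrier HX" "u \<in> grade U r" "x \<in> carrier X"
  shows "tensor_hom_kernel \<alpha> \<phi> u x = tY (\<alpha> u) (twist_pow HX r \<phi> x)"
  unfolding tensor_hom_kernel_def
  by (rule graded_sum_homogeneous[OF U.bimod_graded W'_mod kernel_summand_linear[OF assms(1,2,4)] assms(3)])

lemma
  shows kernel_linear_U: "\<lbrakk>\<alpha> \<in> carrier HU; \<phi> \<in> carrier HX; x \<in> carrier X\<rbrakk> \<Longrightarrow>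
      linear_map K U WY (\<lambda>u. tensor_hom_kernel \<alpha> \<phi> u x)"
    and kernel_linear_X: "\<lbrakk>\<alpha> \<in> carrier HU; \<phi> \<in> carrier HX; u \<in> carrier U\<rbrakk> \<Longrightarrow>
      linear_map K X WY (\<lambda>x. tensor_hom_kernel \<alpha> \<phi> u x)"
    and kernel_linear_\<alpha>: "\<lbrakk>\<phi> \<in> carrier HX; u \<in> carrier U; x \<in> carrier X\<rbrakk> \<Longrightarrow>
      linear_map K HU WY (\<lambda>\<alpha>. tensor_hom_kernel \<alpha> \<phi> u x)"
    and kernel_linear_\<phi>: "\<lbrakk>\<alpha> \<in> carrier HU; u \<in> carrier U; x \<in> carrier X\<rbrakk> \<Longrightarrow>
      linear_map K HX WY (\<lambda>\<phi>. tensor_hom_kernel \<alpha> \<phi> u x)"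
proof -
  note fin = finite_hsupp[OF U.bimod_graded] and hc = hcomp_closed[OF U.bimod_graded]
  note tw = twist_pow_closed[OF HX_graded]
  show "linear_map K U WY (\<lambda>u. tensor_hom_kernel \<alpha> \<phi> u x)"
    if "\<alpha> \<in> carrier HU" "\<phi> \<in> carrier HX" "x \<in> carrier X"
    unfolding tensor_hom_kernel_def
    by (rule graded_sum_linear[OF U.bimod_graded W'_mod kernel_summand_linear[OF that]])
  show "linear_map K X WY (\<lambda>x. tensor_hom_kernel \<alpha> \<phi> u x)"
    if "\<alpha> \<in> carrier HU" "\<phi> \<in> carrier HX" "u \<in> carrier U"
    unfolding tensor_hom_kernel_def
    by (intro linear_map_finsum_fun X.bimod_module W'_mod fin that
        linear_map_comp[OF hom_linear[OF aXY' tw] tY_right] hom_apply_closed[OF aUV] hc)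
  show "linear_map K HU WY (\<lambda>\<alpha>. tensor_hom_kernel \<alpha> \<phi> u x)"
    if "\<phi> \<in> carrier HX" "u \<in> carrier U" "x \<in> carrier X"
    unfolding tensor_hom_kernel_def
    by (intro linear_map_finsum_fun HU_module W'_mod fin that
        linear_map_comp[OF hom_ev[OF aUV] tY_left] twist_pow_apply_closed hc)
  show "linear_map K HX WY (\<lambda>\<phi>. tensor_hom_kernel \<alpha> \<phi> u x)"
    if "\<alpha> \<in> carrier HU" "u \<in> carrier U" "x \<in> carrier X"
    unfolding tensor_hom_kernel_def
    by (intro linear_map_finsum_fun HX_module W'_mod fin that
        linear_map_comp[OF linear_map_comp[OF twist_pow_linear[OF HX_graded] hom_ev[OF aXY']] tY_right]
        hom_apply_closed[OF aUV] hc)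
qed

lemma kernel_bilinear:
  "\<alpha> \<in> carrier HU \<Longrightarrow> \<phi> \<in> carrier HX \<Longrightarrow> bilinear_map K U X WY (tensor_hom_kernel \<alpha> \<phi>)"
  by (intro bilinear_mapI kernel_linear_U kernel_linear_X)

text \<open>
  Replacing \<open>u\<close> by \<open>u b\<close> raises the exponent of the twist by the degree of \<open>b\<close>, which is exactly the
  sign of moving \<open>\<phi>\<close> past \<open>b\<close> on the other side.
\<close>

lemma kernel_balanced:
  assumes \<alpha>: "\<alpha> \<in> carrier HU" and \<phi>: "\<phi> \<in> carrier HX"
    and u: "u \<in> grade U p" and b: "b \<in> grade B q" and x: "x \<in> grade X r"
  shows "tensor_hom_kernel \<alpha> \<phi> (ract U u b) x = tensor_hom_kernel \<alpha> \<phi> u (lact X b x)"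
proof -
  note uc = U.bimod_grade_closed[OF u] and bc = B.algebra_grade_closed[OF b] and xc = X.bimod_grade_closed[OF x]
  show ?thesis
    by (simp add: kernel_homogeneous[OF \<alpha> \<phi> U.ract_degree[OF u b] xc] kernel_homogeneous[OF \<alpha> \<phi> u X.lact_closed[OF bc xc]]
        hom_ract[OF \<alpha> uc bc] hom_lact_twist[OF \<phi> b xc] over_tens_balanced[OF aW' _ bc]
        hom_apply_closed[OF aUV \<alpha> uc] twist_pow_apply_closed[OF \<phi> xc])
qed

text \<open>
  Restricted to the carrier, since morphisms of bimodules are extensional functions.
\<close>

definition tensor_hom :: "('u \<Rightarrow> 'v) \<Rightarrow> ('x \<Rightarrow> 'y) \<Rightarrow> ('u \<times> 'x \<Rightarrow> 'k) set set \<Rightarrow> ('v \<times> 'y \<Rightarrow> 'k) set set" where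
  "tensor_hom \<alpha> \<phi> = (\<lambda>w\<in>carrier WX. over_lift K WY (tensor_hom_kernel \<alpha> \<phi>) w)"

lemma tensor_hom_lin:
  assumes "\<alpha> \<in> carrier HU" "\<phi> \<in> carrier HX"
  shows "tensor_hom \<alpha> \<phi> \<in> carrier (lin_maps K WX WY)"
  unfolding tensor_hom_def
  by (intro lin_maps_restrict W_mod W'_mod over_lift_linear[OF aW W'_mod kernel_bilinear[OF assms] kernel_balanced[OF assms]])

lemma tensor_hom_tens_kernel:
  assumes "\<alpha> \<in> carrier HU" "\<phi> \<in> carrier HX" "u \<in> carrier U" "x \<in> carrier X"
  shows "tensor_hom \<alpha> \<phi> (tX u x) = tensor_hom_kernel \<alpha> \<phi> u x"
  using over_tens_closed[OF aW assms(3,4)]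
  by (simp add: tensor_hom_def over_lift_tens[OF aW W'_mod kernel_bilinear[OF assms(1,2)] kernel_balanced[OF assms(1,2)] assms(3,4)])

lemma tensor_hom_tens:
  assumes \<alpha>: "\<alpha> \<in> carrier HU" and \<phi>: "\<phi> \<in> bimod_hom_deg K B A X Y q" and u: "u \<in> grade U r" and x: "x \<in> carrier X"
  shows "tensor_hom \<alpha> \<phi> (tX u x) = ksign WY (q * r) (tY (\<alpha> u) (\<phi> x))"
proof -
  note \<phi>c = deg_closed[OF aXY' \<phi>] and uc = U.bimod_grade_closed[OF u]
  have g: "\<phi> \<in> grade HX q" using \<phi> by (simp add: bimod_hom_simps(5))
  have "tensor_hom \<alpha> \<phi> (tX u x) = tY (\<alpha> u) (twist_pow HX r \<phi> x)"
    by (simp add: tensor_hom_tens_kernel[OF \<alpha> \<phi>c uc x] kernel_homogeneous[OF \<alpha> \<phi>c u x])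
  also have "twist_pow HX r \<phi> x = ksign Y (q * r) (\<phi> x)"
    by (simp add: twist_pow_homogeneous[OF HX_graded g] hom_ksign[OF aXY' \<phi>c x] mult.commute)
  also have "tY (\<alpha> u) (ksign Y (q * r) (\<phi> x)) = ksign WY (q * r) (tY (\<alpha> u) (\<phi> x))"
    by (rule linear_map_ksign[OF Y.bimod_module W'_mod tY_right[OF hom_apply_closed[OF aUV \<alpha> uc]]
          hom_apply_closed[OF aXY' \<phi>c x]])
  finally show ?thesis .
qed

lemma over_parameter_linear:
  assumes P: "module K P" and lin: "\<And>p. p \<in> carrier P \<Longrightarrow> linear_map K WX WY (f p)"
    and tens: "\<And>u x. u \<in> carrier U \<Longrightarrow> x \<in> carrier X \<Longrightarrow> linear_map K P WY (\<lambda>p. f p (tX u x))"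
    and w: "w \<in> carrier WX"
  shows "linear_map K P WY (\<lambda>p. f p w)"
  using w
proof (induction rule: over_induct[OF aW, consumes 1, case_names zero add tens])
  case zero
  show ?case
    by (subst linear_map_cong[OF linear_map_zero[OF W_mod W'_mod lin] P], assumption)
      (rule linear_map_zero_fun[OF W'_mod])
next
  case (add w w')
  show ?case
    by (subst linear_map_cong[OF linear_map_add[OF lin add(1,2)] P], assumption)
      (rule linear_map_plus_fun[OF W'_mod add(3,4)])
next
  case (tens p q u x)
  then show ?case using assms(3) U.bimod_grade_closed X.bimod_grade_closed by blast
qed

lemma tensor_hom_bilinear_lin: "bilinear_map K HU HX (lin_maps K WX WY) tensor_hom"
proof (rule bilinear_mapI)
  fix \<alpha> assume \<alpha>: "\<alpha> \<in> carrier HU"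
  show "linear_map K HX (lin_maps K WX WY) (tensor_hom \<alpha>)"
  proof (rule linear_map_into_lin_maps[OF W_mod W'_mod HX_module tensor_hom_lin[OF \<alpha>]])
    fix w assume w: "w \<in> carrier WX"
    show "linear_map K HX WY (\<lambda>\<phi>. tensor_hom \<alpha> \<phi> w)"
    proof (rule over_parameter_linear[OF HX_module lin_maps_linear[OF tensor_hom_lin[OF \<alpha>]] _ w])
      fix u x assume u: "u \<in> carrier U" and x: "x \<in> carrier X"
      show "linear_map K HX WY (\<lambda>\<phi>. tensor_hom \<alpha> \<phi> (tX u x))"
        by (subst linear_map_cong[OF tensor_hom_tens_kernel[OF \<alpha> _ u x] HX_module], assumption)
          (rule kernel_linear_\<phi>[OF \<alpha> u x])
    qed
  qed
next
  fix \<phi> assume \<phi>: "\<phi> \<in> carrier HX"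
  show "linear_map K HU (lin_maps K WX WY) (\<lambda>\<alpha>. tensor_hom \<alpha> \<phi>)"
  proof (rule linear_map_into_lin_maps[OF W_mod W'_mod HU_module tensor_hom_lin[OF _ \<phi>]])
    fix w assume w: "w \<in> carrier WX"
    show "linear_map K HU WY (\<lambda>\<alpha>. tensor_hom \<alpha> \<phi> w)"
    proof (rule over_parameter_linear[OF HU_module lin_maps_linear[OF tensor_hom_lin[OF _ \<phi>]] _ w])
      fix u x assume u: "u \<in> carrier U" and x: "x \<in> carrier X"
      show "linear_map K HU WY (\<lambda>\<alpha>. tensor_hom \<alpha> \<phi> (tX u x))"
        by (subst linear_map_cong[OF tensor_hom_tens_kernel[OF _ \<phi> u x] HU_module], assumption)
          (rule kernel_linear_\<alpha>[OF \<phi> u x])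
    qed
  qed
qed

text \<open>
  Moving \<open>c\<close> out costs \<open>|\<phi>| |c|\<close> from the change of \<open>|u|\<close> and \<open>|\<alpha>| |c|\<close> from \<open>\<alpha>\<close>, together the sign of
  a map of degree \<open>|\<alpha>| + |\<phi>|\<close>.
\<close>

lemma tensor_hom_deg:
  assumes \<alpha>: "\<alpha> \<in> bimod_hom_deg K C B U V p" and \<phi>: "\<phi> \<in> bimod_hom_deg K B A X Y q"
  shows "tensor_hom \<alpha> \<phi> \<in> bimod_hom_deg K C A WX WY (p + q)"
proof (rule bimod_hom_degI[OF aWW'])
  note \<alpha>c = deg_closed[OF aUV \<alpha>] and \<phi>c = deg_closed[OF aXY' \<phi>]
  note val = tensor_hom_tens[OF \<alpha>c \<phi>]
  note lin = lin_maps_linear[OF tensor_hom_lin[OF \<alpha>c \<phi>c]]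
  note \<alpha>a = hom_apply_closed[OF aUV \<alpha>c] and \<phi>a = hom_apply_closed[OF aXY' \<phi>c]
  note gW' = grade_submodule[OF over_graded[OF aW']]
  show "tensor_hom \<alpha> \<phi> \<in> carrier (lin_maps K WX WY)" by (rule tensor_hom_lin[OF \<alpha>c \<phi>c])
  show "tensor_hom \<alpha> \<phi> w \<in> grade WY (n + (p + q))" if w: "w \<in> grade WX n" for n w
  proof (rule over_grade_into[OF aW W'_mod lin gW' _ w])
    fix r s u x assume n: "r + s = n" and u: "u \<in> grade U r" and x: "x \<in> grade X s"
    have "tY (\<alpha> u) (\<phi> x) \<in> grade WY ((r + p) + (s + q))"
      by (rule over_tens_grade[OF aW' bimod_hom_degD(3)[OF \<alpha> u] bimod_hom_degD(3)[OF \<phi> x]])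
    moreover have "(r + p) + (s + q) = n + (p + q)" using n by simp
    ultimately show "tensor_hom \<alpha> \<phi> (tX u x) \<in> grade WY (n + (p + q))"
      by (simp add: val[OF u X.bimod_grade_closed[OF x]] submodule_ksign[OF gW'])
  qed
  show "tensor_hom \<alpha> \<phi> (lact WX c w) = ksign WY ((p + q) * m) (lact WY c (tensor_hom \<alpha> \<phi> w))"
    if c: "c \<in> grade C m" and w: "w \<in> carrier WX" for m c w
  proof -
    note cc = C.algebra_grade_closed[OF c]
    note lW = over_lact(1)[OF aW cc] and lW' = over_lact(1)[OF aW' cc]
    show ?thesis
    proof (rule over_eqI[OF aW W'_mod linear_map_comp[OF lW lin]
          linear_map_ksign_fun[OF W'_mod linear_map_comp[OF lin lW']] _ w])
      fix r s u x assume u: "u \<in> grade U r" and x: "x \<in> grade X s"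
      note uc = U.bimod_grade_closed[OF u] and xc = X.bimod_grade_closed[OF x]
      note t = tY_closed[OF V.lact_closed[OF cc \<alpha>a[OF uc]] \<phi>a[OF xc]]
      have "tensor_hom \<alpha> \<phi> (lact WX c (tX u x)) = ksign WY (q * (m + r) + p * m) (tY (lact V c (\<alpha> u)) (\<phi> x))"
        using t by (simp add: over_lact(2)[OF aW cc uc xc] val[OF U.lact_degree[OF c u] xc] bimod_hom_deg_lact[OF aUV \<alpha> c uc]
          linear_map_ksign[OF V.bimod_module W'_mod tY_left[OF \<phi>a[OF xc]] V.lact_closed[OF cc \<alpha>a[OF uc]]] MW'.ksign_simps)
      also have "\<dots> = ksign WY ((p + q) * m + q * r) (tY (lact V c (\<alpha> u)) (\<phi> x))"
        by (rule ksign_cong) (simp add: algebra_simps)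
      also have "\<dots> = ksign WY ((p + q) * m) (lact WY c (tensor_hom \<alpha> \<phi> (tX u x)))"
        using t by (simp add: val[OF u xc] linear_map_ksign[OF W'_mod W'_mod lW'] tY_closed \<alpha>a uc \<phi>a xc
            over_lact(2)[OF aW' cc] MW'.ksign_simps)
      finally show "tensor_hom \<alpha> \<phi> (lact WX c (tX u x)) = ksign WY ((p + q) * m) (lact WY c (tensor_hom \<alpha> \<phi> (tX u x)))" .
    qed
  qed
  show "tensor_hom \<alpha> \<phi> (ract WX w a) = ract WY (tensor_hom \<alpha> \<phi> w) a"
    if a: "a \<in> carrier A" and w: "w \<in> carrier WX" for a w
  proof (rule over_eqI[OF aW W'_mod linear_map_comp[OF over_ract(1)[OF aW a] lin]
        linear_map_comp[OF lin over_ract(1)[OF aW' a]] _ w])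
    fix r s u x assume u: "u \<in> grade U r" and x: "x \<in> grade X s"
    note uc = U.bimod_grade_closed[OF u] and xc = X.bimod_grade_closed[OF x]
    show "tensor_hom \<alpha> \<phi> (ract WX (tX u x) a) = ract WY (tensor_hom \<alpha> \<phi> (tX u x)) a"
      by (simp add: over_ract(2)[OF aW a uc xc] val[OF u X.ract_closed[OF xc a]] val[OF u xc] bimod_hom_deg_ract[OF aXY' \<phi> a xc]
          linear_map_ksign[OF W'_mod W'_mod over_ract(1)[OF aW' a]] tY_closed \<alpha>a uc \<phi>a xc over_ract(2)[OF aW' a])
  qed
qed

lemma tensor_hom_closed:
  assumes \<alpha>: "\<alpha> \<in> carrier HU" and \<phi>: "\<phi> \<in> carrier HX"
  shows "tensor_hom \<alpha> \<phi> \<in> carrier HW"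
proof -
  note L = lin_maps_module[OF W_mod W'_mod] and sub = hom_carrier_submodule[OF aWW']
  note bil = tensor_hom_bilinear_lin
  show ?thesis
  proof (rule linear_map_graded_into[OF HU_graded L bilinear_map_left[OF bil \<phi>] sub _ \<alpha>])
    fix p \<alpha> assume "\<alpha> \<in> grade HU p"
    then have \<alpha>: "\<alpha> \<in> bimod_hom_deg K C B U V p" by (simp add: bimod_hom_simps(5))
    show "tensor_hom \<alpha> \<phi> \<in> carrier HW"
    proof (rule linear_map_graded_into[OF HX_graded L bilinear_map_right[OF bil deg_closed[OF aUV \<alpha>]] sub _ \<phi>])
      fix q \<phi> assume "\<phi> \<in> grade HX q"
      then show "tensor_hom \<alpha> \<phi> \<in> carrier HW"
        using deg_closed[OF aWW' tensor_hom_deg[OF \<alpha>]] by (simp add: bimod_hom_simps(5))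
    qed
  qed
qed

lemma tensor_hom_bilinear: "bilinear_map K HU HX HW tensor_hom"
  by (intro bilinear_mapI hom_into[OF aWW'] bilinear_map_right[OF tensor_hom_bilinear_lin]
      bilinear_map_left[OF tensor_hom_bilinear_lin] tensor_hom_closed)

lemma over_hom_eqI:
  assumes "f \<in> carrier HW" "g \<in> carrier HW"
    and "\<And>p q u x. u \<in> grade U p \<Longrightarrow> x \<in> grade X q \<Longrightarrow> f (tX u x) = g (tX u x)"
  shows "f = g"
  by (rule lin_maps_eqI[OF hom_closed_lin[OF aWW' assms(1)] hom_closed_lin[OF aWW' assms(2)]])
    (rule over_eqI[OF aW W'_mod hom_linear[OF aWW' assms(1)] hom_linear[OF aWW' assms(2)] assms(3)])

text \<open>
  Both sides have the same four terms on \<open>u \<otimes> x\<close>, with one of \<open>\<alpha> u\<close>, \<open>u\<close>, \<open>\<phi> x\<close>, \<open>x\<close> differentiated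
  in each.
\<close>

lemma tensor_hom_diff:
  assumes \<alpha>: "\<alpha> \<in> bimod_hom_deg K C B U V p" and \<phi>: "\<phi> \<in> bimod_hom_deg K B A X Y q"
  shows "diff HW (tensor_hom \<alpha> \<phi>) = tensor_hom (diff HU \<alpha>) \<phi> \<oplus>\<^bsub>HW\<^esub> ksign HW p (tensor_hom \<alpha> (diff HX \<phi>))"
proof (rule over_hom_eqI)
  note dgU = hom_dg_module[OF aUV] and dgX = hom_dg_module[OF aXY'] and dgW = hom_dg_module[OF aWW']
  interpret HW: module K HW by (rule hom_module[OF aWW'])
  note \<alpha>c = deg_closed[OF aUV \<alpha>] and \<phi>c = deg_closed[OF aXY' \<phi>]
  note d\<alpha> = diff_closed[OF dgU \<alpha>c] and d\<phi> = diff_closed[OF dgX \<phi>c]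
  note t1 = tensor_hom_closed[OF d\<alpha> \<phi>c] and t2 = tensor_hom_closed[OF \<alpha>c d\<phi>] and t0 = tensor_hom_closed[OF \<alpha>c \<phi>c]
  show "diff HW (tensor_hom \<alpha> \<phi>) \<in> carrier HW" by (rule diff_closed[OF dgW t0])
  show "tensor_hom (diff HU \<alpha>) \<phi> \<oplus>\<^bsub>HW\<^esub> ksign HW p (tensor_hom \<alpha> (diff HX \<phi>)) \<in> carrier HW"
    using t1 t2 HW.ksign_closed by simp
  fix r s u x assume u: "u \<in> grade U r" and x: "x \<in> grade X s"
  note uc = U.bimod_grade_closed[OF u] and xc = X.bimod_grade_closed[OF x]
  note w = over_tens_closed[OF aW uc xc]
  note du = diff_grade[OF U.dg_module u] and dx = diff_closed[OF X.dg_module xc]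
  note duc = U.bimod_grade_closed[OF du]
  note \<alpha>a = hom_apply_closed[OF aUV \<alpha>c] and \<phi>a = hom_apply_closed[OF aXY' \<phi>c]
  note dV = diff_closed[OF V.dg_module] and dY = diff_closed[OF Y.dg_module]
  let ?k = "ksign WY"
  let ?t1 = "tY (diff V (\<alpha> u)) (\<phi> x)" and ?t2 = "tY (\<alpha> (diff U u)) (\<phi> x)"
  let ?t3 = "tY (\<alpha> u) (diff Y (\<phi> x))" and ?t4 = "tY (\<alpha> u) (\<phi> (diff X x))"
  have t: "?t1 \<in> carrier WY" "?t2 \<in> carrier WY" "?t3 \<in> carrier WY" "?t4 \<in> carrier WY" "tY (\<alpha> u) (\<phi> x) \<in> carrier WY"
    by (intro tY_closed dV dY \<alpha>a \<phi>a uc xc duc dx)+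
  have L: "diff HW (tensor_hom \<alpha> \<phi>) (tX u x) =
      (?k (q * r) ?t1 \<oplus>\<^bsub>WY\<^esub> ?k (q * r + (r + p)) ?t3) \<ominus>\<^bsub>WY\<^esub>
      (?k (p + q + q * (r + 1)) ?t2 \<oplus>\<^bsub>WY\<^esub> ?k (p + q + (r + q * r)) ?t4)"
  proof -
    have th: "linear_map K WX WY (tensor_hom \<alpha> \<phi>)" by (rule lin_maps_linear[OF tensor_hom_lin[OF \<alpha>c \<phi>c]])
    have a: "diff WY (tensor_hom \<alpha> \<phi> (tX u x)) = ?k (q * r) ?t1 \<oplus>\<^bsub>WY\<^esub> ?k (q * r + (r + p)) ?t3"
      using t by (simp add: tensor_hom_tens[OF \<alpha>c \<phi> u xc] linear_map_ksign[OF W'_mod W'_mod over_diff_linear[OF aW']]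
          over_diff_tens[OF aW' bimod_hom_degD(3)[OF \<alpha> u] \<phi>a[OF xc]] MW'.ksign_simps)
    have b: "tensor_hom \<alpha> \<phi> (diff WX (tX u x)) = ?k (q * (r + 1)) ?t2 \<oplus>\<^bsub>WY\<^esub> ?k (r + q * r) ?t4"
    proof -
      interpret MW: module K WX by (rule W_mod)
      have c: "tX (diff U u) x \<in> carrier WX" "tX u (diff X x) \<in> carrier WX"
        by (intro over_tens_closed[OF aW] duc uc xc dx)+
      show ?thesis
        using t c by (simp add: over_diff_tens[OF aW u xc] linear_map_add[OF th] linear_map_ksign[OF W_mod W'_mod th]
            MW.ksign_simps MW'.ksign_simps tensor_hom_tens[OF \<alpha>c \<phi> du xc] tensor_hom_tens[OF \<alpha>c \<phi> u dx])
    qed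
    show ?thesis
      using t by (simp add: hom_diff_apply[OF aWW' tensor_hom_deg[OF \<alpha> \<phi>] w] a b MW'.ksign_simps)
  qed
  have R1: "tensor_hom (diff HU \<alpha>) \<phi> (tX u x) = ?k (q * r) ?t1 \<ominus>\<^bsub>WY\<^esub> ?k (q * r + p) ?t2"
    using t by (simp add: tensor_hom_tens[OF d\<alpha> \<phi> u xc] hom_diff_apply[OF aUV \<alpha> uc] dV \<alpha>a uc duc MV.ksign_closed
        linear_map_minus[OF V.bimod_module W'_mod tY_left[OF \<phi>a[OF xc]]]
        linear_map_ksign[OF V.bimod_module W'_mod tY_left[OF \<phi>a[OF xc]]] MW'.ksign_simps MW'.ksign_minus)
  have R2: "ksign HW p (tensor_hom \<alpha> (diff HX \<phi>)) (tX u x) =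
      ?k (p + (q + 1) * r) ?t3 \<ominus>\<^bsub>WY\<^esub> ?k (p + ((q + 1) * r + q)) ?t4"
    using t by (simp add: hom_ksign[OF aWW' t2 w] tensor_hom_tens[OF \<alpha>c hom_diff_deg[OF aXY' \<phi>] u xc]
        hom_diff_apply[OF aXY' \<phi> xc] dY \<phi>a xc dx MY.ksign_closed
        linear_map_minus[OF Y.bimod_module W'_mod tY_right[OF \<alpha>a[OF uc]]]
        linear_map_ksign[OF Y.bimod_module W'_mod tY_right[OF \<alpha>a[OF uc]]] MW'.ksign_simps MW'.ksign_minus)
  have R: "(tensor_hom (diff HU \<alpha>) \<phi> \<oplus>\<^bsub>HW\<^esub> ksign HW p (tensor_hom \<alpha> (diff HX \<phi>))) (tX u x) =
      tensor_hom (diff HU \<alpha>) \<phi> (tX u x) \<oplus>\<^bsub>WY\<^esub> ksign HW p (tensor_hom \<alpha> (diff HX \<phi>)) (tX u x)"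
    by (rule linear_map_add[OF hom_ev[OF aWW' w] t1 HW.ksign_closed[OF t2]])
  have s: "?k (q * r + (r + p)) ?t3 = ?k (p + (q + 1) * r) ?t3" "?k (p + q + q * (r + 1)) ?t2 = ?k (q * r + p) ?t2"
    "?k (p + q + (r + q * r)) ?t4 = ?k (p + ((q + 1) * r + q)) ?t4"
    by (auto intro!: ksign_cong simp: algebra_simps)
  show "diff HW (tensor_hom \<alpha> \<phi>) (tX u x) =
    (tensor_hom (diff HU \<alpha>) \<phi> \<oplus>\<^bsub>HW\<^esub> ksign HW p (tensor_hom \<alpha> (diff HX \<phi>))) (tX u x)"
    unfolding L R R1 R2 s
    using t by (simp add: a_minus_def MW'.M.minus_add MW'.M.a_ac MW'.ksign_closed)
qed

subsection \<open>The map on tensors of morphisms\<close>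

definition tensor_map where
  "tensor_map = tensor_lift K HW tensor_hom"

private lemmas dgHU = hom_dg_module[OF aUV] and dgHX = hom_dg_module[OF aXY'] and dgHW = hom_dg_module[OF aWW']
private lemmas HW_module = hom_module[OF aWW']

lemma tensor_map_linear: "linear_map K (dg_tensor K HU HX) HW tensor_map"
  unfolding tensor_map_def
  by (rule dg_tensor_lift_linear[OF dgHU dgHX HW_module tensor_hom_bilinear])

lemma tensor_map_tens:
  "\<alpha> \<in> carrier HU \<Longrightarrow> \<phi> \<in> carrier HX \<Longrightarrow>
    tensor_map (tens K HU HX \<alpha> \<phi>) = tensor_hom \<alpha> \<phi>"
  unfolding tensor_map_def
  by (rule dg_tensor_lift_tens[OF dgHU dgHX HW_module tensor_hom_bilinear])

lemma tensor_map_degree: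
  assumes "z \<in> grade (dg_tensor K HU HX) n"
  shows "tensor_map z \<in> grade HW n"
proof (rule dg_tensor_grade_into[OF dgHU dgHX HW_module tensor_map_linear
      grade_submodule[OF dg_module_graded[OF dgHW]] _ assms])
  fix p q \<alpha> \<phi> assume n: "p + q = n" and "\<alpha> \<in> grade HU p" "\<phi> \<in> grade HX q"
  then have d: "\<alpha> \<in> bimod_hom_deg K C B U V p" "\<phi> \<in> bimod_hom_deg K B A X Y q" by (simp_all add: bimod_hom_simps(5))
  show "tensor_map (tens K HU HX \<alpha> \<phi>) \<in> grade HW n"
    using tensor_hom_deg[OF d] n
    by (simp add: tensor_map_tens deg_closed[OF aUV d(1)] deg_closed[OF aXY' d(2)] bimod_hom_simps(5))
qed

lemma tensor_map_diff:
  assumes "z \<in> carrier (dg_tensor K HU HX)"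
  shows "tensor_map (diff (dg_tensor K HU HX) z) = diff HW (tensor_map z)"
proof (rule dg_tensor_eqI[OF dgHU dgHX HW_module
      linear_map_comp[OF dg_tensor_diff_linear[OF dgHU dgHX] tensor_map_linear]
      linear_map_comp[OF tensor_map_linear diff_linear[OF dgHW]] _ assms])
  fix p q \<alpha> \<phi> assume \<alpha>: "\<alpha> \<in> grade HU p" and \<phi>: "\<phi> \<in> grade HX q"
  have d: "\<alpha> \<in> bimod_hom_deg K C B U V p" "\<phi> \<in> bimod_hom_deg K B A X Y q"
    using \<alpha> \<phi> by (simp_all add: bimod_hom_simps(5))
  note c = deg_closed[OF aUV d(1)] deg_closed[OF aXY' d(2)]
  note dc = diff_closed[OF dgHU c(1)] diff_closed[OF dgHX c(2)]
  note mT = dg_tensor_module[OF dgHU dgHX]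
  interpret T: module K "dg_tensor K HU HX" by (rule mT)
  note t = dg_tens_closed[OF dgHU dgHX dc(1) c(2)] dg_tens_closed[OF dgHU dgHX c(1) dc(2)]
  show "tensor_map (diff (dg_tensor K HU HX) (tens K HU HX \<alpha> \<phi>)) =
      diff HW (tensor_map (tens K HU HX \<alpha> \<phi>))"
    by (simp add: dg_tensor_diff_tens[OF dgHU dgHX \<alpha> c(2)] linear_map_add[OF tensor_map_linear] t T.ksign_closed
        linear_map_ksign[OF mT HW_module tensor_map_linear] tensor_map_tens c dc
        tensor_hom_diff[OF d])
qed

end

end

section \<open>The tensor product functor\<close>

lemma Dg_bimod_simps:
  "Obj (Dg_bimod K B A) = {X. dg_bimodule K B A X}" "Hom (Dg_bimod K B A) X Y = bimod_hom K B A X Y"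
  "Idn (Dg_bimod K B A) X = (\<lambda>x\<in>carrier X. x)" "Cmp (Dg_bimod K B A) X Y Z g f = compose (carrier X) g f"
  by (simp_all add: Dg_bimod_def)

context
  fixes K :: "'k ring" and A :: "('k, 'a) dgmod" and I\<^sub>A :: "'i set" and e\<^sub>A :: "'i \<Rightarrow> 'a"
    and B :: "('k, 'b) dgmod" and I\<^sub>B :: "'j set" and e\<^sub>B :: "'j \<Rightarrow> 'b"
    and C :: "('k, 'c) dgmod" and I\<^sub>C :: "'l set" and e\<^sub>C :: "'l \<Rightarrow> 'c"
  assumes algA: "dg_algebra_idem K A I\<^sub>A e\<^sub>A" and algB: "dg_algebra_idem K B I\<^sub>B e\<^sub>B"
    and algC: "dg_algebra_idem K C I\<^sub>C e\<^sub>C"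
begin

lemma tensor_hom_identity:
  assumes U: "dg_bimodule K C B U" and X: "dg_bimodule K B A X"
  shows "tensor_hom K A B U U X X (\<lambda>u\<in>carrier U. u) (\<lambda>x\<in>carrier X. x) = (\<lambda>w\<in>carrier (tensor_over K B U X). w)"
proof -
  note alg = algA algB algC
  note W = tensor_over_dg_bimodule[OF alg U X]
  note idU = identity_deg[OF algB algC U] and idX = identity_deg[OF algA algB X]
  note cU = deg_closed[OF algB algC U U idU] and cX = deg_closed[OF algA algB X X idX]
  show ?thesis
  proof (rule over_hom_eqI[OF alg U U X X tensor_hom_closed[OF alg U U X X cU cX]
        deg_closed[OF algA algC W W identity_deg[OF algA algC W]]])
    fix r s u x assume u: "u \<in> grade U r" and x: "x \<in> grade X s"
    note uc = dg_bimodule.bimod_grade_closed[OF U u] and xc = dg_bimodule.bimod_grade_closed[OF X x]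
    show "tensor_hom K A B U U X X (\<lambda>u\<in>carrier U. u) (\<lambda>x\<in>carrier X. x) (tens_over K B U X u x) =
        (\<lambda>w\<in>carrier (tensor_over K B U X). w) (tens_over K B U X u x)"
      using over_tens_closed[OF alg U X uc xc]
      by (simp add: tensor_hom_tens[OF alg U U X X cU idX u xc] uc xc ksign_def)
  qed
qed

context
  fixes U0 U1 U2 :: "('k, 'c, 'b, 'u) dgbimod" and X0 X1 X2 :: "('k, 'b, 'a, 'x) dgbimod"
  assumes U0: "dg_bimodule K C B U0" and U1: "dg_bimodule K C B U1" and U2: "dg_bimodule K C B U2"
    and X0: "dg_bimodule K B A X0" and X1: "dg_bimodule K B A X1" and X2: "dg_bimodule K B A X2"
begin

private abbreviation (input) "HU01 \<equiv> bimod_hom K C B U0 U1"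
private abbreviation (input) "DU01 \<equiv> bimod_hom_deg K C B U0 U1"
private abbreviation (input) "HU12 \<equiv> bimod_hom K C B U1 U2"
private abbreviation (input) "DU12 \<equiv> bimod_hom_deg K C B U1 U2"
private abbreviation (input) "HU02 \<equiv> bimod_hom K C B U0 U2"
private abbreviation (input) "DU02 \<equiv> bimod_hom_deg K C B U0 U2"
private abbreviation (input) "HX01 \<equiv> bimod_hom K B A X0 X1"
private abbreviation (input) "DX01 \<equiv> bimod_hom_deg K B A X0 X1"
private abbreviation (input) "HX12 \<equiv> bimod_hom K B A X1 X2"
private abbreviation (input) "DX12 \<equiv> bimod_hom_deg K B A X1 X2"
private abbreviation (input) "HX02 \<equiv> bimod_hom K B A X0 X2"
private abbreviation (input) "DX02 \<equiv> bimod_hom_deg K B A X0 X2"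
private abbreviation (input) "W0 \<equiv> tensor_over K B U0 X0"
private abbreviation (input) "W1 \<equiv> tensor_over K B U1 X1"
private abbreviation (input) "W2 \<equiv> tensor_over K B U2 X2"
private abbreviation (input) "HW02 \<equiv> bimod_hom K C A (tensor_over K B U0 X0) (tensor_over K B U2 X2)"
private abbreviation (input) "th01 \<equiv> tensor_hom K A B U0 U1 X0 X1"
private abbreviation (input) "th12 \<equiv> tensor_hom K A B U1 U2 X1 X2"
private abbreviation (input) "th02 \<equiv> tensor_hom K A B U0 U2 X0 X2"
private abbreviation (input) "tm01 \<equiv> tensor_map K A B C U0 U1 X0 X1"
private abbreviation (input) "tm12 \<equiv> tensor_map K A B C U1 U2 X1 X2"
private abbreviation (input) "tm02 \<equiv> tensor_map K A B C U0 U2 X0 X2"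

private lemmas alg = algA algB algC
private lemmas bim01 = U0 U1 X0 X1 and bim12 = U1 U2 X1 X2 and bim02 = U0 U2 X0 X2
private lemmas aU01 = algB algC U0 U1 and aU12 = algB algC U1 U2 and aU02 = algB algC U0 U2
private lemmas aX01 = algA algB X0 X1 and aX12 = algA algB X1 X2 and aX02 = algA algB X0 X2
private lemmas W0 = tensor_over_dg_bimodule[OF alg U0 X0]
private lemmas W1 = tensor_over_dg_bimodule[OF alg U1 X1]
private lemmas W2 = tensor_over_dg_bimodule[OF alg U2 X2]
private lemmas compose_closed_U = compose_closed[OF algB algC U0 U1 U2]
private lemmas compose_closed_X = compose_closed[OF algA algB X0 X1 X2]

text \<open>
  On \<open>u \<otimes> x\<close> both sides carry the sign with exponent \<open>|\<phi>2| |u| + |\<phi>1| (|u| + |\<alpha>2|)\<close>: on the left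
  \<open>\<phi>1\<close> passes \<open>\<alpha>2 u\<close>, on the right its passage past \<open>\<alpha>2\<close> is the sign in the composition of tensors.
\<close>

lemma tensor_hom_Cmp:
  assumes \<alpha>1: "\<alpha>1 \<in> DU12 p1" and \<phi>1: "\<phi>1 \<in> DX12 q1" and \<alpha>2: "\<alpha>2 \<in> DU01 p2" and \<phi>2: "\<phi>2 \<in> DX01 q2"
  shows "compose (carrier W0) (th12 \<alpha>1 \<phi>1) (th01 \<alpha>2 \<phi>2) =
    ksign HW02 (p2 * q1) (th02 (compose (carrier U0) \<alpha>1 \<alpha>2) (compose (carrier X0) \<phi>1 \<phi>2))"
proof (rule over_hom_eqI[OF alg bim02])
  note mW1 = W_module[OF alg U1 X1] and mW2 = W_module[OF alg U2 X2]
  interpret W2: module K W2 by (rule mW2)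
  interpret H: module K HW02 by (rule hom_module[OF algA algC W0 W2])
  note c1 = deg_closed[OF aU12 \<alpha>1] deg_closed[OF aX12 \<phi>1] and c2 = deg_closed[OF aU01 \<alpha>2] deg_closed[OF aX01 \<phi>2]
  note d12 = compose_deg[OF algB algC U0 U1 U2 \<alpha>1 \<alpha>2] compose_deg[OF algA algB X0 X1 X2 \<phi>1 \<phi>2]
  note c12 = deg_closed[OF aU02 d12(1)] deg_closed[OF aX02 d12(2)]
  note th1 = tensor_hom_closed[OF alg bim12 c1] and th2 = tensor_hom_closed[OF alg bim01 c2]
  note th = tensor_hom_closed[OF alg bim02 c12]
  let ?gf = "compose (carrier W0) (th12 \<alpha>1 \<phi>1) (th01 \<alpha>2 \<phi>2)"
  let ?h = "th02 (compose (carrier U0) \<alpha>1 \<alpha>2) (compose (carrier X0) \<phi>1 \<phi>2)"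
  show "?gf \<in> carrier HW02" by (rule compose_closed[OF algA algC W0 W1 W2 th1 th2])
  show "ksign HW02 (p2 * q1) ?h \<in> carrier HW02" by (rule H.ksign_closed[OF th])
  fix r s u x assume u: "u \<in> grade U0 r" and x: "x \<in> grade X0 s"
  note uc = dg_bimodule.bimod_grade_closed[OF U0 u] and xc = dg_bimodule.bimod_grade_closed[OF X0 x]
  note w = over_tens_closed[OF alg U0 X0 uc xc]
  note \<alpha>u = hom_apply_closed[OF aU01 c2(1) uc] and \<phi>x = hom_apply_closed[OF aX01 c2(2) xc]
  note t1 = over_tens_closed[OF alg U1 X1 \<alpha>u \<phi>x]
  let ?t = "tens_over K B U2 X2 (\<alpha>1 (\<alpha>2 u)) (\<phi>1 (\<phi>2 x))"
  have t: "?t \<in> carrier W2"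
    by (rule over_tens_closed[OF alg U2 X2 hom_apply_closed[OF aU12 c1(1) \<alpha>u] hom_apply_closed[OF aX12 c1(2) \<phi>x]])
  have "?gf (tens_over K B U0 X0 u x) = ksign W2 (q2 * r + q1 * (r + p2)) ?t"
    using w t by (simp add: compose_eq tensor_hom_tens[OF alg bim01 c2(1) \<phi>2 u xc]
        linear_map_ksign[OF mW1 mW2 hom_linear[OF algA algC W1 W2 th1] t1]
        tensor_hom_tens[OF alg bim12 c1(1) \<phi>1 bimod_hom_degD(3)[OF \<alpha>2 u] \<phi>x] W2.ksign_simps)
  also have "\<dots> = ksign W2 (p2 * q1 + (q1 + q2) * r) ?t"
    by (rule ksign_cong) (simp add: algebra_simps)
  also have "\<dots> = ksign HW02 (p2 * q1) ?h (tens_over K B U0 X0 u x)"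
    using t by (simp add: hom_ksign[OF algA algC W0 W2 th w] tensor_hom_tens[OF alg bim02 c12(1) d12(2) u xc]
        compose_eq uc xc W2.ksign_simps)
  finally show "?gf (tens_over K B U0 X0 u x) = ksign HW02 (p2 * q1) ?h (tens_over K B U0 X0 u x)" .
qed

lemma tensor_map_Cmp:
  defines "CB \<equiv> Dg_bimod K C B :: (('k, 'c, 'b, 'u) dgbimod, 'k, 'u \<Rightarrow> 'u) dgcat"
    and "BA \<equiv> Dg_bimod K B A :: (('k, 'b, 'a, 'x) dgbimod, 'k, 'x \<Rightarrow> 'x) dgcat"
  assumes z: "z \<in> carrier (dg_tensor K HU12 HX12)" and w: "w \<in> carrier (dg_tensor K HU01 HX01)"
  shows "tm02 (Cmp (dgcat_tensor K CB BA) (U0, X0) (U1, X1) (U2, X2) z w) = compose (carrier W0) (tm12 z) (tm01 w)"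
proof -
  have CB: "dg_category K CB" and BA: "dg_category K BA"
    unfolding CB_def BA_def by (rule dg_category_Dg_bimod[OF algB algC] dg_category_Dg_bimod[OF algA algB])+
  have o: "(U0, X0) \<in> Obj CB \<times> Obj BA" "(U1, X1) \<in> Obj CB \<times> Obj BA" "(U2, X2) \<in> Obj CB \<times> Obj BA"
    using U0 U1 U2 X0 X1 X2 by (simp_all add: CB_def BA_def Dg_bimod_simps)
  have hom: "Hom CB = bimod_hom K C B" "Hom BA = bimod_hom K B A"
    by (simp_all add: CB_def BA_def Dg_bimod_def)
  have cmp: "Cmp CB U0 U1 U2 g f = compose (carrier U0) g f" "Cmp BA X0 X1 X2 g' f' = compose (carrier X0) g' f'" for g f g' f'
    by (simp_all add: CB_def BA_def Dg_bimod_simps)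
  let ?C = "Cmp (dgcat_tensor K CB BA) (U0, X0) (U1, X1) (U2, X2)"
  note dg01 = hom_dg_module[OF aU01] hom_dg_module[OF aX01] and dg12 = hom_dg_module[OF aU12] hom_dg_module[OF aX12]
  note dg02 = hom_dg_module[OF aU02] hom_dg_module[OF aX02]
  note mH = hom_module[OF algA algC W0 W2] and mT = dg_tensor_module[OF dg02]
  note F01 = tensor_map_linear[OF alg bim01] and F12 = tensor_map_linear[OF alg bim12] and F02 = tensor_map_linear[OF alg bim02]
  note bil = dgcat_tensor_Cmp_bilinear[OF CB BA o, unfolded hom fst_conv snd_conv]
  note cbil = compose_bilinear[OF algA algC W0 W1 W2]
  show ?thesis
  proof (rule dg_tensor_eqI[OF dg12 mH linear_map_comp[OF bilinear_map_left[OF bil w] F02]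
        linear_map_comp[OF F12 bilinear_map_left[OF cbil linear_map_closed[OF F01 w]]] _ z])
    fix p1 q1 \<alpha>1 \<phi>1 assume g1: "\<alpha>1 \<in> grade HU12 p1" "\<phi>1 \<in> grade HX12 q1"
    have d1: "\<alpha>1 \<in> DU12 p1" "\<phi>1 \<in> DX12 q1" using g1 by (simp_all add: bimod_hom_simps(5))
    note c1 = deg_closed[OF aU12 d1(1)] deg_closed[OF aX12 d1(2)]
    let ?t1 = "tens K HU12 HX12 \<alpha>1 \<phi>1"
    note t1 = dg_tens_closed[OF dg12 c1]
    show "tm02 (?C ?t1 w) = compose (carrier W0) (tm12 ?t1) (tm01 w)"
    proof (rule dg_tensor_eqI[OF dg01 mH linear_map_comp[OF bilinear_map_right[OF bil t1] F02]
          linear_map_comp[OF F01 bilinear_map_right[OF cbil linear_map_closed[OF F12 t1]]] _ w])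
      fix p2 q2 \<alpha>2 \<phi>2 assume g2: "\<alpha>2 \<in> grade HU01 p2" "\<phi>2 \<in> grade HX01 q2"
      have d2: "\<alpha>2 \<in> DU01 p2" "\<phi>2 \<in> DX01 q2" using g2 by (simp_all add: bimod_hom_simps(5))
      note c2 = deg_closed[OF aU01 d2(1)] deg_closed[OF aX01 d2(2)]
      let ?t2 = "tens K HU01 HX01 \<alpha>2 \<phi>2"
      note c12 = compose_closed_U[OF c1(1) c2(1)] compose_closed_X[OF c1(2) c2(2)]
      have "?C ?t1 ?t2 = ksign (dg_tensor K HU02 HX02) (p2 * q1)
          (tens K HU02 HX02 (compose (carrier U0) \<alpha>1 \<alpha>2) (compose (carrier X0) \<phi>1 \<phi>2))"
        using dgcat_tensor_Cmp_tens[OF CB BA o, unfolded hom fst_conv snd_conv cmp, OF c1(1) g1(2) g2(1) c2(2)] .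
      then show "tm02 (?C ?t1 ?t2) = compose (carrier W0) (tm12 ?t1) (tm01 ?t2)"
        by (simp add: linear_map_ksign[OF mT mH F02 dg_tens_closed[OF dg02 c12]] tensor_map_tens[OF alg bim02 c12]
            tensor_map_tens[OF alg bim12 c1] tensor_map_tens[OF alg bim01 c2] tensor_hom_Cmp[OF d1 d2])
    qed
  qed
qed

end

end

theorem proposition8p4:
  fixes K :: "'k ring"
    and A :: "('k, 'a) dgmod" and I\<^sub>A :: "'i set" and e\<^sub>A :: "'i \<Rightarrow> 'a"
    and B :: "('k, 'b) dgmod" and I\<^sub>B :: "'j set" and e\<^sub>B :: "'j \<Rightarrow> 'b"
    and C :: "('k, 'c) dgmod" and I\<^sub>C :: "'l set" and e\<^sub>C :: "'l \<Rightarrow> 'c"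
  defines "CB \<equiv> Dg_bimod K C B :: (('k, 'c, 'b, 'u) dgbimod, 'k, 'u \<Rightarrow> 'u) dgcat"
    and "BA \<equiv> Dg_bimod K B A :: (('k, 'b, 'a, 'x) dgbimod, 'k, 'x \<Rightarrow> 'x) dgcat"
  assumes "cring K"
    and "dg_algebra_idem K A I\<^sub>A e\<^sub>A"
    and "dg_algebra_idem K B I\<^sub>B e\<^sub>B"
    and "dg_algebra_idem K C I\<^sub>C e\<^sub>C"
  shows "\<exists>F. dg_functor K (dgcat_tensor K CB BA) (Dg_bimod K C A)
               (\<lambda>(U, X). tensor_over K B U X) F \<and>
             (\<forall>U\<in>Obj CB. \<forall>V\<in>Obj CB. \<forall>X\<in>Obj BA. \<forall>Y\<in>Obj BA. \<forall>p q r.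
                \<forall>\<alpha>\<in>grade (Hom CB U V) p. \<forall>\<phi>\<in>grade (Hom BA X Y) q.
                \<forall>u\<in>grade U r. \<forall>x\<in>carrier X.
                  F (U, X) (V, Y) (tens K (Hom CB U V) (Hom BA X Y) \<alpha> \<phi>) (tens_over K B U X u x) =
                    ksign (tensor_over K B V Y) (q * r) (tens_over K B V Y (\<alpha> u) (\<phi> x)))"
proof (intro exI conjI)
  note algA = assms(4) and algB = assms(5) and algC = assms(6)
  note alg = algA algB algC
  let ?F = "\<lambda>(U, X) (V, Y). tensor_map K A B C U V X Y"
  have CB: "dg_category K CB" and BA: "dg_category K BA"
    unfolding CB_def BA_def by (rule dg_category_Dg_bimod[OF algB algC] dg_category_Dg_bimod[OF algA algB])+
  have obj: "Obj (dgcat_tensor K CB BA) = {U. dg_bimodule K C B U} \<times> {X. dg_bimodule K B A X}"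
    unfolding dgcat_tensor_simps[OF CB BA] by (simp add: CB_def BA_def Dg_bimod_simps)
  have hom: "Hom (dgcat_tensor K CB BA) P Q = dg_tensor K (bimod_hom K C B (fst P) (fst Q)) (bimod_hom K B A (snd P) (snd Q))" for P Q
    unfolding dgcat_tensor_simps[OF CB BA] by (simp add: CB_def BA_def Dg_bimod_simps)
  have idn: "Idn (dgcat_tensor K CB BA) P = tens K (bimod_hom K C B (fst P) (fst P)) (bimod_hom K B A (snd P) (snd P))
      (\<lambda>u\<in>carrier (fst P). u) (\<lambda>x\<in>carrier (snd P). x)" for P
    unfolding dgcat_tensor_simps[OF CB BA] by (simp add: CB_def BA_def Dg_bimod_simps)
  show "dg_functor K (dgcat_tensor K CB BA) (Dg_bimod K C A) (\<lambda>(U, X). tensor_over K B U X) ?F"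
  proof (rule dg_functor.intro)
    show "dg_category K (dgcat_tensor K CB BA)" by (rule dg_category_dgcat_tensor[OF CB BA])
    show "dg_category K (Dg_bimod K C A)" by (rule dg_category_Dg_bimod[OF algA algC])
    show "dg_functor_axioms K (dgcat_tensor K CB BA) (Dg_bimod K C A) (\<lambda>(U, X). tensor_over K B U X) ?F"
    proof
      fix P assume "P \<in> Obj (dgcat_tensor K CB BA)"
      then obtain U X where P: "P = (U, X)" and U: "dg_bimodule K C B U" and X: "dg_bimodule K B A X"
        unfolding obj by auto
      show "(case P of (U, X) \<Rightarrow> tensor_over K B U X) \<in> Obj (Dg_bimod K C A)"
        using tensor_over_dg_bimodule[OF alg U X] by (simp add: P Dg_bimod_simps)
      have "?F P P (Idn (dgcat_tensor K CB BA) P) = tensor_hom K A B U U X X (\<lambda>u\<in>carrier U. u) (\<lambda>x\<in>carrier X. x)"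
        unfolding P idn fst_conv snd_conv prod.case
        by (rule tensor_map_tens[OF alg U U X X deg_closed[OF algB algC U U identity_deg[OF algB algC U]]
              deg_closed[OF algA algB X X identity_deg[OF algA algB X]]])
      then show "?F P P (Idn (dgcat_tensor K CB BA) P) = Idn (Dg_bimod K C A) (case P of (U, X) \<Rightarrow> tensor_over K B U X)"
        by (simp add: tensor_hom_identity[OF alg U X] P Dg_bimod_simps)
    next
      fix P Q assume "P \<in> Obj (dgcat_tensor K CB BA)" "Q \<in> Obj (dgcat_tensor K CB BA)"
      then obtain U X V Y where P: "P = (U, X)" and U: "dg_bimodule K C B U" and X: "dg_bimodule K B A X"
        and Q: "Q = (V, Y)" and V: "dg_bimodule K C B V" and Y: "dg_bimodule K B A Y"
        unfolding obj by auto
      show "linear_map K (Hom (dgcat_tensor K CB BA) P Q) (Hom (Dg_bimod K C A) (case P of (U, X) \<Rightarrow> tensor_over K B U X)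
          (case Q of (U, X) \<Rightarrow> tensor_over K B U X)) (?F P Q)"
        using tensor_map_linear[OF alg U V X Y] by (simp add: hom P Q Dg_bimod_simps)
      show "?F P Q f \<in> grade (Hom (Dg_bimod K C A) (case P of (U, X) \<Rightarrow> tensor_over K B U X)
          (case Q of (U, X) \<Rightarrow> tensor_over K B U X)) n" if "f \<in> grade (Hom (dgcat_tensor K CB BA) P Q) n" for f n
        using tensor_map_degree[OF alg U V X Y] that by (simp add: hom P Q Dg_bimod_simps)
      show "?F P Q (diff (Hom (dgcat_tensor K CB BA) P Q) f) = diff (Hom (Dg_bimod K C A)
          (case P of (U, X) \<Rightarrow> tensor_over K B U X) (case Q of (U, X) \<Rightarrow> tensor_over K B U X)) (?F P Q f)"
        if "f \<in> carrier (Hom (dgcat_tensor K CB BA) P Q)" for f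
        using tensor_map_diff[OF alg U V X Y] that by (simp add: hom P Q Dg_bimod_simps)
    next
      fix P Q R g f assume "P \<in> Obj (dgcat_tensor K CB BA)" "Q \<in> Obj (dgcat_tensor K CB BA)" "R \<in> Obj (dgcat_tensor K CB BA)"
        and g: "g \<in> carrier (Hom (dgcat_tensor K CB BA) Q R)" and f: "f \<in> carrier (Hom (dgcat_tensor K CB BA) P Q)"
      then obtain U X U' X' U'' X'' where P: "P = (U, X)" and U: "dg_bimodule K C B U" and X: "dg_bimodule K B A X"
        and Q: "Q = (U', X')" and U': "dg_bimodule K C B U'" and X': "dg_bimodule K B A X'"
        and R: "R = (U'', X'')" and U'': "dg_bimodule K C B U''" and X'': "dg_bimodule K B A X''"
        unfolding obj by auto
      show "?F P R (Cmp (dgcat_tensor K CB BA) P Q R g f) = Cmp (Dg_bimod K C A) (case P of (U, X) \<Rightarrow> tensor_over K B U X)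
          (case Q of (U, X) \<Rightarrow> tensor_over K B U X) (case R of (U, X) \<Rightarrow> tensor_over K B U X) (?F Q R g) (?F P Q f)"
        using tensor_map_Cmp[OF alg U U' U'' X X' X'' g[unfolded hom Q R fst_conv snd_conv] f[unfolded hom P Q fst_conv snd_conv]]
        by (simp add: P Q R Dg_bimod_simps CB_def BA_def)
    qed
  qed
  show "\<forall>U\<in>Obj CB. \<forall>V\<in>Obj CB. \<forall>X\<in>Obj BA. \<forall>Y\<in>Obj BA. \<forall>p q r.
      \<forall>\<alpha>\<in>grade (Hom CB U V) p. \<forall>\<phi>\<in>grade (Hom BA X Y) q. \<forall>u\<in>grade U r. \<forall>x\<in>carrier X.
        ?F (U, X) (V, Y) (tens K (Hom CB U V) (Hom BA X Y) \<alpha> \<phi>) (tens_over K B U X u x) =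
          ksign (tensor_over K B V Y) (q * r) (tens_over K B V Y (\<alpha> u) (\<phi> x))"
  proof (intro ballI allI)
    fix U V X Y p q r \<alpha> \<phi> u x
    assume "U \<in> Obj CB" "V \<in> Obj CB" "X \<in> Obj BA" "Y \<in> Obj BA"
      and "\<alpha> \<in> grade (Hom CB U V) p" "\<phi> \<in> grade (Hom BA X Y) q" and u: "u \<in> grade U r" and x: "x \<in> carrier X"
    then have U: "dg_bimodule K C B U" and V: "dg_bimodule K C B V" and X: "dg_bimodule K B A X" and Y: "dg_bimodule K B A Y"
      and \<alpha>: "\<alpha> \<in> bimod_hom_deg K C B U V p" and \<phi>: "\<phi> \<in> bimod_hom_deg K B A X Y q"
      by (simp_all add: CB_def BA_def Dg_bimod_simps bimod_hom_simps(5))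
    note \<alpha>c = deg_closed[OF algB algC U V \<alpha>] and \<phi>c = deg_closed[OF algA algB X Y \<phi>]
    show "?F (U, X) (V, Y) (tens K (Hom CB U V) (Hom BA X Y) \<alpha> \<phi>) (tens_over K B U X u x) =
          ksign (tensor_over K B V Y) (q * r) (tens_over K B V Y (\<alpha> u) (\<phi> x))"
      unfolding CB_def BA_def Dg_bimod_simps prod.case tensor_map_tens[OF alg U V X Y \<alpha>c \<phi>c]
      by (rule tensor_hom_tens[OF alg U V X Y \<alpha>c \<phi> u x])
  qed
qed

end
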